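(* Let $a_n\to\infty$, let $t=t_n$ be determined by $m(t)=a_n$, and write $s=s(t)$, $\mu_3=\mu_3(t)$. (1) If $0<\liminf_{n\to\infty}\frac{a_n}{s\sqrt n}\le\limsup_{n\to\infty}\frac{a_n}{s\sqrt n}<\infty$, then the total variation norm between $P_{a_n}$ and $G_{a_n}$ goes to $0$ as $n\to\infty$. (2) If $\lim_{n\to\infty}\frac{a_n}{s\sqrt n}=0$, then the total variation norm between $P_{a_n}$ and $\Pi^{a_n}$ goes to $0$ as $n\to\infty$. Here $P_{a_n}$, $\Pi^{a_n}$ and $G_{a_n}$ are the probability measures with densities $p_{a_n}$, $\pi^{a_n}$ and $g_{a_n}$ respectively, where $$g_{a_n}(x):=C\,p(x)\,\mathfrak{n}(\alpha\beta+a_n,\beta,x),\qquad \alpha:=t+\frac{\mu_3}{2(n-1)s^2},\qquad \beta:=(n-1)s^2,$$ $\mathfrak{n}(\mu,\sigma^2,x)$ is the normal density with expectation $\mu$ and variance $\sigma^2$ evaluated at $x$, and $C=C_n$ is the normalizing constant.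
   Context: Standing setting. $X_1,X_2,\dots$ are i.i.d. non-negative unbounded random variables with density $p$ on $\mathbb{R}_+$ of the form $p(x)=\exp(-(g(x)-q(x)))$, $x\ge 0$ ($p=0$ on $(-\infty,0)$), where $g$ is positive, convex, four times differentiable, $g(x)/x\to\infty$ as $x\to\infty$, and $q$ is bounded. Put $h=g'$ and let $\psi=h^{\leftarrow}$ be the inverse of $h$ (for large arguments). $RV(\alpha)$ denotes the functions on $\mathbb{R}_+$ regularly varying at infinity with index $\alpha$. It is assumed that $h\in\mathcal{R}$, i.e. one of the following holds. (Regularly varying case) $h(x)=x^{\beta_0}l(x)$ for some $\beta_0>0$, with $l(x)=c\exp\int_1^x\frac{\epsilon(u)}{u}du$, $c>0$, $\epsilon$ twice differentiable, $\epsilon(x)=o(1)$, $x|\epsilon'(x)|=O(1)$, $x^2|\epsilon''(x)|=O(1)$ as $x\to\infty$; moreover $|h''|\in RV(\theta)$ for some real $\theta\le\beta_0-2$, and $|q|\in RV(\eta)$ for some $\eta<\theta-\frac{3\beta_0}{2}-\frac32$. (Rapidly varying case) $h$ is rapidly varying at infinity, $\psi\in RV(0)$ with $\psi(t)=c\exp\int_1^t\frac{\epsilon(u)}{u}du$, $c>0$, $\epsilon$ twice differentiable, $\epsilon(t)=o(1)$, $t\epsilon'(t)/\epsilon(t)\to0$, $t^2\epsilon''(t)/\epsilon(t)\to0$ as $t\to\infty$; moreover $|q(\psi(t))|\in RV(\eta)$ as a function of $t$, for some $\eta<-\frac12$. $\Phi(t)=E[e^{tX_1}]$ (finite for all $t\ge0$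 and in a neighborhood of $0$), $m(t)=\frac{d}{dt}\log\Phi(t)$, $s^2(t)=m'(t)$ with $s(t)>0$, $\mu_3(t)=\frac{d^3}{dt^3}\log\Phi(t)$. The tilted density is $\pi_t(x)=e^{tx}p(x)/\Phi(t)$; for $a$ in the range of $m$, $\pi^a:=\pi_t$ where $t$ is the unique solution of $m(t)=a$. $S_1^n=X_1+\dots+X_n$; $p_{a_n}(\cdot)=p(X_1=\cdot\mid S_1^n=na_n)$ is the conditional density of $X_1$ given $S_1^n=na_n$. *)

theory Defs
  imports "HOL-Probability.Probability" "HOL-Library.Landau_Symbols"
begin

section \<open>Regular and rapid variation at infinity\<close>

text \<open>Positivity and measurability are only required on a neighbourhood of infinity; in particular
  membership says nothing about the (arbitrary) values of a total function outside its domain.\<close>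

definition eventually_pos_measurable :: "(real \<Rightarrow> real) \<Rightarrow> bool" where
  "eventually_pos_measurable f \<longleftrightarrow>
     (\<exists>A. (\<forall>x\<ge>A. f x > 0) \<and> f \<in> borel_measurable (restrict_space borel {A..}))"

definition RV :: "real \<Rightarrow> (real \<Rightarrow> real) set" where
  "RV \<rho> = {f. eventually_pos_measurable f \<and>
     (\<forall>b>0. ((\<lambda>x. f (b * x) / f x) \<longlongrightarrow> b powr \<rho>) at_top)}"

text \<open>For \<open>0 < b < 1\<close> the quotient then automatically tends to \<open>0\<close>.\<close>

definition rapidly_varying :: "(real \<Rightarrow> real) \<Rightarrow> bool" where
  "rapidly_varying f \<longleftrightarrow> eventually_pos_measurable f \<and>
     (\<forall>b>1. filterlim (\<lambda>x. f (b * x) / f x) at_top at_top)"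

section \<open>The class of functions h\<close>

definition has_two_derivs_on ::
    "(real \<Rightarrow> real) \<Rightarrow> (real \<Rightarrow> real) \<Rightarrow> (real \<Rightarrow> real) \<Rightarrow> real set \<Rightarrow> bool" where
  "has_two_derivs_on f f' f'' S \<longleftrightarrow>
     (\<forall>x\<in>S. (f has_real_derivative f' x) (at x within S) \<and>
            (f' has_real_derivative f'' x) (at x within S))"

text \<open>Karamata representation \<open>c exp (\<integral>\<^bsub>1\<^esub>\<^bsup>x\<^esup> \<epsilon>(u)/u du)\<close>, meaningful for \<open>x \<ge> 1\<close>.\<close>

definition karamata :: "real \<Rightarrow> (real \<Rightarrow> real) \<Rightarrow> real \<Rightarrow> real" where
  "karamata c \<epsilon> x = c * exp (integral {1..x} (\<lambda>u. \<epsilon> u / u))"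

definition inverse_at_infinity :: "(real \<Rightarrow> real) \<Rightarrow> (real \<Rightarrow> real) \<Rightarrow> bool" where
  "inverse_at_infinity h \<psi> \<longleftrightarrow>
     (\<forall>\<^sub>F t in at_top. h (\<psi> t) = t) \<and> (\<forall>\<^sub>F x in at_top. \<psi> (h x) = x)"

definition regularly_varying_case :: "(real \<Rightarrow> real) \<Rightarrow> (real \<Rightarrow> real) \<Rightarrow> bool" where
  "regularly_varying_case h q \<longleftrightarrow>
     (\<exists>\<beta>0 c \<theta> \<eta> \<epsilon> \<epsilon>' \<epsilon>''.
        \<beta>0 > 0 \<and> c > 0 \<and>
        has_two_derivs_on \<epsilon> \<epsilon>' \<epsilon>'' {1..} \<and>
        (\<forall>x\<ge>1. h x = x powr \<beta>0 * karamata c \<epsilon> x) \<and>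
        \<epsilon> \<in> o(\<lambda>_. 1) \<and>
        (\<lambda>x. x * \<bar>\<epsilon>' x\<bar>) \<in> O(\<lambda>_. 1) \<and>
        (\<lambda>x. x\<^sup>2 * \<bar>\<epsilon>'' x\<bar>) \<in> O(\<lambda>_. 1) \<and>
        \<theta> \<le> \<beta>0 - 2 \<and> (\<lambda>x. \<bar>(deriv ^^ 2) h x\<bar>) \<in> RV \<theta> \<and>
        \<eta> < \<theta> - 3 * \<beta>0 / 2 - 3 / 2 \<and> (\<lambda>x. \<bar>q x\<bar>) \<in> RV \<eta>)"

text \<open>Since \<open>\<psi>\<close> is the inverse of \<open>h\<close> for large arguments only, its representation is required
  only there: for \<open>h x = exp x\<close> one has \<open>\<psi> t = ln t\<close>, which vanishes at \<open>t = 1\<close>.\<close>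

definition rapidly_varying_case :: "(real \<Rightarrow> real) \<Rightarrow> (real \<Rightarrow> real) \<Rightarrow> bool" where
  "rapidly_varying_case h q \<longleftrightarrow>
     rapidly_varying h \<and>
     (\<exists>\<psi> c \<eta> \<epsilon> \<epsilon>' \<epsilon>''.
        inverse_at_infinity h \<psi> \<and> \<psi> \<in> RV 0 \<and> c > 0 \<and>
        has_two_derivs_on \<epsilon> \<epsilon>' \<epsilon>'' {1..} \<and>
        (\<forall>\<^sub>F t in at_top. \<psi> t = karamata c \<epsilon> t) \<and>
        (\<forall>\<^sub>F t in at_top. \<epsilon> t \<noteq> 0) \<and>
        \<epsilon> \<in> o(\<lambda>_. 1) \<and>
        ((\<lambda>t. t * \<epsilon>' t / \<epsilon> t) \<longlongrightarrow> 0) at_top \<and>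
        ((\<lambda>t. t\<^sup>2 * \<epsilon>'' t / \<epsilon> t) \<longlongrightarrow> 0) at_top \<and>
        \<eta> < - (1 / 2) \<and> (\<lambda>t. \<bar>q (\<psi> t)\<bar>) \<in> RV \<eta>)"

definition class_R :: "(real \<Rightarrow> real) \<Rightarrow> (real \<Rightarrow> real) \<Rightarrow> bool" where
  "class_R h q \<longleftrightarrow> regularly_varying_case h q \<or> rapidly_varying_case h q"

section \<open>Moment generating function, cumulants and tilting\<close>

definition mgf :: "'w measure \<Rightarrow> ('w \<Rightarrow> real) \<Rightarrow> real \<Rightarrow> real" where
  "mgf M Y t = (\<integral>\<omega>. exp (t * Y \<omega>) \<partial>M)"

definition tilted_mean :: "'w measure \<Rightarrow> ('w \<Rightarrow> real) \<Rightarrow> real \<Rightarrow> real" where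
  "tilted_mean M Y = deriv (\<lambda>t. ln (mgf M Y t))"

definition tilted_sd :: "'w measure \<Rightarrow> ('w \<Rightarrow> real) \<Rightarrow> real \<Rightarrow> real" where
  "tilted_sd M Y t = sqrt (deriv (tilted_mean M Y) t)"

definition tilted_mu3 :: "'w measure \<Rightarrow> ('w \<Rightarrow> real) \<Rightarrow> real \<Rightarrow> real" where
  "tilted_mu3 M Y = (deriv ^^ 3) (\<lambda>t. ln (mgf M Y t))"

definition tilted_density :: "'w measure \<Rightarrow> ('w \<Rightarrow> real) \<Rightarrow> (real \<Rightarrow> real) \<Rightarrow> real \<Rightarrow> real \<Rightarrow> real" where
  "tilted_density M Y p t x = exp (t * x) * p x / mgf M Y t"

definition tilted_measure :: "'w measure \<Rightarrow> ('w \<Rightarrow> real) \<Rightarrow> (real \<Rightarrow> real) \<Rightarrow> real \<Rightarrow> real measure" where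
  "tilted_measure M Y p t = density lborel (\<lambda>x. ennreal (tilted_density M Y p t x))"

section \<open>Conditional law of a summand given the sum\<close>

text \<open>Density of a sum of \<open>n\<close> independent variables with density \<open>f\<close>; for \<open>n = 0\<close> there is none.
  For a bounded density \<open>f\<close> and \<open>n \<ge> 2\<close> this is the continuous version of the density of the sum.\<close>

fun conv_pow :: "(real \<Rightarrow> ennreal) \<Rightarrow> nat \<Rightarrow> real \<Rightarrow> ennreal" where
  "conv_pow f 0 = (\<lambda>_. 0)"
| "conv_pow f (Suc 0) = f"
| "conv_pow f (Suc (Suc n)) = (\<lambda>x. \<integral>\<^sup>+y. f (x - y) * conv_pow f (Suc n) y \<partial>lborel)"

text \<open>Joint density of \<open>(X\<^sub>1, S\<^sub>n)\<close> divided by the density of \<open>S\<^sub>n\<close>, for \<open>n \<ge> 2\<close>;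
  see \<open>distributed_conv_pow\<close> and \<open>distributed_summand_and_sum\<close> below.\<close>

definition cond_density :: "(real \<Rightarrow> ennreal) \<Rightarrow> nat \<Rightarrow> real \<Rightarrow> real \<Rightarrow> ennreal" where
  "cond_density f n z x = f x * conv_pow f (n - 1) (z - x) / conv_pow f n z"

definition cond_measure :: "(real \<Rightarrow> real) \<Rightarrow> nat \<Rightarrow> real \<Rightarrow> real measure" where
  "cond_measure p n a = density lborel (cond_density (\<lambda>x. ennreal (p x)) n (real n * a))"

lemma (in prob_space) distributed_conv_pow:
  fixes X :: "'i \<Rightarrow> 'a \<Rightarrow> real"
  assumes "finite I" "I \<noteq> {}" "indep_vars (\<lambda>_. borel) X I"
    and "\<And>i. i \<in> I \<Longrightarrow> distributed M lborel (X i) f"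
  shows "distributed M lborel (\<lambda>\<omega>. \<Sum>i\<in>I. X i \<omega>) (conv_pow f (card I))"
  using assms
proof (induction I rule: finite_ne_induct)
  case (singleton i)
  then show ?case by simp
next
  case (insert i I)
  have indep: "indep_vars (\<lambda>_. borel) X I"
    using insert.prems(1) by (rule indep_vars_subset) auto
  obtain k where k: "card I = Suc k"
    using insert.hyps(1,2) by (metis card_gt_0_iff gr0_conv_Suc)
  have "distributed M lborel (\<lambda>\<omega>. X i \<omega> + (\<Sum>i\<in>I. X i \<omega>))
          (\<lambda>x. \<integral>\<^sup>+y. f (x - y) * conv_pow f (card I) y \<partial>lborel)"
    using insert indep by (intro distributed_convolution indep_vars_sum) auto
  then show ?case
    using insert.hyps(1,3) k by simp
qed

lemma (in prob_space) distributed_summand_and_sum: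
  fixes X :: "nat \<Rightarrow> 'a \<Rightarrow> real"
  assumes n: "n \<ge> 2" and indep: "indep_vars (\<lambda>_. borel) X {1..n}"
    and X: "\<And>i. i \<in> {1..n} \<Longrightarrow> distributed M lborel (X i) f"
  shows "distributed M (lborel \<Otimes>\<^sub>M lborel) (\<lambda>\<omega>. (X 1 \<omega>, \<Sum>i=1..n. X i \<omega>))
           (\<lambda>(x, z). f x * conv_pow f (n - 1) (z - x))"
proof -
  have eq: "{1..n} = insert 1 {2..n}"
    using n by auto
  define T where "T = (\<lambda>\<omega>. \<Sum>i=2..n. X i \<omega>)"
  define k where "k = conv_pow f (n - 1)"
  have sum_eq: "(\<Sum>i=1..n. X i \<omega>) = X 1 \<omega> + T \<omega>" for \<omega>
    unfolding eq T_def by simp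
  have dX: "distributed M lborel (X 1) f"
    using X n by simp
  have "distributed M lborel T (conv_pow f (card {2..n}))"
    unfolding T_def using n X by (intro distributed_conv_pow indep_vars_subset[OF indep]) auto
  then have dT: "distributed M lborel T k"
    unfolding k_def using n by simp
  have ind: "indep_var lborel (X 1) lborel T"
  proof -
    have "indep_var borel (X 1) borel T"
      unfolding T_def using indep unfolding eq by (intro indep_vars_sum) auto
    from indep_var_compose[OF this, of "\<lambda>x. x" lborel "\<lambda>x. x" lborel] show ?thesis
      by (simp add: o_def)
  qed
  have joint: "distributed M (lborel \<Otimes>\<^sub>M lborel) (\<lambda>\<omega>. (X 1 \<omega>, T \<omega>)) (\<lambda>(x, y). f x * k y)"
    by (intro distributed_joint_indep dX dT ind lborel.sigma_finite_measure_axioms)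
  have [measurable]: "f \<in> borel_measurable borel" "k \<in> borel_measurable borel"
      "X 1 \<in> borel_measurable M" "T \<in> borel_measurable M"
    using dX dT by (auto simp: distributed_def)
  show ?thesis
    unfolding distributed_def sum_eq k_def[symmetric]
  proof (intro conjI)
    show "distr M (lborel \<Otimes>\<^sub>M lborel) (\<lambda>\<omega>. (X 1 \<omega>, X 1 \<omega> + T \<omega>)) =
        density (lborel \<Otimes>\<^sub>M lborel) (\<lambda>(x, z). f x * k (z - x))"
    proof (rule measure_eqI)
      fix A assume "A \<in> sets (distr M (lborel \<Otimes>\<^sub>M lborel) (\<lambda>\<omega>. (X 1 \<omega>, X 1 \<omega> + T \<omega>)))"
      then have A[measurable]: "A \<in> sets (borel \<Otimes>\<^sub>M borel)"
        by (simp cong: sets_pair_measure_cong)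
      have "emeasure (distr M (lborel \<Otimes>\<^sub>M lborel) (\<lambda>\<omega>. (X 1 \<omega>, X 1 \<omega> + T \<omega>))) A =
          (\<integral>\<^sup>+\<omega>. indicator A (X 1 \<omega>, X 1 \<omega> + T \<omega>) \<partial>M)"
        by (subst nn_integral_indicator[symmetric], simp cong: sets_pair_measure_cong)
           (subst nn_integral_distr, measurable)
      also have "\<dots> = (\<integral>\<^sup>+u. (case u of (x, y) \<Rightarrow> f x * k y) *
            (case u of (x, y) \<Rightarrow> indicator A (x, x + y)) \<partial>(lborel \<Otimes>\<^sub>M lborel))"
        by (subst distributed_nn_integral[OF joint]) auto
      also have "\<dots> = (\<integral>\<^sup>+x. \<integral>\<^sup>+y. f x * k y * indicator A (x, x + y) \<partial>lborel \<partial>lborel)"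
        by (subst lborel.nn_integral_fst[symmetric]) auto
      also have "\<dots> = (\<integral>\<^sup>+x. \<integral>\<^sup>+z. f x * k (z - x) * indicator A (x, z) \<partial>lborel \<partial>lborel)"
      proof (rule nn_integral_cong)
        fix x :: real
        show "(\<integral>\<^sup>+y. f x * k y * indicator A (x, x + y) \<partial>lborel) =
              (\<integral>\<^sup>+z. f x * k (z - x) * indicator A (x, z) \<partial>lborel)"
          using nn_integral_real_affine[of "\<lambda>z. f x * k (z - x) * indicator A (x, z)" 1 x] by simp
      qed
      also have "\<dots> = emeasure (density (lborel \<Otimes>\<^sub>M lborel) (\<lambda>(x, z). f x * k (z - x))) A"
        by (subst emeasure_density, simp, simp, subst lborel.nn_integral_fst[symmetric]) auto
      finally show "emeasure (distr M (lborel \<Otimes>\<^sub>M lborel) (\<lambda>\<omega>. (X 1 \<omega>, X 1 \<omega> + T \<omega>))) A =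
          emeasure (density (lborel \<Otimes>\<^sub>M lborel) (\<lambda>(x, z). f x * k (z - x))) A" .
    qed simp
  qed measurable
qed

section \<open>The Gaussian-tilted law\<close>

text \<open>\<open>normal_density\<close> takes the standard deviation as its second argument, hence \<open>sqrt \<beta>\<close>.\<close>

definition gauss_tilt_weight :: "(real \<Rightarrow> real) \<Rightarrow> real \<Rightarrow> real \<Rightarrow> real \<Rightarrow> real \<Rightarrow> real" where
  "gauss_tilt_weight p a \<alpha> \<beta> x = p x * normal_density (\<alpha> * \<beta> + a) (sqrt \<beta>) x"

definition gauss_tilt_density :: "(real \<Rightarrow> real) \<Rightarrow> real \<Rightarrow> real \<Rightarrow> real \<Rightarrow> real \<Rightarrow> real" where
  "gauss_tilt_density p a \<alpha> \<beta> x =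
     gauss_tilt_weight p a \<alpha> \<beta> x / (\<integral>y. gauss_tilt_weight p a \<alpha> \<beta> y \<partial>lborel)"

definition gauss_tilt_measure ::
    "'w measure \<Rightarrow> ('w \<Rightarrow> real) \<Rightarrow> (real \<Rightarrow> real) \<Rightarrow> nat \<Rightarrow> real \<Rightarrow> real \<Rightarrow> real measure" where
  "gauss_tilt_measure M Y p n a t =
     (let s = tilted_sd M Y t;
          \<beta> = (real n - 1) * s\<^sup>2;
          \<alpha> = t + tilted_mu3 M Y t / (2 * (real n - 1) * s\<^sup>2)
      in density lborel (\<lambda>x. ennreal (gauss_tilt_density p a \<alpha> \<beta> x)))"

section \<open>Total variation\<close>

definition tv_dist :: "real measure \<Rightarrow> real measure \<Rightarrow> real" where
  "tv_dist P Q = (SUP A\<in>sets borel. \<bar>measure P A - measure Q A\<bar>)"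

end

theory Submission
  imports Defs "HOL-Real_Asymp.Real_Asymp"
begin

text \<open>Write \<open>\<pi>\<^sub>t\<close> for the tilted density with \<open>m(t) = a\<^sub>n\<close>. The law given the sum is invariant under tilting, so
the conditional density of one summand is the reweighting
\<open>\<pi>\<^sub>t(x) F(n a\<^sub>n - x) / N\<close>, where \<open>F\<close> is the density of the sum of \<open>n - 1\<close> independent variables
with density \<open>\<pi>\<^sub>t\<close>. Such a sum fluctuates on the scale \<open>s \<surd>n\<close>, while \<open>x\<close> fluctuates under \<open>\<pi>\<^sub>t\<close> only
on the scale \<open>s\<close>; hence the weight is nearly constant on the bulk of \<open>\<pi>\<^sub>t\<close>, and the conditional law
is close to \<open>\<pi>\<^sub>t\<close> in total variation. The density \<open>g\<close> of the Gaussian tilt is a reweighting of \<open>\<pi>\<^sub>t\<close>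
too: completing the square gives the weight
\<open>exp (\<kappa> (x - a\<^sub>n) - (x - a\<^sub>n)\<^sup>2 / (2 \<beta>))\<close> with \<open>\<kappa> = \<mu>\<^sub>3 / (2 (n - 1) s\<^sup>2)\<close>, which is nearly
constant as soon as \<open>s\<^sup>2 / n\<close> tends to \<open>0\<close>. In both cases \<open>reweighted_density_L1\<close> turns the near
constancy of the weight into a bound on the total variation distance.

What has to be made uniform is the local limit theorem, since \<open>t\<close> moves with \<open>n\<close>. As \<open>q\<close> is bounded,
\<open>\<pi>\<^sub>t\<close> is comparable, with constants depending only on the bound of \<open>q\<close>, to the log-concave density
proportional to \<open>exp (- (g x - t x))\<close>. Let \<open>w\<close> be the width of the level set on which \<open>g x - t x\<close> is
within \<open>1\<close> of its minimum. Convexity alone forces the rescaled density \<open>w \<pi>\<^sub>t(m(t) + w z)\<close> to have a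
uniform exponential tail and to be bounded below on an interval of length one
(\<open>convex_level_scale\<close>, \<open>tame_of_log_concave\<close>). On the class of centred densities with these two
properties, called tame below, the Fourier proof of the local limit theorem works with explicit
constants (\<open>local_limit_weighted\<close>): the tail controls the characteristic function near \<open>0\<close> through the
third moment, the lower bound keeps its modulus away from \<open>1\<close> elsewhere, and boundedness of the
density makes it square integrable.

The variation condition on \<open>h = g'\<close> enters through the single consequence \<open>x h'(x) \<rightarrow> \<infinity>\<close>
(\<open>x_deriv_h_at_top\<close>). It makes \<open>g\<close> so curved near the minimum that \<open>w\<^sup>2 / a\<^sub>n \<rightarrow> 0\<close>
(\<open>eventually_narrow\<close>). Since \<open>s\<close> and \<open>w\<close> are of the same order, boundedness of
\<open>a\<^sub>n / (s \<surd>n)\<close> then yields \<open>s\<^sup>2 / n \<rightarrow> 0\<close>, which is what the Gaussian tilt requires.\<close>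

section \<open>Total variation and reweighted densities\<close>

lemma tv_dist_density_le:
  fixes u v :: "real \<Rightarrow> real"
  assumes u: "integrable lborel u" "\<And>x. 0 \<le> u x" and v: "integrable lborel v" "\<And>x. 0 \<le> v x"
  shows "tv_dist (density lborel (\<lambda>x. ennreal (u x))) (density lborel (\<lambda>x. ennreal (v x)))
    \<le> (\<integral>x. \<bar>u x - v x\<bar> \<partial>lborel)"
proof -
  have meas: "measure (density lborel (\<lambda>x. ennreal (f x))) A = (\<integral>x. indicator A x * f x \<partial>lborel)"
    if f: "integrable lborel f" "\<And>x. 0 \<le> f x" and A: "A \<in> sets borel" for f :: "real \<Rightarrow> real" and A
  proof -
    have [measurable]: "f \<in> borel_measurable borel" using f(1) by auto
    have "integrable lborel (\<lambda>x. indicator A x * f x)"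
      using integrable_mult_indicator[OF _ f(1), of A] A by simp
    then have "(\<integral>\<^sup>+x. ennreal (indicator A x * f x) \<partial>lborel) = ennreal (\<integral>x. indicator A x * f x \<partial>lborel)"
      by (intro nn_integral_eq_integral) (auto simp: f)
    moreover have "emeasure (density lborel (\<lambda>x. ennreal (f x))) A
        = (\<integral>\<^sup>+x. ennreal (indicator A x * f x) \<partial>lborel)"
      using A by (subst emeasure_density) (auto intro!: nn_integral_cong split: split_indicator)
    ultimately show ?thesis
      unfolding measure_def by (simp add: f integral_nonneg_AE)
  qed
  have "\<bar>measure (density lborel (\<lambda>x. ennreal (u x))) A - measure (density lborel (\<lambda>x. ennreal (v x))) A\<bar>
      \<le> (\<integral>x. \<bar>u x - v x\<bar> \<partial>lborel)" if A: "A \<in> sets borel" for A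
  proof -
    have int: "integrable lborel (\<lambda>x. indicator A x * f x)" if "integrable lborel f" for f :: "real \<Rightarrow> real"
      using integrable_mult_indicator[OF _ that, of A] A by simp
    have "(\<integral>x. indicator A x * u x \<partial>lborel) - (\<integral>x. indicator A x * v x \<partial>lborel)
        = (\<integral>x. indicator A x * (u x - v x) \<partial>lborel)"
      using int[OF u(1)] int[OF v(1)] by (simp add: right_diff_distrib)
    also have "\<bar>\<dots>\<bar> \<le> (\<integral>x. \<bar>u x - v x\<bar> \<partial>lborel)"
    proof (rule order_trans[OF integral_abs_bound integral_mono])
      show "integrable lborel (\<lambda>x. \<bar>indicator A x * (u x - v x)\<bar>)"
        using int[of "\<lambda>x. u x - v x"] u v by (intro integrable_abs) auto
    qed (use u v in \<open>auto split: split_indicator\<close>)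
    finally show ?thesis
      using A u v by (simp add: meas)
  qed
  then show ?thesis
    unfolding tv_dist_def by (intro cSUP_least) auto
qed

text \<open>A weight \<open>R\<close> that is close to the constant \<open>C\<close> in the mean also has its integral \<open>N\<close> close to \<open>C\<close>, so
dividing by \<open>N\<close> costs a second error of the same size. The conditional law and the Gaussian tilt are
both treated as reweightings of the tilted density.\<close>

lemma reweighted_density_L1:
  fixes f R :: "real \<Rightarrow> real"
  assumes f: "integrable lborel f" "\<And>x. 0 \<le> f x" "(\<integral>x. f x \<partial>lborel) = 1"
    and R: "R \<in> borel_measurable borel" "\<And>x. 0 \<le> R x"
    and int: "integrable lborel (\<lambda>x. f x * \<bar>R x - C\<bar>)"
    and le: "(\<integral>x. f x * \<bar>R x - C\<bar> \<partial>lborel) \<le> e" and e: "e < C"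
  defines "N \<equiv> (\<integral>x. f x * R x \<partial>lborel)"
  shows "integrable lborel (\<lambda>x. f x * R x)" "\<bar>N - C\<bar> \<le> e"
    and "(\<integral>x. \<bar>f x * R x / N - f x\<bar> \<partial>lborel) \<le> 2 * e / (C - e)"
proof -
  have [measurable]: "f \<in> borel_measurable borel" "R \<in> borel_measurable borel" using f R by auto
  have intd: "integrable lborel (\<lambda>x. f x * (R x - C))"
    by (rule Bochner_Integration.integrable_bound[OF int]) (auto simp: abs_mult f)
  have "integrable lborel (\<lambda>x. f x * (R x - C) + C * f x)"
    using intd f by auto
  then show intR: "integrable lborel (\<lambda>x. f x * R x)"
    by (simp add: algebra_simps)
  have "N - C = (\<integral>x. f x * (R x - C) \<partial>lborel)"
    unfolding N_def using intR f by (simp add: right_diff_distrib)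
  also have "\<bar>\<dots>\<bar> \<le> (\<integral>x. f x * \<bar>R x - C\<bar> \<partial>lborel)"
    using integral_abs_bound[of lborel "\<lambda>x. f x * (R x - C)"] by (simp add: abs_mult f)
  finally show NC: "\<bar>N - C\<bar> \<le> e" using le by simp
  then have N: "N > 0" "N \<ge> C - e" using e by auto
  have "(\<integral>x. \<bar>f x * R x / N - f x\<bar> \<partial>lborel) = (\<integral>x. f x * \<bar>R x - N\<bar> / N \<partial>lborel)"
  proof (rule Bochner_Integration.integral_cong[OF refl])
    fix x
    have "f x * R x / N - f x = f x * (R x - N) / N" using N by (simp add: field_simps)
    then show "\<bar>f x * R x / N - f x\<bar> = f x * \<bar>R x - N\<bar> / N"
      using N f by (simp add: abs_mult)
  qed
  also have "\<dots> \<le> (\<integral>x. (f x * \<bar>R x - C\<bar> + e * f x) / N \<partial>lborel)"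
  proof (rule integral_mono')
    show "integrable lborel (\<lambda>x. (f x * \<bar>R x - C\<bar> + e * f x) / N)"
      using int f by auto
    fix x
    have "f x * \<bar>R x - N\<bar> \<le> f x * (\<bar>R x - C\<bar> + e)"
      using NC f by (intro mult_left_mono) auto
    then show "f x * \<bar>R x - N\<bar> / N \<le> (f x * \<bar>R x - C\<bar> + e * f x) / N"
      using N by (simp add: divide_right_mono algebra_simps)
    show "0 \<le> (f x * \<bar>R x - C\<bar> + e * f x) / N"
      using f N NC by auto
  qed
  also have "\<dots> = ((\<integral>x. f x * \<bar>R x - C\<bar> \<partial>lborel) + e) / N"
    using int f by simp
  also have "\<dots> \<le> (2 * e) / N"
    using le N by (intro divide_right_mono) auto
  also have "\<dots> \<le> 2 * e / (C - e)"
    using N e NC by (intro divide_left_mono) auto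
  finally show "(\<integral>x. \<bar>f x * R x / N - f x\<bar> \<partial>lborel) \<le> 2 * e / (C - e)" .
qed

section \<open>Densities of sums\<close>

lemma borel_measurable_conv_pow [measurable]:
  assumes [measurable]: "f \<in> borel_measurable borel"
  shows "conv_pow f n \<in> borel_measurable borel"
proof (induction n)
  case (Suc n)
  then show ?case
    by (cases n) auto
qed simp

text \<open>Exponential tilts and affine changes of variable pass through convolution, because
\<open>exp (\<tau> (z - y)) exp (\<tau> y) = exp (\<tau> z)\<close>. This is how the conditional density given the sum, which
involves only \<open>p\<close>, is expressed through the rescaled tilted density.\<close>

lemma conv_pow_affine_tilt:
  assumes [measurable]: "f \<in> borel_measurable borel" and w: "w > 0" and C: "C \<ge> 0"
  shows "conv_pow (\<lambda>z. ennreal (C * exp (\<tau> * z)) * f (b + w * z)) (Suc n) z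
    = ennreal (C ^ Suc n * exp (\<tau> * z) / w ^ n) * conv_pow f (Suc n) (real (Suc n) * b + w * z)"
proof (induction n arbitrary: z)
  case 0
  show ?case by simp
next
  case (Suc n)
  let ?F = "\<lambda>y. f (real (Suc (Suc n)) * b + w * z - y) * conv_pow f (Suc n) y"
  have "conv_pow (\<lambda>z. ennreal (C * exp (\<tau> * z)) * f (b + w * z)) (Suc (Suc n)) z
      = (\<integral>\<^sup>+y. ennreal (C ^ Suc (Suc n) * exp (\<tau> * z) / w ^ n) * ?F (real (Suc n) * b + w * y) \<partial>lborel)"
    unfolding conv_pow.simps(3) Suc
  proof (intro nn_integral_cong)
    fix y
    have "ennreal (C * exp (\<tau> * (z - y))) * ennreal (C ^ Suc n * exp (\<tau> * y) / w ^ n)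
        = ennreal (C ^ Suc (Suc n) * exp (\<tau> * z) / w ^ n)"
      using w C by (subst ennreal_mult'[symmetric]) (auto simp: exp_diff right_diff_distrib)
    moreover have "b + w * (z - y) = real (Suc (Suc n)) * b + w * z - (real (Suc n) * b + w * y)"
      by (simp add: algebra_simps)
    moreover have "(c * u) * (c' * v) = (c * c') * (u * v)" for c c' u v :: ennreal
      by (simp only: mult_ac)
    ultimately show "ennreal (C * exp (\<tau> * (z - y))) * f (b + w * (z - y)) *
        (ennreal (C ^ Suc n * exp (\<tau> * y) / w ^ n) * conv_pow f (Suc n) (real (Suc n) * b + w * y))
        = ennreal (C ^ Suc (Suc n) * exp (\<tau> * z) / w ^ n) * ?F (real (Suc n) * b + w * y)"
      by metis
  qed
  also have "\<dots> = ennreal (C ^ Suc (Suc n) * exp (\<tau> * z) / w ^ n) * (\<integral>\<^sup>+y. ?F (real (Suc n) * b + w * y) \<partial>lborel)"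
    by (rule nn_integral_cmult) measurable
  also have "(\<integral>\<^sup>+y. ?F (real (Suc n) * b + w * y) \<partial>lborel) = ennreal (1 / w) * (\<integral>\<^sup>+y. ?F y \<partial>lborel)"
  proof -
    have "(\<integral>\<^sup>+y. ?F y \<partial>lborel) = ennreal w * (\<integral>\<^sup>+y. ?F (real (Suc n) * b + w * y) \<partial>lborel)"
      using w by (subst nn_integral_real_affine[of ?F w "real (Suc n) * b"]) auto
    then have "ennreal (1 / w) * (\<integral>\<^sup>+y. ?F y \<partial>lborel)
        = (ennreal (1 / w) * ennreal w) * (\<integral>\<^sup>+y. ?F (real (Suc n) * b + w * y) \<partial>lborel)"
      by (simp add: mult.assoc)
    then show ?thesis using w by (simp add: ennreal_mult'[symmetric])
  qed
  also have "(\<integral>\<^sup>+y. ?F y \<partial>lborel) = conv_pow f (Suc (Suc n)) (real (Suc (Suc n)) * b + w * z)"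
    by simp
  finally show ?case
    using w C by (simp only: mult.assoc[symmetric]) (simp add: ennreal_mult'[symmetric] field_simps)
qed

lemma nn_integral_conv_pow:
  assumes [measurable]: "f \<in> borel_measurable borel" and f: "(\<integral>\<^sup>+x. f x \<partial>lborel) = 1"
  shows "(\<integral>\<^sup>+x. conv_pow f (Suc n) x \<partial>lborel) = 1"
proof (induction n)
  case (Suc n)
  have "(\<integral>\<^sup>+x. \<integral>\<^sup>+y. f (x - y) * conv_pow f (Suc n) y \<partial>lborel \<partial>lborel)
      = (\<integral>\<^sup>+y. \<integral>\<^sup>+x. f (x - y) * conv_pow f (Suc n) y \<partial>lborel \<partial>lborel)"
    by (rule lborel_pair.Fubini') measurable
  also have "\<dots> = (\<integral>\<^sup>+y. conv_pow f (Suc n) y \<partial>lborel)"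
  proof (intro nn_integral_cong)
    fix y
    have "(\<integral>\<^sup>+x. f (x - y) \<partial>lborel) = 1"
      using nn_integral_real_affine[of f 1 "-y"] f by simp
    then show "(\<integral>\<^sup>+x. f (x - y) * conv_pow f (Suc n) y \<partial>lborel) = conv_pow f (Suc n) y"
      by (subst nn_integral_multc) auto
  qed
  finally show ?case using Suc by simp
qed (use f in simp)

lemma conv_pow_le:
  assumes [measurable]: "f \<in> borel_measurable borel" and f: "(\<integral>\<^sup>+x. f x \<partial>lborel) = 1"
    and B: "\<And>x. f x \<le> B"
  shows "conv_pow f (Suc n) x \<le> B"
proof (cases n)
  case (Suc m)
  have "(\<integral>\<^sup>+y. f (x - y) * conv_pow f (Suc m) y \<partial>lborel) \<le> (\<integral>\<^sup>+y. B * conv_pow f (Suc m) y \<partial>lborel)"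
    by (intro nn_integral_mono mult_right_mono B) auto
  also have "\<dots> = B * 1"
    by (subst nn_integral_cmult) (auto simp: nn_integral_conv_pow[OF assms(1) f])
  finally show ?thesis using Suc by simp
qed (use B in simp)

lemma char_convolution:
  assumes "real_distribution M" "real_distribution N"
  shows "char (convolution M N) t = char M t * char N t"
proof -
  interpret M: real_distribution M by fact
  interpret N: real_distribution N by fact
  interpret pair_prob_space M N ..
  have "char (convolution M N) t = (CLINT x|M \<Otimes>\<^sub>M N. iexp (t * fst x) * iexp (t * snd x))"
    unfolding convolution_def char_def
    by (subst integral_distr) (auto intro!: Bochner_Integration.integral_cong simp: split_beta field_simps exp_add)
  also have "\<dots> = (CLINT x|M. CLINT y|N. iexp (t * x) * iexp (t * y))"
  proof -
    have "integrable (M \<Otimes>\<^sub>M N) (\<lambda>x. iexp (t * fst x) * iexp (t * snd x))"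
      by (intro integrable_const_bound[of _ 1]) (auto simp: norm_mult)
    from integral_fst'[OF this] show ?thesis by simp
  qed
  also have "\<dots> = char M t * char N t"
    by (simp add: char_def)
  finally show ?thesis .
qed

lemma real_distribution_density:
  assumes [measurable]: "f \<in> borel_measurable borel" and f: "(\<integral>\<^sup>+x. f x \<partial>lborel) = 1"
  shows "real_distribution (density lborel f)"
proof -
  have "prob_space (density lborel f)"
    by (rule prob_spaceI) (simp add: emeasure_density f)
  then show ?thesis
    by (simp add: real_distribution_def real_distribution_axioms_def)
qed

lemma char_conv_pow:
  assumes [measurable]: "f \<in> borel_measurable borel" and f: "(\<integral>\<^sup>+x. f x \<partial>lborel) = 1"
  shows "char (density lborel (conv_pow f (Suc n))) u = char (density lborel f) u ^ Suc n"
proof (induction n)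
  case (Suc n)
  have D: "real_distribution (density lborel f)" "real_distribution (density lborel (conv_pow f (Suc n)))"
    by (auto intro!: real_distribution_density simp: f nn_integral_conv_pow[OF assms(1) f])
  have "density lborel (conv_pow f (Suc (Suc n)))
      = convolution (density lborel f) (density lborel (conv_pow f (Suc n)))"
    unfolding conv_pow.simps(3) using D
    by (intro convolution_density[symmetric])
       (auto simp: real_distribution_def prob_space_def)
  then show ?case
    using Suc char_convolution[OF D] by simp
qed simp

section \<open>Fourier inversion almost everywhere\<close>

lemma integral_char_swap:
  assumes "real_distribution M" "real_distribution N"
  shows "(CLINT u|N. char M (\<tau> * u)) = (CLINT x|M. char N (\<tau> * x))"
proof -
  interpret M: real_distribution M by fact
  interpret N: real_distribution N by fact
  interpret pair_prob_space M N ..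
  have "integrable (M \<Otimes>\<^sub>M N) (\<lambda>(x, u). iexp (\<tau> * u * x))"
    by (intro integrable_const_bound[of _ 1]) auto
  from Fubini_integral[OF this]
  show ?thesis by (simp add: char_def ac_simps)
qed

text \<open>One half of Plancherel's theorem. The function \<open>|\<phi>|\<^sup>2\<close> is the characteristic function of \<open>X - X'\<close> for
independent copies, whose density is again bounded by \<open>B\<close>. Testing it against a Gaussian turns the
integral into a Gaussian mean under the law of \<open>X - X'\<close>, and the Gaussian is then flattened.\<close>

lemma nn_integral_char_square_le:
  assumes [measurable]: "f \<in> borel_measurable borel" and f: "(\<integral>\<^sup>+x. f x \<partial>lborel) = 1"
    and B: "\<And>x. f x \<le> ennreal B" and B0: "B \<ge> 0"
  shows "(\<integral>\<^sup>+u. ennreal ((cmod (char (density lborel f) u))\<^sup>2) \<partial>lborel) \<le> ennreal (2 * pi * B)"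
proof -
  define \<mu> where "\<mu> = density lborel f"
  define f' where "f' = (\<lambda>x. f (- x))"
  define d where "d = (\<lambda>x. \<integral>\<^sup>+y. f (x - y) * f' y \<partial>lborel)"
  have [measurable]: "f' \<in> borel_measurable borel" "d \<in> borel_measurable borel"
    unfolding f'_def d_def by measurable
  have f': "(\<integral>\<^sup>+x. f' x \<partial>lborel) = 1"
    using nn_integral_real_affine[of f "-1" 0] f by (simp add: f'_def)
  have RD: "real_distribution \<mu>" "real_distribution (density lborel f')"
    unfolding \<mu>_def by (auto intro!: real_distribution_density simp: f f')
  have D_eq: "convolution \<mu> (density lborel f') = density lborel d"
    unfolding d_def \<mu>_def using RD
    by (intro convolution_density) (auto simp: real_distribution_def prob_space_def \<mu>_def)
  interpret \<mu>: real_distribution \<mu> by (rule RD)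
  have d_le: "d x \<le> ennreal B" for x
  proof -
    have "d x \<le> (\<integral>\<^sup>+y. ennreal B * f' y \<partial>lborel)"
      unfolding d_def by (intro nn_integral_mono mult_right_mono B) auto
    then show ?thesis by (simp add: nn_integral_cmult f')
  qed
  have d1: "(\<integral>\<^sup>+x. d x \<partial>lborel) = 1"
  proof -
    have "prob_space (convolution \<mu> (density lborel f'))"
    proof -
      interpret N: real_distribution "density lborel f'" by (rule RD)
      interpret pair_prob_space \<mu> "density lborel f'" ..
      show ?thesis unfolding convolution_def by (rule prob_space_distr) auto
    qed
    then have "emeasure (density lborel d) (space (density lborel d)) = 1"
      unfolding D_eq by (rule prob_space.emeasure_space_1)
    then show ?thesis by (simp add: emeasure_density)
  qed
  have RD': "real_distribution (density lborel d)"
    by (rule real_distribution_density) (auto simp: d1)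
  have "char (density lborel f') u = cnj (char \<mu> u)" for u
  proof -
    have eq: "density lborel f' = distr \<mu> borel uminus"
    proof (rule measure_eqI)
      fix A assume "A \<in> sets (density lborel f')"
      then have [measurable]: "A \<in> sets borel" by simp
      show "emeasure (density lborel f') A = emeasure (distr \<mu> borel uminus) A"
        using nn_integral_real_affine[of "\<lambda>x. f x * indicator A (- x)" "-1" 0]
        by (simp add: emeasure_density emeasure_distr \<mu>_def f'_def indicator_vimage[symmetric] vimage_def)
    qed (simp add: \<mu>_def)
    have "char (density lborel f') u = (CLINT x|\<mu>. cnj (iexp (u * x)))"
      unfolding eq char_def by (subst integral_distr) (auto simp: exp_cnj)
    also have "\<dots> = cnj (char \<mu> u)"
      unfolding char_def by (intro integral_bounded_linear bounded_linear_cnj \<mu>.integrable_const_bound[of _ 1]) auto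
    finally show ?thesis .
  qed
  then have char_d: "char (density lborel d) u = complex_of_real ((cmod (char \<mu> u))\<^sup>2)" for u
    unfolding D_eq[symmetric] char_convolution[OF RD] complex_norm_square by simp
  have NR: "real_distribution std_normal_distribution"
    by (simp add: real_distribution_def real_distribution_axioms_def prob_space_normal_density)
  interpret N: real_distribution std_normal_distribution by (rule NR)
  have le_n: "(\<integral>\<^sup>+u. ennreal ((cmod (char \<mu> u))\<^sup>2 * exp (- (u\<^sup>2) / (2 * \<tau>\<^sup>2))) \<partial>lborel) \<le> ennreal (2 * pi * B)"
    if \<tau>: "\<tau> > 0" for \<tau> :: real
  proof -
    let ?c = "\<lambda>u. (cmod (char \<mu> u))\<^sup>2"
    have "(CLINT u|std_normal_distribution. complex_of_real (?c (\<tau> * u)))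
        = (CLINT x|density lborel d. complex_of_real (exp (- (\<tau> * x)\<^sup>2 / 2)))"
      using integral_char_swap[OF RD' NR, of \<tau>] by (simp add: char_d char_std_normal_distribution)
    then have eq: "(\<integral>u. ?c (\<tau> * u) \<partial>std_normal_distribution)
        = (\<integral>x. exp (- (\<tau> * x)\<^sup>2 / 2) \<partial>density lborel d)"
      by (simp only: integral_complex_of_real of_real_eq_iff)
    have c1: "?c u \<le> 1" for u
      using \<mu>.cmod_char_le_1[of u] by (simp add: power_le_one)
    have "integrable std_normal_distribution (\<lambda>u. ?c (\<tau> * u))"
      by (intro N.integrable_const_bound[of _ 1]) (auto simp: c1)
    then have 1: "(\<integral>\<^sup>+u. ennreal (?c (\<tau> * u)) \<partial>std_normal_distribution)
        = ennreal (\<integral>u. ?c (\<tau> * u) \<partial>std_normal_distribution)"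
      by (intro nn_integral_eq_integral) auto
    interpret D: real_distribution "density lborel d" by (rule RD')
    have "integrable (density lborel d) (\<lambda>x. exp (- (\<tau> * x)\<^sup>2 / 2))"
      by (intro D.integrable_const_bound[of _ 1]) auto
    then have 2: "(\<integral>\<^sup>+x. ennreal (exp (- (\<tau> * x)\<^sup>2 / 2)) \<partial>density lborel d)
        = ennreal (\<integral>x. exp (- (\<tau> * x)\<^sup>2 / 2) \<partial>density lborel d)"
      by (intro nn_integral_eq_integral) auto
    have 3: "(\<integral>\<^sup>+x. ennreal (exp (- (\<tau> * x)\<^sup>2 / 2)) \<partial>density lborel d) \<le> ennreal (B * sqrt (2 * pi) / \<tau>)"
    proof -
      have "(\<integral>\<^sup>+x. ennreal (exp (- (\<tau> * x)\<^sup>2 / 2)) \<partial>density lborel d)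
          = (\<integral>\<^sup>+x. d x * ennreal (exp (- (\<tau> * x)\<^sup>2 / 2)) \<partial>lborel)"
        by (rule nn_integral_density) auto
      also have "\<dots> \<le> (\<integral>\<^sup>+x. ennreal B * ennreal (exp (- (\<tau> * x)\<^sup>2 / 2)) \<partial>lborel)"
        by (intro nn_integral_mono mult_right_mono d_le) auto
      also have "\<dots> = (\<integral>\<^sup>+x. ennreal (B * sqrt (2 * pi) / \<tau>) * ennreal (normal_density 0 (1 / \<tau>) x) \<partial>lborel)"
        using \<tau> B0 by (intro nn_integral_cong)
          (simp add: ennreal_mult'[symmetric] normal_density_def real_sqrt_divide field_simps)
      also have "\<dots> = ennreal (B * sqrt (2 * pi) / \<tau>)"
      proof -
        have "(\<integral>\<^sup>+x. ennreal (normal_density 0 (1 / \<tau>) x) \<partial>lborel) = 1"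
          using \<tau> by (subst nn_integral_eq_integral) auto
        then show ?thesis by (subst nn_integral_cmult) auto
      qed
      finally show ?thesis .
    qed
    have "(\<integral>\<^sup>+u. ennreal (?c u * exp (- (u\<^sup>2) / (2 * \<tau>\<^sup>2))) \<partial>lborel)
        = ennreal \<tau> * (\<integral>\<^sup>+u. ennreal (?c (\<tau> * u) * exp (- ((\<tau> * u)\<^sup>2) / (2 * \<tau>\<^sup>2))) \<partial>lborel)"
      using \<tau> nn_integral_real_affine[of "\<lambda>u. ennreal (?c u * exp (- (u\<^sup>2) / (2 * \<tau>\<^sup>2)))" \<tau> 0] by simp
    also have "(\<integral>\<^sup>+u. ennreal (?c (\<tau> * u) * exp (- ((\<tau> * u)\<^sup>2) / (2 * \<tau>\<^sup>2))) \<partial>lborel)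
        = (\<integral>\<^sup>+u. ennreal (sqrt (2 * pi)) * (ennreal (std_normal_density u) * ennreal (?c (\<tau> * u))) \<partial>lborel)"
      using \<tau> by (intro nn_integral_cong)
        (simp add: ennreal_mult'[symmetric] std_normal_density_def power_mult_distrib)
    also have "\<dots> = ennreal (sqrt (2 * pi)) * (\<integral>\<^sup>+u. ennreal (?c (\<tau> * u)) \<partial>std_normal_distribution)"
      by (subst nn_integral_cmult) (auto simp: nn_integral_density)
    also have "\<dots> \<le> ennreal (sqrt (2 * pi)) * ennreal (B * sqrt (2 * pi) / \<tau>)"
      using 1 2 3 eq by (intro mult_left_mono) auto
    also have "ennreal \<tau> * (ennreal (sqrt (2 * pi)) * ennreal (B * sqrt (2 * pi) / \<tau>)) = ennreal (2 * pi * B)"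
      using \<tau> B0 by (simp add: ennreal_mult'[symmetric])
    finally show ?thesis by (simp add: mult_left_mono)
  qed
  have "(\<integral>\<^sup>+u. ennreal ((cmod (char \<mu> u))\<^sup>2) \<partial>lborel)
      = (\<integral>\<^sup>+u. liminf (\<lambda>n. ennreal ((cmod (char \<mu> u))\<^sup>2 * exp (- (u\<^sup>2) / (2 * (real (Suc n))\<^sup>2)))) \<partial>lborel)"
  proof (intro nn_integral_cong lim_imp_Liminf[symmetric] tendsto_ennrealI)
    fix u
    have "(\<lambda>n. exp (- (u\<^sup>2) / (2 * (real (Suc n))\<^sup>2))) \<longlonglongrightarrow> 1"
      by real_asymp
    from tendsto_mult[OF tendsto_const[of "(cmod (char \<mu> u))\<^sup>2"] this]
    show "(\<lambda>n. (cmod (char \<mu> u))\<^sup>2 * exp (- (u\<^sup>2) / (2 * (real (Suc n))\<^sup>2))) \<longlonglongrightarrow> (cmod (char \<mu> u))\<^sup>2"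
      by simp
  qed simp
  also have "\<dots> \<le> liminf (\<lambda>n. \<integral>\<^sup>+u. ennreal ((cmod (char \<mu> u))\<^sup>2 * exp (- (u\<^sup>2) / (2 * (real (Suc n))\<^sup>2))) \<partial>lborel)"
    by (rule nn_integral_liminf) auto
  also have "\<dots> \<le> liminf (\<lambda>n::nat. ennreal (2 * pi * B))"
    by (intro Liminf_mono always_eventually allI le_n) simp
  finally show ?thesis unfolding \<mu>_def by (simp add: Liminf_const)
qed

lemma interval_integral_iexp_scale:
  fixes a b u :: real
  assumes "u \<noteq> 0"
  shows "(CLBINT z=a..b. iexp (- (u * z))) = (iexp (- (u * a)) - iexp (- (u * b))) / (\<i> * u)"
  using assms
  by (subst interval_integral_FTC_finite[where F = "\<lambda>z. iexp (- (u * z)) * (\<i> / u)"])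
     (auto intro!: continuous_at_imp_continuous_on derivative_eq_intros has_vector_derivative_real_field
        continuous_intros simp: field_simps)

text \<open>Equality almost everywhere is enough for later use, where the density of a sum is always integrated
against the law of one further summand. Levy's inversion formula gives the mass of every
interval, which identifies the density.\<close>

lemma density_eq_inverse_fourier:
  assumes [measurable]: "f \<in> borel_measurable borel" and f: "(\<integral>\<^sup>+x. f x \<partial>lborel) = 1"
    and int: "integrable lborel (char (density lborel f))"
  shows "AE z in lborel. f z = ennreal (Re (CLBINT u. char (density lborel f) u * iexp (- (u * z))) / (2 * pi))
    \<and> 0 \<le> Re (CLBINT u. char (density lborel f) u * iexp (- (u * z)))"
proof -
  define \<mu> where "\<mu> = density lborel f"
  interpret \<mu>: real_distribution \<mu>
    unfolding \<mu>_def by (rule real_distribution_density) (auto simp: f)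
  define J where "J = (\<lambda>z. CLBINT u. char \<mu> u * iexp (- (u * z)))"
  define K where "K = (LBINT u. cmod (char \<mu> u))"
  have int': "integrable lborel (char \<mu>)" using int unfolding \<mu>_def .
  have [measurable]: "J \<in> borel_measurable borel" unfolding J_def by measurable
  have J_le: "cmod (J z) \<le> K" for z
  proof -
    have "cmod (J z) \<le> (LBINT u. cmod (char \<mu> u * iexp (- (u * z))))"
      unfolding J_def by (rule integral_norm_bound)
    also have "\<dots> = K" unfolding K_def by (simp add: norm_mult)
    finally show ?thesis .
  qed
  have K0: "K \<ge> 0" unfolding K_def by simp
  have meas: "2 * pi * measure \<mu> {a<..b} = (LBINT z. indicator {a<..b} z * Re (J z))"
    and int_ind: "integrable lborel (\<lambda>z. indicator {a<..b} z * Re (J z))" if ab: "a \<le> b" for a b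
  proof -
    let ?H = "\<lambda>z u. indicator {a<..b} z *\<^sub>R (char \<mu> u * iexp (- (u * z)))"
    let ?F = "\<lambda>u. (iexp (- (u * a)) - iexp (- (u * b))) / (\<i> * u)"
    have pt: "measure \<mu> {x} = 0" for x
      unfolding measure_def \<mu>_def by (simp add: emeasure_density nn_integral_indicator_singleton')
    have F_le: "cmod (?F u) \<le> b - a" if "u \<noteq> 0" for u
      using Levy_Inversion_aux2[of "-b" "-a" u] ab that by simp
    have intF: "integrable lborel (\<lambda>u. ?F u * char \<mu> u)"
    proof (rule Bochner_Integration.integrable_bound)
      show "integrable lborel (\<lambda>u. (b - a) * cmod (char \<mu> u))" using int' by auto
      show "AE u in lborel. cmod (?F u * char \<mu> u) \<le> norm ((b - a) * cmod (char \<mu> u))"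
        using AE_lborel_singleton[of 0]
      proof eventually_elim
        case (elim u)
        have "cmod (?F u) * cmod (char \<mu> u) \<le> (b - a) * cmod (char \<mu> u)"
          by (intro mult_right_mono F_le elim) auto
        then show ?case using ab by (simp only: norm_mult) simp
      qed
    qed measurable
    have "(\<lambda>n. CLBINT u=- real n..real n. ?F u * char \<mu> u) \<longlonglongrightarrow> (CLBINT u. ?F u * char \<mu> u)"
    proof -
      have "(\<lambda>n. CLBINT u. indicator {- real n<..<real n} u *\<^sub>R (?F u * char \<mu> u)) \<longlonglongrightarrow> (CLBINT u. ?F u * char \<mu> u)"
      proof (rule integral_dominated_convergence)
        show "integrable lborel (\<lambda>u. cmod (?F u * char \<mu> u))" using intF by (rule integrable_norm)
        show "AE u in lborel. (\<lambda>n. indicator {- real n<..<real n} u *\<^sub>R (?F u * char \<mu> u)) \<longlonglongrightarrow> ?F u * char \<mu> u"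
        proof (rule AE_I2)
          fix u
          have "\<forall>\<^sub>F n in sequentially. \<bar>u\<bar> < real n"
            by real_asymp
          then have "\<forall>\<^sub>F n in sequentially. indicator {- real n<..<real n} u *\<^sub>R (?F u * char \<mu> u) = ?F u * char \<mu> u"
            by eventually_elim (auto simp: indicator_def)
          then show "(\<lambda>n. indicator {- real n<..<real n} u *\<^sub>R (?F u * char \<mu> u)) \<longlonglongrightarrow> ?F u * char \<mu> u"
            by (rule tendsto_eventually)
        qed
      qed (auto split: split_indicator)
      then show ?thesis
        by (simp add: interval_lebesgue_integral_def set_lebesgue_integral_def)
    qed
    from tendsto_mult[OF tendsto_const[of "1 / (2 * complex_of_real pi)"] this]
    have "(\<lambda>n. 1 / (2 * pi) * (CLBINT u=- real n..real n. ?F u * char \<mu> u)) \<longlonglongrightarrow> 1 / (2 * pi) * (CLBINT u. ?F u * char \<mu> u)"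
      by simp
    from LIMSEQ_unique[OF this \<mu>.Levy_Inversion[OF ab pt pt, unfolded of_int_minus of_int_of_nat_eq]]
    have 1: "complex_of_real (2 * pi * measure \<mu> {a<..b}) = (CLBINT u. ?F u * char \<mu> u)"
      by (simp add: field_simps)
    have "(CLBINT u. ?F u * char \<mu> u) = (CLBINT u. CLBINT z. ?H z u)"
    proof (rule integral_cong_AE)
      show "AE u in lborel. ?F u * char \<mu> u = (CLBINT z. ?H z u)"
        using AE_lborel_singleton[of 0]
      proof eventually_elim
        case (elim u)
        have "(CLBINT z=a..b. iexp (- (u * z))) = ?F u"
          using elim by (rule interval_integral_iexp_scale)
        then have "(CLBINT z. indicator {a<..b} z *\<^sub>R iexp (- (u * z))) = ?F u"
          using ab by (simp add: interval_integral_Ioc set_lebesgue_integral_def)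
        moreover have "(CLBINT z. ?H z u)
            = char \<mu> u * (CLBINT z. indicator {a<..b} z *\<^sub>R iexp (- (u * z)))"
          by (subst integral_mult_right_zero[symmetric]) (simp add: mult_ac)
        ultimately show ?case by simp
      qed
    qed measurable
    also have "\<dots> = (CLBINT z. CLBINT u. ?H z u)"
    proof (rule lborel_pair.Fubini_integral)
      show "integrable (lborel \<Otimes>\<^sub>M lborel) (\<lambda>(z, u). ?H z u)"
      proof (rule lborel_pair.Fubini_integrable)
        have eq: "(LBINT u. norm (?H z u)) = indicator {a<..b} z * K" for z
          unfolding K_def by (simp add: norm_mult)
        show "integrable lborel (\<lambda>z. LBINT u. norm (case (z, u) of (z, u) \<Rightarrow> ?H z u))"
          unfolding prod.case eq using ab by simp
        show "AE z in lborel. integrable lborel (\<lambda>u. case (z, u) of (z, u) \<Rightarrow> ?H z u)"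
        proof (rule AE_I2)
          fix z
          have "integrable lborel (\<lambda>u. char \<mu> u * iexp (- (u * z)))"
            by (rule Bochner_Integration.integrable_bound[OF int']) (auto simp: norm_mult)
          then show "integrable lborel (\<lambda>u. case (z, u) of (z, u) \<Rightarrow> ?H z u)"
            by simp
        qed
      qed measurable
    qed
    also have "\<dots> = (CLBINT z. indicator {a<..b} z *\<^sub>R J z)"
      unfolding J_def by simp
    finally have 2: "complex_of_real (2 * pi * measure \<mu> {a<..b}) = (CLBINT z. indicator {a<..b} z *\<^sub>R J z)"
      using 1 by simp
    have intJ: "integrable lborel (\<lambda>z. indicator {a<..b} z *\<^sub>R J z)"
      by (rule integrableI_bounded_set_indicator[of _ _ _ K]) (use ab J_le in auto)
    have "2 * pi * measure \<mu> {a<..b} = Re (CLBINT z. indicator {a<..b} z *\<^sub>R J z)"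
      using 2 by (metis Re_complex_of_real)
    also have "\<dots> = (LBINT z. indicator {a<..b} z * Re (J z))"
      using integral_Re[OF intJ] by simp
    finally show "2 * pi * measure \<mu> {a<..b} = (LBINT z. indicator {a<..b} z * Re (J z))" .
    show "integrable lborel (\<lambda>z. indicator {a<..b} z * Re (J z))"
      using integrable_Re[OF intJ] by simp
  qed
  \<comment> \<open>The inverse transform is not known to be nonnegative yet. Adding \<open>L\<close> on both sides makes both functions densities of sigma-finite measures, which can be compared on intervals.\<close>
  define L where "L = K / (2 * pi) + 1"
  have JL: "0 \<le> Re (J z) / (2 * pi) + L" for z
  proof -
    have "- K \<le> Re (J z)" using J_le[of z] abs_Re_le_cmod[of "J z"] by linarith
    then have "- K / (2 * pi) \<le> Re (J z) / (2 * pi)" by (intro divide_right_mono) auto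
    then show ?thesis unfolding L_def by simp
  qed
  have L0: "L > 0" unfolding L_def using K0 by (simp add: add_nonneg_pos)
  have "density lborel (\<lambda>z. f z + ennreal L) = density lborel (\<lambda>z. ennreal (Re (J z) / (2 * pi) + L))"
  proof (rule measure_eqI_generator_eq[where \<Omega> = UNIV and E = "range (\<lambda>(a, b). {a<..b::real})" and A = "\<lambda>i. {- real i<..real i}"])
    show "Int_stable (range (\<lambda>(a, b). {a<..b::real}))"
      by (auto simp: Int_stable_def)
    have eq: "emeasure (density lborel (\<lambda>z. f z + ennreal L)) {a<..b} = ennreal (measure \<mu> {a<..b} + L * (b - a))"
      "emeasure (density lborel (\<lambda>z. ennreal (Re (J z) / (2 * pi) + L))) {a<..b} = ennreal (measure \<mu> {a<..b} + L * (b - a))"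
      if ab: "a \<le> b" for a b
    proof -
      have "emeasure (density lborel (\<lambda>z. f z + ennreal L)) {a<..b} = emeasure \<mu> {a<..b} + ennreal L * ennreal (b - a)"
        unfolding \<mu>_def using ab
        by (simp add: emeasure_density distrib_right nn_integral_add nn_integral_cmult)
      also have "\<dots> = ennreal (measure \<mu> {a<..b} + L * (b - a))"
        using ab L0 by (simp add: \<mu>.emeasure_eq_measure ennreal_mult')
      finally show "emeasure (density lborel (\<lambda>z. f z + ennreal L)) {a<..b} = ennreal (measure \<mu> {a<..b} + L * (b - a))" .
      have i: "integrable lborel (\<lambda>z. indicator {a<..b} z * Re (J z) / (2 * pi) + L * indicator {a<..b} z)"
        using int_ind[OF ab] ab by (intro Bochner_Integration.integrable_add) auto
      have "emeasure (density lborel (\<lambda>z. ennreal (Re (J z) / (2 * pi) + L))) {a<..b}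
          = (\<integral>\<^sup>+z. ennreal (indicator {a<..b} z * Re (J z) / (2 * pi) + L * indicator {a<..b} z) \<partial>lborel)"
        by (subst emeasure_density) (auto intro!: nn_integral_cong split: split_indicator)
      also have "\<dots> = ennreal (LBINT z. indicator {a<..b} z * Re (J z) / (2 * pi) + L * indicator {a<..b} z)"
        by (rule nn_integral_eq_integral[OF i]) (use JL in \<open>auto split: split_indicator\<close>)
      also have "(LBINT z. indicator {a<..b} z * Re (J z) / (2 * pi) + L * indicator {a<..b} z)
          = (LBINT z. indicator {a<..b} z * Re (J z)) / (2 * pi) + L * (b - a)"
        using int_ind[OF ab] ab by (subst Bochner_Integration.integral_add) auto
      also have "\<dots> = measure \<mu> {a<..b} + L * (b - a)"
        by (simp add: meas[OF ab, symmetric])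
      finally show "emeasure (density lborel (\<lambda>z. ennreal (Re (J z) / (2 * pi) + L))) {a<..b}
          = ennreal (measure \<mu> {a<..b} + L * (b - a))" .
    qed
    show "emeasure (density lborel (\<lambda>z. f z + ennreal L)) X
        = emeasure (density lborel (\<lambda>z. ennreal (Re (J z) / (2 * pi) + L))) X"
      if "X \<in> range (\<lambda>(a, b). {a<..b::real})" for X
    proof -
      from that obtain a b where X: "X = {a<..b}" by auto
      show ?thesis
      proof (cases "a \<le> b")
        case True then show ?thesis unfolding X by (simp only: eq)
      next
        case False then show ?thesis unfolding X by simp
      qed
    qed
    show "emeasure (density lborel (\<lambda>z. f z + ennreal L)) {- real i<..real i} \<noteq> \<infinity>" for i
      by (simp add: eq)
    show "(\<Union>i. {- real i<..real i}) = UNIV"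
    proof safe
      fix x :: real
      obtain n where "\<bar>x\<bar> < real n" using reals_Archimedean2 by blast
      then show "x \<in> (\<Union>i. {- real i<..real i})" by (auto intro!: exI[of _ n])
    qed auto
  qed (auto simp: borel_sigma_sets_Ioc)
  then have "AE z in lborel. f z + ennreal L = ennreal (Re (J z) / (2 * pi) + L)"
    by (intro sigma_finite_measure.density_unique[OF lborel.sigma_finite_measure_axioms]) auto
  then show ?thesis
  proof eventually_elim
    case (elim z)
    have "f z < top"
      using elim by (metis ennreal_add_eq_top ennreal_less_top less_top)
    then obtain r where r: "f z = ennreal r" "r \<ge> 0" by (cases "f z") auto
    have "r + L = Re (J z) / (2 * pi) + L"
      using elim r L0 JL[of z] by (simp add: ennreal_plus[symmetric] del: ennreal_plus)
    then show ?case
      using r pi_gt_zero by (auto simp: J_def \<mu>_def zero_le_divide_iff)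
  qed
qed

section \<open>A uniform local limit theorem\<close>

lemma integrable_abs_power_exp:
  fixes c :: real assumes c: "c > 0"
  shows "integrable lborel (\<lambda>z. \<bar>z\<bar> ^ k * exp (- (c * \<bar>z\<bar>)))"
proof -
  let ?h = "\<lambda>x::real. x ^ k * exp (- x) * indicator {0..} x"
  have 1: "integrable lborel ?h"
    using has_bochner_integral_I0i_power_exp_m'[of k] by (rule integrable.intros)
  have "integrable lborel (\<lambda>x. ?h (0 + (-1) * x))"
    by (rule lborel_integrable_real_affine[OF 1]) simp
  then have 2: "integrable lborel (\<lambda>x. ?h x + ?h (- x))"
    using 1 by simp
  have "integrable lborel (\<lambda>x::real. \<bar>x\<bar> ^ k * exp (- \<bar>x\<bar>))"
  proof (rule Bochner_Integration.integrable_bound[OF 2])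
    show "AE x in lborel. norm (\<bar>x\<bar> ^ k * exp (- \<bar>x\<bar>)) \<le> norm (?h x + ?h (- x))"
      by (intro AE_I2) (auto simp: abs_mult abs_real_def split: split_indicator)
  qed measurable
  then have "integrable lborel (\<lambda>x. \<bar>0 + c * x\<bar> ^ k * exp (- \<bar>0 + c * x\<bar>))"
    using c by (intro lborel_integrable_real_affine) auto
  then have "integrable lborel (\<lambda>x. (1 / c ^ k) * (\<bar>0 + c * x\<bar> ^ k * exp (- \<bar>0 + c * x\<bar>)))"
    by (rule integrable_mult_right)
  then show ?thesis
    using c by (simp add: abs_mult power_mult_distrib)
qed

lemma integrable_abs_power_gauss:
  fixes g :: real assumes g: "g > 0"
  shows "integrable lborel (\<lambda>z. \<bar>z\<bar> ^ k * exp (- (g * z\<^sup>2)))"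
proof -
  define s where "s = sqrt (1 / (2 * g))"
  have s: "s > 0" "2 * s\<^sup>2 = 1 / g" using g by (auto simp: s_def)
  have "integrable lborel (\<lambda>x. sqrt (2 * pi * s\<^sup>2) * (normal_density 0 s x * \<bar>x - 0\<bar> ^ k))"
    using s by (intro integrable_mult_right integrable_normal_moment_abs) auto
  then show ?thesis
    using s g by (simp add: normal_density_def mult_ac)
qed

lemma integral_abs_power_gauss_scale:
  fixes g \<kappa> :: real assumes g: "g > 0" and \<kappa>: "\<kappa> > 0"
  shows "(\<integral>z. \<bar>z\<bar> ^ j * exp (- (g * \<kappa>\<^sup>2 * z\<^sup>2)) \<partial>lborel)
    = (\<integral>z. \<bar>z\<bar> ^ j * exp (- (g * z\<^sup>2)) \<partial>lborel) / \<kappa> ^ Suc j"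
proof -
  have "(\<integral>z. \<bar>z\<bar> ^ j * exp (- (g * z\<^sup>2)) \<partial>lborel)
      = \<kappa> * (\<integral>z. \<bar>\<kappa> * z\<bar> ^ j * exp (- (g * (\<kappa> * z)\<^sup>2)) \<partial>lborel)"
    using \<kappa> by (subst lborel_integral_real_affine[of \<kappa> _ 0]) auto
  also have "\<dots> = \<kappa> * (\<integral>z. \<kappa> ^ j * (\<bar>z\<bar> ^ j * exp (- (g * \<kappa>\<^sup>2 * z\<^sup>2))) \<partial>lborel)"
    using \<kappa> by (simp add: abs_mult power_mult_distrib mult_ac)
  also have "\<dots> = \<kappa> ^ Suc j * (\<integral>z. \<bar>z\<bar> ^ j * exp (- (g * \<kappa>\<^sup>2 * z\<^sup>2)) \<partial>lborel)"
    by simp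
  finally show ?thesis using \<kappa> by (simp add: field_simps)
qed

lemma norm_power_diff_le:
  fixes a b :: complex
  assumes "cmod a \<le> r" "cmod b \<le> r"
  shows "cmod (a ^ Suc n - b ^ Suc n) \<le> real (Suc n) * r ^ n * cmod (a - b)"
proof (induction n)
  case (Suc n)
  have r: "r \<ge> 0" using assms(1) norm_ge_zero order_trans by blast
  have "a ^ Suc (Suc n) - b ^ Suc (Suc n) = a * (a ^ Suc n - b ^ Suc n) + (a - b) * b ^ Suc n"
    by (simp add: algebra_simps)
  also have "cmod \<dots> \<le> cmod a * cmod (a ^ Suc n - b ^ Suc n) + cmod (a - b) * cmod b ^ Suc n"
    by (metis norm_mult norm_power norm_triangle_ineq)
  also have "\<dots> \<le> r * (real (Suc n) * r ^ n * cmod (a - b)) + cmod (a - b) * r ^ Suc n"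
    using Suc assms r by (intro add_mono mult_mono power_mono mult_left_mono) auto
  finally show ?case by (simp add: algebra_simps)
qed simp

lemma sin_le_cubic:
  fixes y :: real assumes "0 \<le> y" "y \<le> 2"
  shows "\<bar>sin y\<bar> \<le> y - 2 * y ^ 3 / 15"
proof -
  have s: "sin y \<ge> 0" using assms pi_gt3 by (intro sin_ge_zero) auto
  have "\<bar>sin y - (\<Sum>m<5. sin_coeff m * y ^ m)\<bar> \<le> inverse (fact 5) * \<bar>y\<bar> ^ 5"
    by (rule Maclaurin_sin_bound)
  moreover have "(\<Sum>m<5. sin_coeff m * y ^ m) = y - y ^ 3 / 6"
    by (simp add: numeral_eq_Suc sin_coeff_Suc cos_coeff_Suc)
  moreover have "inverse (fact 5) * \<bar>y\<bar> ^ 5 = y ^ 5 / 120"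
    using assms by (simp add: fact_numeral)
  ultimately have "sin y \<le> y - y ^ 3 / 6 + y ^ 5 / 120"
    by linarith
  moreover have "y ^ 5 \<le> 4 * y ^ 3"
  proof -
    have "y ^ 5 = y\<^sup>2 * y ^ 3" by (simp add: power_add[symmetric])
    also have "\<dots> \<le> 4 * y ^ 3"
      using power_mono[of y 2 2] assms by (intro mult_right_mono) auto
    finally show ?thesis .
  qed
  ultimately show ?thesis using s by simp
qed

definition exp_moment :: "real \<Rightarrow> nat \<Rightarrow> real" where
  "exp_moment c k = (\<integral>z. \<bar>z\<bar> ^ k * exp (- (c * \<bar>z\<bar>)) \<partial>lborel)"

lemma exp_moment_nonneg: "exp_moment c k \<ge> 0"
  unfolding exp_moment_def by simp

text \<open>A class of densities on which the local limit theorem holds with constants depending on \<open>B\<close>, \<open>c\<close> and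
\<open>d\<close> only. The tail bounds all moments and the density itself; the lower bound on an interval of length
one keeps the variance away from \<open>0\<close> and excludes near-lattice behaviour.\<close>

locale tame_density =
  fixes f :: "real \<Rightarrow> real" and B c d \<alpha> :: real
  assumes meas [measurable]: "f \<in> borel_measurable borel"
    and nonneg: "\<And>z. 0 \<le> f z"
    and integral_eq_1: "(\<integral>z. f z \<partial>lborel) = 1"
    and mean_zero: "(\<integral>z. f z * z \<partial>lborel) = 0"
    and tail: "\<And>z. f z \<le> B * exp (- (c * \<bar>z\<bar>))"
    and c_pos: "c > 0" and d_pos: "d > 0"
    and lower: "\<And>z. \<alpha> < z \<Longrightarrow> z < \<alpha> + 1 \<Longrightarrow> d \<le> f z"
begin

definition \<phi> where "\<phi> = char (density lborel (\<lambda>x. ennreal (f x)))"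
definition \<sigma>2 where "\<sigma>2 = (\<integral>z. f z * z\<^sup>2 \<partial>lborel)"
abbreviation mom where "mom \<equiv> exp_moment c"

lemma B_pos: "B > 0"
proof -
  have "0 < B * exp (- (c * \<bar>\<alpha> + 1/2\<bar>))"
    using lower[of "\<alpha> + 1/2"] tail[of "\<alpha> + 1/2"] d_pos by simp
  then show ?thesis by (simp add: zero_less_mult_iff)
qed

lemma le_B: "f z \<le> B"
proof -
  have "exp (- (c * \<bar>z\<bar>)) \<le> 1" using c_pos by simp
  then have "B * exp (- (c * \<bar>z\<bar>)) \<le> B * 1" using B_pos by (intro mult_left_mono) auto
  then show ?thesis using tail[of z] by simp
qed

lemma integrable_moment: "integrable lborel (\<lambda>z. f z * \<bar>z\<bar> ^ k)"
  and moment_le: "(\<integral>z. f z * \<bar>z\<bar> ^ k \<partial>lborel) \<le> B * mom k"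
proof -
  have le: "f z * \<bar>z\<bar> ^ k \<le> B * (\<bar>z\<bar> ^ k * exp (- (c * \<bar>z\<bar>)))" for z
    using mult_right_mono[OF tail[of z], of "\<bar>z\<bar> ^ k"] by (simp add: mult_ac)
  have i: "integrable lborel (\<lambda>z. B * (\<bar>z\<bar> ^ k * exp (- (c * \<bar>z\<bar>))))"
    using integrable_abs_power_exp[OF c_pos, of k] by (rule integrable_mult_right)
  show j: "integrable lborel (\<lambda>z. f z * \<bar>z\<bar> ^ k)"
    by (rule Bochner_Integration.integrable_bound[OF i])
       (use le B_pos nonneg in \<open>auto simp: abs_mult\<close>)
  show "(\<integral>z. f z * \<bar>z\<bar> ^ k \<partial>lborel) \<le> B * mom k"
    unfolding exp_moment_def integral_mult_right_zero[symmetric]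
    by (rule integral_mono[OF j i]) (use le in auto)
qed

lemma integrable_f: "integrable lborel f"
  using integrable_moment[of 0] by simp

lemma integrable_power: "integrable lborel (\<lambda>z. f z * z ^ k)"
  by (rule Bochner_Integration.integrable_bound[OF integrable_moment[of k]])
     (auto simp: abs_mult power_abs)

lemma nn_integral_f: "(\<integral>\<^sup>+x. ennreal (f x) \<partial>lborel) = 1"
  using nn_integral_eq_integral[OF integrable_f] nonneg integral_eq_1 by simp

lemma \<phi>_eq: "\<phi> u = (CLBINT z. f z *\<^sub>R iexp (u * z))"
  unfolding \<phi>_def char_def by (subst integral_density) (auto simp: nonneg)

lemma AE_lower: "AE z in lborel. d * indicator {\<alpha>..\<alpha>+1} z \<le> f z"
  using AE_lborel_singleton[of \<alpha>] AE_lborel_singleton[of "\<alpha> + 1"]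
  by eventually_elim (use lower nonneg in \<open>auto split: split_indicator\<close>)

lemma \<sigma>2_ge: "\<sigma>2 \<ge> d / 12" and \<sigma>2_le: "\<sigma>2 \<le> B * mom 2"
proof -
  show "\<sigma>2 \<le> B * mom 2"
    using moment_le[of 2] by (simp add: \<sigma>2_def)
  have i: "integrable lborel (\<lambda>z. d * (z\<^sup>2 * indicator {\<alpha>..\<alpha>+1} z))"
  proof (rule integrable_mult_right)
    have "continuous_on {\<alpha>..\<alpha>+1} (\<lambda>z::real. z\<^sup>2)" by (intro continuous_intros)
    from borel_integrable_atLeastAtMost'[OF this]
    show "integrable lborel (\<lambda>z. z\<^sup>2 * indicator {\<alpha>..\<alpha>+1} z :: real)"
      by (simp add: set_integrable_def mult.commute)
  qed
  have "(\<integral>z. d * (z\<^sup>2 * indicator {\<alpha>..\<alpha>+1} z) \<partial>lborel) = d * (((\<alpha>+1) ^ 3 - \<alpha> ^ 3) / 3)"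
    using integral_power[of \<alpha> "\<alpha> + 1" 2] by (simp add: eval_nat_numeral)
  moreover have "(\<integral>z. d * (z\<^sup>2 * indicator {\<alpha>..\<alpha>+1} z) \<partial>lborel) \<le> \<sigma>2"
    unfolding \<sigma>2_def using i integrable_power[of 2]
  proof (rule integral_mono_AE)
    show "AE z in lborel. d * (z\<^sup>2 * indicator {\<alpha>..\<alpha>+1} z) \<le> f z * z\<^sup>2"
      using AE_lower
    proof eventually_elim
      case (elim z)
      from mult_right_mono[OF this, of "z\<^sup>2"] show ?case by (simp add: mult_ac)
    qed
  qed
  moreover have "d / 12 \<le> d * (((\<alpha>+1) ^ 3 - \<alpha> ^ 3) / 3)"
  proof -
    have "((\<alpha>+1) ^ 3 - \<alpha> ^ 3) / 3 = (\<alpha> + 1/2)\<^sup>2 + 1 / 12"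
      by (simp add: power2_eq_square power3_eq_cube field_simps)
    then have "1 / 12 \<le> ((\<alpha>+1) ^ 3 - \<alpha> ^ 3) / 3" by simp
    from mult_left_mono[OF this, of d] show ?thesis using d_pos by simp
  qed
  ultimately show "\<sigma>2 \<ge> d / 12" by linarith
qed

lemma d_le_1: "d \<le> 1"
proof -
  have "(\<integral>z. d * indicator {\<alpha>..\<alpha>+1} z \<partial>lborel) \<le> (\<integral>z. f z \<partial>lborel)"
    using AE_lower by (intro integral_mono_AE integrable_f) auto
  then show ?thesis by (simp add: integral_eq_1)
qed

text \<open>The density splits into \<open>d\<close> times the uniform density on the interval and a remainder of mass \<open>1 - d\<close>;
the remainder contributes at most its mass, and the uniform part is computed.\<close>

lemma norm_\<phi>_le_sinc:
  assumes u: "u \<noteq> 0"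
  shows "cmod (\<phi> u) \<le> 1 - d + d * (2 * \<bar>sin (u / 2)\<bar> / \<bar>u\<bar>)"
proof -
  let ?I = "indicator {\<alpha>..\<alpha>+1} :: real \<Rightarrow> real"
  have i1: "integrable lborel (\<lambda>z. (f z - d * ?I z) *\<^sub>R iexp (u * z))"
  proof (rule Bochner_Integration.integrable_bound)
    show "integrable lborel (\<lambda>z. f z - d * ?I z)" using integrable_f by auto
  qed auto
  have i2: "integrable lborel (\<lambda>z. ?I z *\<^sub>R iexp (u * z))"
    by (rule integrableI_bounded_set_indicator[of _ _ _ 1]) auto
  have "\<phi> u = (CLBINT z. (f z - d * ?I z) *\<^sub>R iexp (u * z) + d *\<^sub>R (?I z *\<^sub>R iexp (u * z)))"
    unfolding \<phi>_eq by (intro Bochner_Integration.integral_cong) (auto simp: scaleR_left_diff_distrib)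
  also have "\<dots> = (CLBINT z. (f z - d * ?I z) *\<^sub>R iexp (u * z)) + d *\<^sub>R (CLBINT z. ?I z *\<^sub>R iexp (u * z))"
    using i1 i2 by (subst Bochner_Integration.integral_add) (auto simp del: scaleR_scaleR)
  finally have "cmod (\<phi> u) \<le> cmod (CLBINT z. (f z - d * ?I z) *\<^sub>R iexp (u * z)) + d * cmod (CLBINT z. ?I z *\<^sub>R iexp (u * z))"
    using norm_triangle_ineq[of "CLBINT z. (f z - d * ?I z) *\<^sub>R iexp (u * z)" "d *\<^sub>R (CLBINT z. ?I z *\<^sub>R iexp (u * z))"] d_pos
    by simp
  moreover have "cmod (CLBINT z. (f z - d * ?I z) *\<^sub>R iexp (u * z)) \<le> 1 - d"
  proof -
    have "cmod (CLBINT z. (f z - d * ?I z) *\<^sub>R iexp (u * z)) \<le> (\<integral>z. cmod ((f z - d * ?I z) *\<^sub>R iexp (u * z)) \<partial>lborel)"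
      by (rule integral_norm_bound)
    also have "\<dots> = (\<integral>z. f z - d * ?I z \<partial>lborel)"
    proof (rule integral_cong_AE)
      show "AE z in lborel. cmod ((f z - d * ?I z) *\<^sub>R iexp (u * z)) = f z - d * ?I z"
        using AE_lower by eventually_elim auto
    qed measurable
    also have "\<dots> = 1 - d"
      using integrable_f integral_eq_1 by simp
    finally show ?thesis .
  qed
  moreover have "cmod (CLBINT z. ?I z *\<^sub>R iexp (u * z)) = 2 * \<bar>sin (u / 2)\<bar> / \<bar>u\<bar>"
  proof -
    have "(CLBINT z. ?I z *\<^sub>R iexp (u * z)) = (CLBINT z=\<alpha>..\<alpha>+1. iexp (u * z))"
      by (subst interval_integral_Icc) (auto simp: set_lebesgue_integral_def)
    also have "\<dots> = (iexp (u * \<alpha>) - iexp (u * (\<alpha> + 1))) / (\<i> * complex_of_real (- u))"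
      using interval_integral_iexp_scale[of "- u" \<alpha> "\<alpha> + 1"] u by simp
    also have "iexp (u * \<alpha>) - iexp (u * (\<alpha> + 1)) = - (iexp (u * \<alpha>) * (iexp u - 1))"
    proof -
      have "iexp (u * (\<alpha> + 1)) = iexp (u * \<alpha>) * iexp u"
        by (simp add: exp_add[symmetric] distrib_left)
      then show ?thesis by (simp only: right_diff_distrib) simp
    qed
    finally show ?thesis
      by (simp add: norm_mult norm_divide dist_exp_i_1)
  qed
  ultimately show ?thesis by simp
qed

lemma norm_\<phi>_le_1: "cmod (\<phi> u) \<le> 1"
proof -
  interpret real_distribution "density lborel (\<lambda>x. ennreal (f x))"
    by (rule real_distribution_density) (auto simp: nn_integral_f)
  show ?thesis unfolding \<phi>_def by (rule cmod_char_le_1)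
qed

lemma norm_\<phi>_near:
  assumes u: "\<bar>u\<bar> \<le> 4"
  shows "cmod (\<phi> u) \<le> exp (- (d / 30 * u\<^sup>2))"
proof (cases "u = 0")
  case False
  define y where "y = \<bar>u\<bar> / 2"
  have y: "0 < y" "y \<le> 2" using False u by (auto simp: y_def)
  have "\<bar>sin (u / 2)\<bar> = \<bar>sin y\<bar>" by (cases "u \<ge> 0") (auto simp: y_def)
  then have "2 * \<bar>sin (u / 2)\<bar> / \<bar>u\<bar> = \<bar>sin y\<bar> / y" by (simp add: y_def)
  also have "\<dots> \<le> (y - 2 * y ^ 3 / 15) / y"
    using sin_le_cubic[of y] y by (intro divide_right_mono) auto
  also have "\<dots> = 1 - u\<^sup>2 / 30"
    using y by (simp add: y_def field_simps power3_eq_cube power2_eq_square)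
  finally have "cmod (\<phi> u) \<le> 1 - d + d * (1 - u\<^sup>2 / 30)"
    using norm_\<phi>_le_sinc[OF False] d_pos by (smt (verit) mult_left_mono)
  also have "\<dots> = 1 + - (d / 30 * u\<^sup>2)" by (simp add: field_simps)
  also have "\<dots> \<le> exp (- (d / 30 * u\<^sup>2))" by (rule exp_ge_add_one_self)
  finally show ?thesis .
qed (use norm_\<phi>_le_1 in simp)

lemma norm_\<phi>_far:
  assumes u: "\<bar>u\<bar> \<ge> 4"
  shows "cmod (\<phi> u) \<le> 1 - d / 2"
proof -
  have "2 * \<bar>sin (u / 2)\<bar> / \<bar>u\<bar> \<le> 2 * 1 / 4"
    using u by (intro frac_le) auto
  then have "d * (2 * \<bar>sin (u / 2)\<bar> / \<bar>u\<bar>) \<le> d * (1 / 2)"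
    using d_pos by (intro mult_left_mono) auto
  moreover have "u \<noteq> 0" using u by auto
  ultimately show ?thesis using norm_\<phi>_le_sinc[of u] by simp
qed

lemma \<phi>_taylor:
  "cmod (\<phi> u - (1 - \<sigma>2 * u\<^sup>2 / 2)) \<le> B * mom 3 / 6 * \<bar>u\<bar> ^ 3"
proof -
  let ?T = "\<lambda>z. complex_of_real (f z - f z * z\<^sup>2 * u\<^sup>2 / 2) + \<i> * complex_of_real (u * (f z * z))"
  have i: "integrable lborel (\<lambda>z. f z *\<^sub>R iexp (u * z))"
    by (rule Bochner_Integration.integrable_bound[OF integrable_f]) auto
  have "integrable lborel (\<lambda>z. f z - f z * z\<^sup>2 * u\<^sup>2 / 2)"
    using integrable_f integrable_power[of 2] by simp
  then have i1: "integrable lborel (\<lambda>z. complex_of_real (f z - f z * z\<^sup>2 * u\<^sup>2 / 2))"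
    by (rule integrable_of_real)
  have "integrable lborel (\<lambda>z. u * (f z * z))"
    using integrable_power[of 1] by simp
  then have i2: "integrable lborel (\<lambda>z. \<i> * complex_of_real (u * (f z * z)))"
    by (intro integrable_mult_right) (rule integrable_of_real)
  have "(\<integral>z. f z - f z * z\<^sup>2 * u\<^sup>2 / 2 \<partial>lborel) = 1 - \<sigma>2 * u\<^sup>2 / 2"
    using integrable_f integrable_power[of 2] integral_eq_1 by (simp add: \<sigma>2_def)
  then have "(CLBINT z. complex_of_real (f z - f z * z\<^sup>2 * u\<^sup>2 / 2) + \<i> * complex_of_real (u * (f z * z)))
      = 1 - \<sigma>2 * u\<^sup>2 / 2"
    unfolding Bochner_Integration.integral_add[OF i1 i2] integral_mult_right_zero integral_complex_of_real mean_zero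
    by simp
  then have "cmod (\<phi> u - (1 - \<sigma>2 * u\<^sup>2 / 2)) = cmod (CLBINT z. f z *\<^sub>R iexp (u * z)
      - ?T z)"
    unfolding Bochner_Integration.integral_diff[OF i Bochner_Integration.integrable_add[OF i1 i2]] \<phi>_eq
    by simp
  also have "\<dots> \<le> (\<integral>z. cmod (f z *\<^sub>R iexp (u * z)
      - ?T z) \<partial>lborel)"
    by (rule integral_norm_bound)
  also have "\<dots> \<le> (\<integral>z. \<bar>u\<bar> ^ 3 / 6 * (f z * \<bar>z\<bar> ^ 3) \<partial>lborel)"
  proof (rule integral_mono')
    show "integrable lborel (\<lambda>z. \<bar>u\<bar> ^ 3 / 6 * (f z * \<bar>z\<bar> ^ 3))"
      by (intro integrable_mult_right integrable_moment)
    fix z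
    have taylor: "(\<Sum>k\<le>2. (\<i> * complex_of_real x) ^ k / fact k) = 1 + \<i> * x - complex_of_real x ^ 2 / 2" for x
      by (simp add: numeral_2_eq_2) (simp add: algebra_simps)
    have eq: "f z *\<^sub>R iexp (u * z) - ?T z
        = f z *\<^sub>R (iexp (u * z) - (\<Sum>k\<le>2. (\<i> * complex_of_real (u * z)) ^ k / fact k))"
    proof -
      have "f z *\<^sub>R w - ?T z
          = f z *\<^sub>R (w - (1 + \<i> * complex_of_real (u * z) - complex_of_real (u * z) ^ 2 / 2))" for w
        by (simp add: complex_eq_iff power2_eq_square algebra_simps)
      then show ?thesis unfolding taylor .
    qed
    have "cmod (f z *\<^sub>R iexp (u * z)
        - ?T z) = f z * cmod (iexp (u * z) - (\<Sum>k\<le>2. (\<i> * complex_of_real (u * z)) ^ k / fact k))"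
      unfolding eq using nonneg by simp
    also have "\<dots> \<le> f z * (\<bar>u * z\<bar> ^ 3 / 6)"
      using iexp_approx1[of "u * z" 2] nonneg by (intro mult_left_mono) (auto simp: fact_numeral)
    finally show "cmod (f z *\<^sub>R iexp (u * z)
        - ?T z) \<le> \<bar>u\<bar> ^ 3 / 6 * (f z * \<bar>z\<bar> ^ 3)"
      by (simp add: abs_mult power_mult_distrib mult_ac)
    show "0 \<le> \<bar>u\<bar> ^ 3 / 6 * (f z * \<bar>z\<bar> ^ 3)" using nonneg by simp
  qed
  also have "\<dots> \<le> \<bar>u\<bar> ^ 3 / 6 * (B * mom 3)"
    unfolding integral_mult_right_zero by (intro mult_left_mono moment_le) auto
  finally show ?thesis by (simp add: mult_ac)
qed

lemma char_gauss_diff: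
  assumes u: "\<bar>u\<bar> \<le> 4"
  shows "cmod (\<phi> u - exp (- (\<sigma>2 * u\<^sup>2 / 2))) \<le> (B * mom 3 / 6 + (B * mom 2)\<^sup>2 / 2) * \<bar>u\<bar> ^ 3"
proof -
  define y where "y = \<sigma>2 * u\<^sup>2 / 2"
  have \<sigma>: "\<sigma>2 \<ge> 0" using \<sigma>2_ge d_pos by simp
  have y: "y \<ge> 0" using \<sigma> by (simp add: y_def)
  have "\<bar>(1 - y) - exp (- y)\<bar> \<le> y\<^sup>2 / 2"
  proof -
    have "exp (- y) \<le> 1 - y + y\<^sup>2 / 2"
    proof -
      define h where "h = (\<lambda>x::real. 1 - x + x\<^sup>2 / 2 - exp (- x))"
      have "h 0 \<le> h y"
      proof (rule DERIV_nonneg_imp_nondecreasing[OF y])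
        fix x :: real assume "0 \<le> x" "x \<le> y"
        have "(h has_real_derivative (- 1 + x + exp (- x))) (at x)"
          unfolding h_def by (auto intro!: derivative_eq_intros)
        moreover have "0 \<le> - 1 + x + exp (- x)" using exp_ge_add_one_self[of "- x"] by simp
        ultimately show "\<exists>y. (h has_real_derivative y) (at x) \<and> 0 \<le> y" by blast
      qed
      then show ?thesis by (simp add: h_def)
    qed
    moreover have "1 - y \<le> exp (- y)" using exp_ge_add_one_self[of "- y"] by simp
    ultimately show ?thesis by simp
  qed
  then have 1: "cmod (complex_of_real (1 - y) - complex_of_real (exp (- y))) \<le> y\<^sup>2 / 2"
    by (simp only: of_real_diff[symmetric] norm_of_real)
  have "y\<^sup>2 / 2 = \<sigma>2\<^sup>2 * (\<bar>u\<bar> * \<bar>u\<bar> ^ 3) / 8"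
    by (simp add: y_def power_mult_distrib power_divide power2_eq_square power3_eq_cube)
  also have "\<dots> \<le> (B * mom 2)\<^sup>2 * (4 * \<bar>u\<bar> ^ 3) / 8"
    using u \<sigma>2_le \<sigma> by (intro divide_right_mono mult_mono power_mono) auto
  also have "\<dots> = (B * mom 2)\<^sup>2 / 2 * \<bar>u\<bar> ^ 3" by simp
  finally have 2: "y\<^sup>2 / 2 \<le> (B * mom 2)\<^sup>2 / 2 * \<bar>u\<bar> ^ 3" .
  have "cmod (\<phi> u - exp (- y)) \<le> cmod (\<phi> u - complex_of_real (1 - y)) + cmod (complex_of_real (1 - y) - complex_of_real (exp (- y)))"
    using norm_triangle_ineq[of "\<phi> u - complex_of_real (1 - y)" "complex_of_real (1 - y) - complex_of_real (exp (- y))"]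
    by (simp add: exp_of_real)
  also have "\<dots> \<le> B * mom 3 / 6 * \<bar>u\<bar> ^ 3 + (B * mom 2)\<^sup>2 / 2 * \<bar>u\<bar> ^ 3"
    using \<phi>_taylor[of u] 1 2 by (intro add_mono) (auto simp: y_def)
  finally show ?thesis by (simp add: y_def distrib_right exp_of_real[symmetric])
qed

text \<open>Three regimes in one estimate. For \<open>|u| \<le> 4\<close> the first term comes from comparing \<open>\<phi>\<^sup>k\<close> with the
Gaussian and the second from replacing \<open>exp (- i u z)\<close> by \<open>1\<close>. For larger \<open>u\<close> the third term bounds
\<open>\<phi>\<^sup>k\<close> and the first absorbs the Gaussian. The exponent uses \<open>d / 60\<close>, half of the rate \<open>d / 30\<close>
available for \<open>\<phi>\<close>, because a difference of \<open>k\<close>-th powers retains only \<open>k - 1 \<ge> k / 2\<close> factors.\<close>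

lemma fourier_integrand_bound:
  assumes k: "k \<ge> 2"
  shows "cmod (\<phi> u ^ k * iexp (- (u * z)) - exp (- (real k * \<sigma>2 * u\<^sup>2 / 2)))
    \<le> real k * (B * mom 3 / 6 + (B * mom 2)\<^sup>2 / 2 + 1) * (\<bar>u\<bar> ^ 3 * exp (- (d / 60 * real k * u\<^sup>2)))
      + \<bar>z\<bar> * (\<bar>u\<bar> * exp (- (d / 60 * real k * u\<^sup>2)))
      + (1 - d / 2) ^ (k - 2) * (cmod (\<phi> u))\<^sup>2"
proof -
  define E where "E = exp (- (d / 60 * real k * u\<^sup>2))"
  define C where "C = B * mom 3 / 6 + (B * mom 2)\<^sup>2 / 2"
  define b where "b = exp (- (\<sigma>2 * u\<^sup>2 / 2))"
  have bk: "exp (- (real k * \<sigma>2 * u\<^sup>2 / 2)) = b ^ k"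
    unfolding b_def by (simp add: exp_of_nat_mult[symmetric] mult_ac)
  have C0: "C \<ge> 0" unfolding C_def using B_pos exp_moment_nonneg by simp
  have E0: "E \<ge> 0" unfolding E_def by simp
  have d2: "0 \<le> 1 - d / 2" using d_le_1 by simp
  have tri: "cmod (\<phi> u ^ k * iexp (- (u * z)) - of_real (b ^ k))
      \<le> cmod (\<phi> u ^ k - of_real (b ^ k)) + cmod (\<phi> u) ^ k * cmod (iexp (- (u * z)) - 1)"
  proof -
    have "\<phi> u ^ k * iexp (- (u * z)) - of_real (b ^ k)
        = (\<phi> u ^ k - of_real (b ^ k)) + \<phi> u ^ k * (iexp (- (u * z)) - 1)"
      by (simp add: algebra_simps)
    then show ?thesis
      using norm_triangle_ineq by (metis norm_mult norm_power)
  qed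
  have b_le: "b \<le> exp (- (d / 30 * u\<^sup>2))"
  proof -
    have "d / 30 * u\<^sup>2 \<le> \<sigma>2 / 2 * u\<^sup>2" using \<sigma>2_ge d_pos by (intro mult_right_mono) auto
    then show ?thesis by (simp add: b_def)
  qed
  show ?thesis
  proof (cases "\<bar>u\<bar> \<le> 4")
    case True
    let ?r = "exp (- (d / 30 * u\<^sup>2))"
    obtain j where j: "k = Suc j" "k \<le> 2 * j" using k by (cases k) auto
    have "?r ^ j = exp (- (d / 30 * real j * u\<^sup>2))"
      by (simp add: exp_of_nat_mult[symmetric] mult_ac)
    also have "\<dots> \<le> E"
    proof -
      have "real k \<le> 2 * real j" using j(2) by linarith
      then have "d / 60 * real k * u\<^sup>2 \<le> d / 60 * (2 * real j) * u\<^sup>2"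
        using d_pos by (intro mult_right_mono mult_left_mono) auto
      then show ?thesis unfolding E_def by simp
    qed
    finally have rj: "?r ^ j \<le> E" .
    have rk: "?r ^ k \<le> E"
    proof -
      have "?r ^ Suc j \<le> ?r ^ j" using d_pos by (intro power_decreasing) auto
      then show ?thesis using rj unfolding j(1) by (rule order_trans)
    qed
    have "cmod (\<phi> u ^ Suc j - of_real b ^ Suc j) \<le> real (Suc j) * ?r ^ j * cmod (\<phi> u - of_real b)"
      by (rule norm_power_diff_le) (use norm_\<phi>_near[OF True] b_le in \<open>auto simp: b_def\<close>)
    also have "\<dots> \<le> real (Suc j) * E * (C * \<bar>u\<bar> ^ 3)"
      using rj char_gauss_diff[OF True] E0 unfolding C_def b_def
      by (intro mult_mono mult_left_mono) (auto simp: exp_of_real)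
    finally have 1: "cmod (\<phi> u ^ k - of_real (b ^ k)) \<le> real k * C * (\<bar>u\<bar> ^ 3 * E)"
      by (simp add: j mult_ac)
    have "cmod (iexp (- (u * z)) - 1) \<le> \<bar>u * z\<bar>"
      using iexp_approx1[of "- (u * z)" 0] by simp
    moreover have "cmod (\<phi> u) ^ k \<le> E"
      using norm_\<phi>_near[OF True] rk power_mono[of "cmod (\<phi> u)" ?r k] by simp
    ultimately have 2: "cmod (\<phi> u) ^ k * cmod (iexp (- (u * z)) - 1) \<le> E * \<bar>u * z\<bar>"
      using E0 by (intro mult_mono) auto
    have "0 \<le> real k * (\<bar>u\<bar> ^ 3 * E)" "0 \<le> (1 - d / 2) ^ (k - 2) * (cmod (\<phi> u))\<^sup>2"
      using E0 d2 by auto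
    then show ?thesis
      using tri 1 2 unfolding bk E_def[symmetric] C_def[symmetric]
      by (simp add: algebra_simps abs_mult exp_of_real)
  next
    case False
    have "cmod (\<phi> u) ^ k = cmod (\<phi> u) ^ (k - 2) * (cmod (\<phi> u))\<^sup>2"
      using k by (metis le_add_diff_inverse2 power_add)
    also have "\<dots> \<le> (1 - d / 2) ^ (k - 2) * (cmod (\<phi> u))\<^sup>2"
      using norm_\<phi>_far[of u] False by (intro mult_right_mono power_mono) auto
    finally have 1: "cmod (\<phi> u ^ k * iexp (- (u * z))) \<le> (1 - d / 2) ^ (k - 2) * (cmod (\<phi> u))\<^sup>2"
      by (simp add: norm_mult norm_power)
    have "b ^ k \<le> exp (- (d / 30 * u\<^sup>2)) ^ k"
      using b_le by (intro power_mono) (auto simp: b_def)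
    also have "\<dots> \<le> E"
      unfolding E_def using d_pos by (simp add: exp_of_nat_mult[symmetric] mult_ac)
    also have "E \<le> real k * (\<bar>u\<bar> ^ 3 * E)"
    proof -
      have "1 ^ 3 \<le> \<bar>u\<bar> ^ 3" using False by (intro power_mono) auto
      then have "1 * 1 \<le> real k * \<bar>u\<bar> ^ 3" using k by (intro mult_mono) auto
      from mult_right_mono[OF this E0] show ?thesis by (simp add: mult_ac)
    qed
    finally have 2: "b ^ k \<le> real k * (\<bar>u\<bar> ^ 3 * E)" .
    have b0: "b ^ k \<ge> 0" unfolding b_def by simp
    have "cmod (\<phi> u ^ k * iexp (- (u * z)) - of_real (b ^ k)) \<le> (1 - d / 2) ^ (k - 2) * (cmod (\<phi> u))\<^sup>2 + b ^ k"
    proof -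
      have "cmod (complex_of_real (b ^ k)) = b ^ k" using b0 by (simp only: norm_of_real abs_of_nonneg)
      then show ?thesis
        using norm_triangle_ineq4[of "\<phi> u ^ k * iexp (- (u * z))" "complex_of_real (b ^ k)"] 1 by linarith
    qed
    moreover have "0 \<le> real k * C * (\<bar>u\<bar> ^ 3 * E)" "0 \<le> \<bar>z\<bar> * (\<bar>u\<bar> * E)"
      using C0 E0 by auto
    ultimately show ?thesis
      using 2 unfolding bk E_def[symmetric] C_def[symmetric] by (simp add: algebra_simps exp_of_real)
  qed
qed

lemma borel_measurable_\<phi> [measurable]: "\<phi> \<in> borel_measurable borel"
proof -
  interpret real_distribution "density lborel (\<lambda>x. ennreal (f x))"
    by (rule real_distribution_density) (auto simp: nn_integral_f)
  show ?thesis unfolding \<phi>_def by measurable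
qed

lemma integrable_char_square: "integrable lborel (\<lambda>u. (cmod (\<phi> u))\<^sup>2)"
  and integral_char_square_le: "(\<integral>u. (cmod (\<phi> u))\<^sup>2 \<partial>lborel) \<le> 2 * pi * B"
proof -
  have le: "(\<integral>\<^sup>+u. ennreal ((cmod (\<phi> u))\<^sup>2) \<partial>lborel) \<le> ennreal (2 * pi * B)"
    unfolding \<phi>_def using B_pos
    by (intro nn_integral_char_square_le) (auto simp: nn_integral_f le_B ennreal_leI)
  show i: "integrable lborel (\<lambda>u. (cmod (\<phi> u))\<^sup>2)"
    using le by (intro integrableI_bounded) (auto simp: less_top[symmetric] top_unique)
  show "(\<integral>u. (cmod (\<phi> u))\<^sup>2 \<partial>lborel) \<le> 2 * pi * B"
    using le nn_integral_eq_integral[OF i] B_pos by (simp add: ennreal_le_iff)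
qed

lemma integrable_char_power:
  assumes "k \<ge> 2" shows "integrable lborel (\<lambda>u. \<phi> u ^ k)"
proof (rule Bochner_Integration.integrable_bound[OF integrable_char_square])
  show "AE u in lborel. norm (\<phi> u ^ k) \<le> norm ((cmod (\<phi> u))\<^sup>2)"
    using assms norm_\<phi>_le_1 by (intro AE_I2) (simp add: norm_power power_decreasing)
qed measurable

abbreviation gmom where "gmom j \<equiv> (\<integral>u. \<bar>u\<bar> ^ j * exp (- (d / 60 * u\<^sup>2)) \<partial>lborel)"

text \<open>Integrating the preceding bound: \<open>k |u|\<^sup>3\<close> and \<open>|u|\<close> against a Gaussian of variance of order \<open>1 / k\<close>
both give \<open>O(1 / k)\<close>, one factor \<open>\<surd>k\<close> smaller than the main term.\<close>

lemma inverse_fourier_bound: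
  assumes k: "k \<ge> 2"
  shows "\<bar>Re (CLBINT u. \<phi> u ^ k * iexp (- (u * z))) / (2 * pi) - 1 / sqrt (2 * pi * \<sigma>2 * real k)\<bar>
    \<le> ((B * mom 3 / 6 + (B * mom 2)\<^sup>2 / 2 + 1) * gmom 3 / real k + \<bar>z\<bar> * gmom 1 / real k
      + (1 - d / 2) ^ (k - 2) * (2 * pi * B)) / (2 * pi)"
proof -
  define C where "C = B * mom 3 / 6 + (B * mom 2)\<^sup>2 / 2 + 1"
  define \<kappa> where "\<kappa> = sqrt (real k)"
  have \<kappa>: "\<kappa> > 0" "\<kappa>\<^sup>2 = real k" using k by (auto simp: \<kappa>_def)
  have \<sigma>: "\<sigma>2 > 0" using \<sigma>2_ge d_pos by simp
  have d60: "d / 60 > 0" using d_pos by simp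
  define s where "s = 1 / sqrt (\<sigma>2 * real k)"
  have s: "s > 0" "s\<^sup>2 = 1 / (\<sigma>2 * real k)" using \<sigma> k by (auto simp: s_def power_divide)
  have gauss: "has_bochner_integral lborel (\<lambda>u. exp (- (real k * \<sigma>2 * u\<^sup>2 / 2))) (sqrt (2 * pi * s\<^sup>2))"
  proof -
    have "has_bochner_integral lborel (\<lambda>u. sqrt (2 * pi * s\<^sup>2) * normal_density 0 s u) (sqrt (2 * pi * s\<^sup>2) * 1)"
      using s by (intro has_bochner_integral_mult_right) (simp add: has_bochner_integral_iff)
    moreover have "sqrt (2 * pi * s\<^sup>2) * normal_density 0 s u = exp (- (real k * \<sigma>2 * u\<^sup>2 / 2))" for u
      using s \<sigma> k by (simp add: normal_density_def mult_ac)
    ultimately show ?thesis by simp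
  qed
  have i\<phi>: "integrable lborel (\<lambda>u. \<phi> u ^ k * iexp (- (u * z)))"
    by (rule Bochner_Integration.integrable_bound[OF integrable_char_power[OF k]]) (auto simp: norm_mult)
  have ig: "integrable lborel (\<lambda>u. complex_of_real (exp (- (real k * \<sigma>2 * u\<^sup>2 / 2))))"
    using gauss by (intro integrable_of_real) (simp add: has_bochner_integral_iff)
  define E where "E = (\<lambda>j u. \<bar>u\<bar> ^ j * exp (- (d / 60 * real k * u\<^sup>2)))"
  have iE: "integrable lborel (E j)" and IE: "(\<integral>u. E j u \<partial>lborel) = gmom j / \<kappa> ^ Suc j" for j
    using integrable_abs_power_gauss[of "d / 60 * real k" j] d60 k
      integral_abs_power_gauss_scale[OF d60 \<kappa>(1), of j] unfolding \<kappa>(2) E_def by auto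
  have "cmod ((CLBINT u. \<phi> u ^ k * iexp (- (u * z))) - sqrt (2 * pi * s\<^sup>2))
      = cmod (CLBINT u. \<phi> u ^ k * iexp (- (u * z)) - complex_of_real (exp (- (real k * \<sigma>2 * u\<^sup>2 / 2))))"
    using i\<phi> ig gauss by (subst Bochner_Integration.integral_diff) (auto simp: has_bochner_integral_iff)
  also have "\<dots> \<le> (\<integral>u. cmod (\<phi> u ^ k * iexp (- (u * z)) - complex_of_real (exp (- (real k * \<sigma>2 * u\<^sup>2 / 2)))) \<partial>lborel)"
    by (rule integral_norm_bound)
  also have "\<dots> \<le> (\<integral>u. real k * C * E 3 u + \<bar>z\<bar> * E 1 u + (1 - d / 2) ^ (k - 2) * (cmod (\<phi> u))\<^sup>2 \<partial>lborel)"
  proof (rule integral_mono)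
    show "integrable lborel (\<lambda>u. cmod (\<phi> u ^ k * iexp (- (u * z)) - complex_of_real (exp (- (real k * \<sigma>2 * u\<^sup>2 / 2)))))"
      by (intro integrable_norm Bochner_Integration.integrable_diff i\<phi> ig)
    show "integrable lborel (\<lambda>u. real k * C * E 3 u + \<bar>z\<bar> * E 1 u + (1 - d / 2) ^ (k - 2) * (cmod (\<phi> u))\<^sup>2)"
      by (intro Bochner_Integration.integrable_add integrable_mult_right iE integrable_char_square)
  qed (use fourier_integrand_bound[OF k, of _ z] in \<open>simp add: E_def C_def exp_of_real\<close>)
  also have "\<dots> = real k * C * (gmom 3 / \<kappa> ^ 4) + \<bar>z\<bar> * (gmom 1 / \<kappa>\<^sup>2) + (1 - d / 2) ^ (k - 2) * (\<integral>u. (cmod (\<phi> u))\<^sup>2 \<partial>lborel)"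
    using iE integrable_char_square by (simp add: IE numeral_eq_Suc)
  also have "\<dots> \<le> C * gmom 3 / real k + \<bar>z\<bar> * gmom 1 / real k + (1 - d / 2) ^ (k - 2) * (2 * pi * B)"
  proof -
    have "\<kappa> ^ 4 = (\<kappa>\<^sup>2)\<^sup>2" by simp
    then have "real k * C * (gmom 3 / \<kappa> ^ 4) = C * gmom 3 / real k"
      using k unfolding \<kappa>(2) by (simp add: power2_eq_square)
    moreover have "(1 - d / 2) ^ (k - 2) * (\<integral>u. (cmod (\<phi> u))\<^sup>2 \<partial>lborel) \<le> (1 - d / 2) ^ (k - 2) * (2 * pi * B)"
      using integral_char_square_le d_le_1 by (intro mult_left_mono) auto
    ultimately show ?thesis unfolding \<kappa>(2) by simp
  qed
  finally have "cmod ((CLBINT u. \<phi> u ^ k * iexp (- (u * z))) - sqrt (2 * pi * s\<^sup>2))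
      \<le> C * gmom 3 / real k + \<bar>z\<bar> * gmom 1 / real k + (1 - d / 2) ^ (k - 2) * (2 * pi * B)" (is "_ \<le> ?R") .
  moreover have "Re ((CLBINT u. \<phi> u ^ k * iexp (- (u * z))) - sqrt (2 * pi * s\<^sup>2))
      = Re (CLBINT u. \<phi> u ^ k * iexp (- (u * z))) - sqrt (2 * pi * s\<^sup>2)" by simp
  ultimately have "\<bar>Re (CLBINT u. \<phi> u ^ k * iexp (- (u * z))) - sqrt (2 * pi * s\<^sup>2)\<bar> \<le> ?R"
    using abs_Re_le_cmod[of "(CLBINT u. \<phi> u ^ k * iexp (- (u * z))) - sqrt (2 * pi * s\<^sup>2)"] by linarith
  then have "\<bar>Re (CLBINT u. \<phi> u ^ k * iexp (- (u * z))) - sqrt (2 * pi * s\<^sup>2)\<bar> / (2 * pi) \<le> ?R / (2 * pi)"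
    by (intro divide_right_mono) auto
  moreover have "sqrt (2 * pi * s\<^sup>2) / (2 * pi) = 1 / sqrt (2 * pi * \<sigma>2 * real k)"
  proof -
    have "sqrt (2 * pi * s\<^sup>2) / (2 * pi) = sqrt (2 * pi * s\<^sup>2 / (2 * pi)\<^sup>2)"
      unfolding real_sqrt_divide real_sqrt_abs by simp
    also have "2 * pi * s\<^sup>2 / (2 * pi)\<^sup>2 = 1 / (2 * pi * \<sigma>2 * real k)"
      using s by (simp add: power2_eq_square field_simps)
    finally show ?thesis by (simp add: real_sqrt_divide)
  qed
  moreover have "\<bar>x - y\<bar> / (2 * pi) = \<bar>x / (2 * pi) - y / (2 * pi)\<bar>" for x y :: real
    by (simp add: diff_divide_distrib[symmetric] abs_divide)
  ultimately show ?thesis unfolding C_def by simp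
qed

end

text \<open>With \<open>j = k - 2\<close> this is \<open>j (1 - d / 2)\<^sup>j \<le> j exp (- j d / 2) \<le> 2 / d\<close>; it converts the geometric
contribution of large frequencies into one of order \<open>1 / k\<close>.\<close>

lemma mult_power_le:
  fixes d :: real
  assumes d: "0 < d" "d \<le> 1" and k: "k \<ge> 2"
  shows "real k * (1 - d / 2) ^ (k - 2) \<le> 2 / d + 2"
proof -
  define j where "j = k - 2"
  have r: "0 \<le> 1 - d / 2" "1 - d / 2 \<le> exp (- (d / 2))"
    using d exp_ge_add_one_self[of "- (d / 2)"] by auto
  have "(1 - d / 2) ^ j \<le> exp (- (d / 2)) ^ j" using r by (intro power_mono)
  also have "\<dots> = exp (- (real j * d / 2))" by (simp add: exp_of_nat_mult[symmetric])
  finally have "real j * (1 - d / 2) ^ j \<le> real j * exp (- (real j * d / 2))" by (intro mult_left_mono) auto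
  also have "\<dots> \<le> 2 / d"
  proof -
    have "real j * d / 2 \<le> exp (real j * d / 2)" using exp_ge_add_one_self[of "real j * d / 2"] by linarith
    then have "real j * d / 2 * exp (- (real j * d / 2)) \<le> exp (real j * d / 2) * exp (- (real j * d / 2))"
      by (intro mult_right_mono) auto
    also have "\<dots> = 1" by (simp add: exp_minus)
    finally show ?thesis using d by (simp add: field_simps)
  qed
  finally have "real j * (1 - d / 2) ^ j \<le> 2 / d" .
  moreover have "2 * (1 - d / 2) ^ j \<le> 2 * 1"
    using r d by (intro mult_left_mono power_le_one) auto
  moreover have "real k = real j + 2" using k by (simp add: j_def)
  ultimately show ?thesis unfolding j_def[symmetric] by (simp add: distrib_right)
qed

context tame_density
begin

definition llt_const where
  "llt_const = ((B * mom 3 / 6 + (B * mom 2)\<^sup>2 / 2 + 1) * gmom 3 + B * mom 1 * gmom 1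
     + (2 / d + 2) * (2 * pi * B)) / (2 * pi)"

lemma gmom_nonneg: "gmom j \<ge> 0"
  by (intro Bochner_Integration.integral_nonneg) simp

lemma conv_pow_finite: "conv_pow (\<lambda>x. ennreal (f x)) (Suc j) z \<le> ennreal B"
  by (intro conv_pow_le) (auto simp: nn_integral_f le_B ennreal_leI)

text \<open>The local limit theorem in the only form that is needed: the density of the sum of \<open>k\<close> summands, at
the point that a further summand would have to compensate, is close on average to its Gaussian value
at \<open>0\<close>. Averaging over the tame density \<open>f\<close> absorbs the linear growth in \<open>z\<close> of the pointwise error.\<close>

lemma local_limit_weighted:
  assumes k: "k \<ge> 2"
  defines "F \<equiv> \<lambda>z. enn2real (conv_pow (\<lambda>x. ennreal (f x)) k z)"
  shows "integrable lborel (\<lambda>z. f z * \<bar>F (- z) - 1 / sqrt (2 * pi * \<sigma>2 * real k)\<bar>)"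
    and "(\<integral>z. f z * \<bar>F (- z) - 1 / sqrt (2 * pi * \<sigma>2 * real k)\<bar> \<partial>lborel) \<le> llt_const / real k"
proof -
  let ?fe = "\<lambda>x. ennreal (f x)"
  define L where "L = 1 / sqrt (2 * pi * \<sigma>2 * real k)"
  define J where "J = (\<lambda>z. Re (CLBINT u. \<phi> u ^ k * iexp (- (u * z))) / (2 * pi))"
  obtain j where j: "k = Suc j" using k by (cases k) auto
  have fe [measurable]: "?fe \<in> borel_measurable borel" by measurable
  have [measurable]: "F \<in> borel_measurable borel" "J \<in> borel_measurable borel"
    unfolding F_def J_def by measurable
  define \<mu>k where "\<mu>k = density lborel (conv_pow ?fe k)"
  have char_k: "char \<mu>k = (\<lambda>u. \<phi> u ^ k)"
    unfolding \<mu>k_def j \<phi>_def by (rule ext, rule char_conv_pow) (auto simp: nn_integral_f)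
  have "AE z in lborel. F z = J z"
  proof -
    have nn: "(\<integral>\<^sup>+x. conv_pow ?fe k x \<partial>lborel) = 1"
      unfolding j by (rule nn_integral_conv_pow) (auto simp: nn_integral_f)
    have "integrable lborel (char (density lborel (conv_pow ?fe k)))"
      unfolding \<mu>k_def[symmetric] char_k by (rule integrable_char_power[OF k])
    with nn have "AE z in lborel. conv_pow ?fe k z = ennreal (Re (CLBINT u. \<phi> u ^ k * iexp (- (u * z))) / (2 * pi))
        \<and> 0 \<le> Re (CLBINT u. \<phi> u ^ k * iexp (- (u * z)))"
      using density_eq_inverse_fourier[of "conv_pow ?fe k"]
      unfolding \<mu>k_def[symmetric] char_k by auto
    then show ?thesis
    proof eventually_elim
      case (elim z)
      then have "0 \<le> J z" unfolding J_def by (intro divide_nonneg_pos) auto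
      then show ?case using elim unfolding F_def J_def by simp
    qed
  qed
  then have "AE z in lborel. F (0 + (-1) * z) = J (0 + (-1) * z)"
    by (intro AE_borel_affine) auto
  then have AE: "AE z in lborel. F (- z) = J (- z)" by simp
  have F: "F z \<ge> 0" "F z \<le> B" for z
  proof -
    show "F z \<ge> 0" unfolding F_def by simp
    show "F z \<le> B" using conv_pow_finite[of j z] B_pos unfolding F_def j by (simp add: enn2real_leI)
  qed
  define G where "G = (\<lambda>z. f z * (((B * mom 3 / 6 + (B * mom 2)\<^sup>2 / 2 + 1) * gmom 3 / real k + \<bar>z\<bar> * gmom 1 / real k
      + (1 - d / 2) ^ (k - 2) * (2 * pi * B)) / (2 * pi)))"
  have G_eq: "G z = (((B * mom 3 / 6 + (B * mom 2)\<^sup>2 / 2 + 1) * gmom 3 / real k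
      + (1 - d / 2) ^ (k - 2) * (2 * pi * B)) / (2 * pi)) * f z + gmom 1 / real k / (2 * pi) * (f z * \<bar>z\<bar> ^ 1)" for z
    unfolding G_def by (simp add: field_simps)
  have iG: "integrable lborel G"
    unfolding G_eq[abs_def]
    by (intro Bochner_Integration.integrable_add integrable_mult_right integrable_f integrable_moment)
  have AE_le: "AE z in lborel. f z * \<bar>F (- z) - L\<bar> \<le> G z"
    using AE
  proof eventually_elim
    case (elim z)
    show ?case
      using inverse_fourier_bound[OF k, of "- z"] nonneg[of z]
      unfolding elim G_def J_def L_def by (intro mult_left_mono) auto
  qed
  show i: "integrable lborel (\<lambda>z. f z * \<bar>F (- z) - 1 / sqrt (2 * pi * \<sigma>2 * real k)\<bar>)"
    unfolding L_def[symmetric]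
  proof (rule Bochner_Integration.integrable_bound[OF iG])
    show "AE z in lborel. norm (f z * \<bar>F (- z) - L\<bar>) \<le> norm (G z)"
      using AE_le by eventually_elim (simp add: nonneg)
  qed measurable
  have "(\<integral>z. f z * \<bar>F (- z) - L\<bar> \<partial>lborel) \<le> (\<integral>z. G z \<partial>lborel)"
    using i AE_le unfolding L_def[symmetric] by (intro integral_mono_AE iG) auto
  also have "\<dots> = (((B * mom 3 / 6 + (B * mom 2)\<^sup>2 / 2 + 1) * gmom 3 / real k
      + (1 - d / 2) ^ (k - 2) * (2 * pi * B)) / (2 * pi)) + gmom 1 / real k / (2 * pi) * (\<integral>z. f z * \<bar>z\<bar> ^ 1 \<partial>lborel)"
    unfolding G_eq[abs_def] using integrable_f integrable_moment[of 1]
    by (subst Bochner_Integration.integral_add) (auto simp: integral_eq_1)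
  also have "\<dots> \<le> (((B * mom 3 / 6 + (B * mom 2)\<^sup>2 / 2 + 1) * gmom 3 / real k
      + (2 / d + 2) / real k * (2 * pi * B)) / (2 * pi)) + gmom 1 / real k / (2 * pi) * (B * mom 1)"
  proof (intro add_mono mult_left_mono divide_right_mono mult_right_mono moment_le order_refl)
    show "(1 - d / 2) ^ (k - 2) \<le> (2 / d + 2) / real k"
      using mult_power_le[OF d_pos d_le_1 k] k by (simp add: field_simps)
  qed (use B_pos gmom_nonneg[of 1] exp_moment_nonneg[of c 3] in auto)
  also have "\<dots> = llt_const / real k"
    unfolding llt_const_def using k by (simp add: field_simps)
  finally show "(\<integral>z. f z * \<bar>F (- z) - 1 / sqrt (2 * pi * \<sigma>2 * real k)\<bar> \<partial>lborel) \<le> llt_const / real k"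
    unfolding L_def .
qed

end

section \<open>The conditional law and the Gaussian tilt as reweightings\<close>

lemma lborel_affine_substitution:
  fixes g :: "real \<Rightarrow> real"
  assumes w: "w > 0"
  shows "integrable lborel g \<longleftrightarrow> integrable lborel (\<lambda>z. w * g (a + w * z))"
    and "(\<integral>x. g x \<partial>lborel) = (\<integral>z. w * g (a + w * z) \<partial>lborel)"
proof -
  have "integrable lborel (\<lambda>z. w * g (a + w * z)) \<longleftrightarrow> integrable lborel (\<lambda>z. g (a + w * z))"
  proof
    assume "integrable lborel (\<lambda>z. w * g (a + w * z))"
    then have "integrable lborel (\<lambda>z. (1 / w) * (w * g (a + w * z)))" by (rule integrable_mult_right)
    then show "integrable lborel (\<lambda>z. g (a + w * z))" using w by simp
  qed (rule integrable_mult_right)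
  then show "integrable lborel g \<longleftrightarrow> integrable lborel (\<lambda>z. w * g (a + w * z))"
    using w lborel_integrable_real_affine_iff[of w g a] by simp
  show "(\<integral>x. g x \<partial>lborel) = (\<integral>z. w * g (a + w * z) \<partial>lborel)"
    using w by (subst lborel_integral_real_affine[of w _ a]) auto
qed

text \<open>In the rescaled coordinate \<open>z = (x - a) / w\<close> the conditional density is \<open>f z F(- z) / N\<close>, where \<open>F\<close> is
the density of the sum of \<open>n - 1\<close> rescaled summands and \<open>N = \<integral> f z F(- z) dz\<close> is the density of the
sum of \<open>n\<close> at \<open>0\<close>. All tilting and scaling factors cancel, and the local limit theorem says that the
weight is close to the constant \<open>L\<close>.\<close>

lemma gibbs_conditioning_L1:
  fixes p :: "real \<Rightarrow> real" and a t w \<Phi> :: real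
  assumes p [measurable]: "p \<in> borel_measurable borel" and p0: "\<And>x. 0 \<le> p x"
    and \<Phi>: "\<Phi> > 0" and w: "w > 0" and n: "n \<ge> 3"
  defines "\<pi> \<equiv> \<lambda>x. exp (t * x) * p x / \<Phi>"
  assumes tame: "tame_density (\<lambda>z. w * \<pi> (a + w * z)) B c d \<alpha>"
  defines "e \<equiv> tame_density.llt_const B c d / real (n - 1)"
    and "L \<equiv> 1 / sqrt (2 * pi * tame_density.\<sigma>2 (\<lambda>z. w * \<pi> (a + w * z)) * real (n - 1))"
  assumes small: "e < L"
  shows "\<exists>u. cond_measure p n a = density lborel (\<lambda>x. ennreal (u x)) \<and> (\<forall>x. 0 \<le> u x) \<and> integrable lborel u
    \<and> (\<integral>x. \<bar>u x - \<pi> x\<bar> \<partial>lborel) \<le> 2 * e / (L - e)"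
proof -
  interpret tame_density "\<lambda>z. w * \<pi> (a + w * z)" B c d \<alpha> by (rule tame)
  let ?f = "\<lambda>z. w * \<pi> (a + w * z)"
  let ?fe = "\<lambda>z. ennreal (?f z)" and ?pe = "\<lambda>x. ennreal (p x)"
  obtain m where m: "n = Suc (Suc m)" using n by (intro that[of "n - 2"]) auto
  have k: "n - 1 = Suc m" "n - 1 \<ge> 2" using m n by auto
  define F where "F = (\<lambda>z. enn2real (conv_pow ?fe (n - 1) z))"
  define R where "R = (\<lambda>x. F ((a - x) / w))"
  have [measurable]: "\<pi> \<in> borel_measurable borel" unfolding \<pi>_def by measurable
  have [measurable]: "F \<in> borel_measurable borel" unfolding F_def by measurable
  have [measurable]: "R \<in> borel_measurable borel" unfolding R_def by measurable
  have \<pi>0: "0 \<le> \<pi> x" for x unfolding \<pi>_def using p0 \<Phi> by simp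
  have subst_int: "integrable lborel (\<lambda>x. \<pi> x * h ((a - x) / w)) \<longleftrightarrow> integrable lborel (\<lambda>z. ?f z * h (- z))"
    and subst: "(\<integral>x. \<pi> x * h ((a - x) / w) \<partial>lborel) = (\<integral>z. ?f z * h (- z) \<partial>lborel)" for h :: "real \<Rightarrow> real"
    using lborel_affine_substitution[OF w, of "\<lambda>x. \<pi> x * h ((a - x) / w)" a] w
    by (simp_all add: mult.assoc)
  have i\<pi>: "integrable lborel \<pi>" and I\<pi>: "(\<integral>x. \<pi> x \<partial>lborel) = 1"
    using subst_int[of "\<lambda>_. 1"] subst[of "\<lambda>_. 1"] integrable_f integral_eq_1 by simp_all
  have R0: "0 \<le> R x" for x unfolding R_def F_def by simp
  have iR: "integrable lborel (\<lambda>x. \<pi> x * \<bar>R x - L\<bar>)" and IR: "(\<integral>x. \<pi> x * \<bar>R x - L\<bar> \<partial>lborel) \<le> e"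
    using local_limit_weighted[OF k(2)] subst_int[of "\<lambda>y. \<bar>F y - L\<bar>"] subst[of "\<lambda>y. \<bar>F y - L\<bar>"]
    unfolding R_def e_def L_def F_def by simp_all
  define N where "N = (\<integral>x. \<pi> x * R x \<partial>lborel)"
  note rw = reweighted_density_L1[OF i\<pi> \<pi>0 I\<pi> _ R0 iR IR small, folded N_def]
  have N: "N > 0" using rw(2) small by simp
  \<comment> \<open>\<open>A1\<close> and \<open>A2\<close> are the factors by which tilting and rescaling change the densities of the sums of \<open>n - 1\<close> and of \<open>n\<close> summands.\<close>
  define A1 where "A1 = (\<lambda>x. (w * exp (t * a) / \<Phi>) ^ Suc m * exp (t * (a - x)) / w ^ m)"
  define A2 where "A2 = (w * exp (t * a) / \<Phi>) ^ Suc (Suc m) / w ^ Suc m"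
  have A: "A1 x > 0" "A2 > 0" for x unfolding A1_def A2_def using w \<Phi> by auto
  have scale: "conv_pow ?fe (Suc j) z = ennreal ((w * exp (t * a) / \<Phi>) ^ Suc j * exp (t * w * z) / w ^ j)
      * conv_pow ?pe (Suc j) (real (Suc j) * a + w * z)" for j z
  proof -
    have "?fe = (\<lambda>z. ennreal (w * exp (t * a) / \<Phi> * exp (t * w * z)) * ?pe (a + w * z))"
      using w \<Phi> p0 by (intro ext) (simp add: ennreal_mult'[symmetric] \<pi>_def exp_add[symmetric] algebra_simps)
    then show ?thesis
      using conv_pow_affine_tilt[of ?pe w "w * exp (t * a) / \<Phi>" "t * w" a j z] w \<Phi> by simp
  qed
  have fin: "conv_pow ?fe (Suc j) z = ennreal (enn2real (conv_pow ?fe (Suc j) z))" for j z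
    using conv_pow_finite[of j z] by (metis ennreal_enn2real_if ennreal_less_top order.strict_trans1 less_irrefl)
  have num: "conv_pow ?pe (n - 1) (real n * a - x) = ennreal (R x / A1 x)" for x
  proof -
    have "ennreal (R x) = ennreal (A1 x) * conv_pow ?pe (n - 1) (real n * a - x)"
    proof -
      have w_cancel: "w * ((a - x) / w) = a - x" using w by simp
      have "t * w * ((a - x) / w) = t * (a - x)"
        by (simp only: mult.assoc w_cancel)
      moreover have "real (Suc m) * a + w * ((a - x) / w) = real n * a - x"
        by (simp only: w_cancel) (simp add: m algebra_simps)
      ultimately show ?thesis
        using fin[of m "(a - x) / w"] scale[of m "(a - x) / w"] unfolding R_def F_def A1_def k(1) by simp
    qed
    then have "ennreal (1 / A1 x) * ennreal (R x) = (ennreal (1 / A1 x) * ennreal (A1 x)) * conv_pow ?pe (n - 1) (real n * a - x)"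
      by (simp add: mult.assoc)
    then show ?thesis using A(1)[of x] A(2) R0[of x] by (simp add: ennreal_mult'[symmetric])
  qed
  have "conv_pow ?fe n 0 = (\<integral>\<^sup>+y. ?fe (- y) * conv_pow ?fe (n - 1) y \<partial>lborel)"
    unfolding m k(1) by simp
  also have "\<dots> = (\<integral>\<^sup>+z. ?fe z * conv_pow ?fe (n - 1) (- z) \<partial>lborel)"
    using nn_integral_real_affine[of "\<lambda>y. ?fe (- y) * conv_pow ?fe (n - 1) y" "- 1" 0] by simp
  also have "\<dots> = (\<integral>\<^sup>+z. ennreal (?f z * F (- z)) \<partial>lborel)"
  proof (intro nn_integral_cong)
    fix z
    have "conv_pow ?fe (n - 1) (- z) = ennreal (F (- z))"
      using fin[of m] unfolding F_def k(1) .
    then show "?fe z * conv_pow ?fe (n - 1) (- z) = ennreal (?f z * F (- z))"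
      using nonneg by (simp only: ennreal_mult'[OF nonneg])
  qed
  also have "\<dots> = ennreal (\<integral>z. ?f z * F (- z) \<partial>lborel)"
  proof (rule nn_integral_eq_integral)
    show "integrable lborel (\<lambda>z. ?f z * F (- z))"
      using rw(1) subst_int[of F] unfolding R_def by simp
    show "AE z in lborel. 0 \<le> ?f z * F (- z)" using nonneg by (simp add: F_def)
  qed
  also have "(\<integral>z. ?f z * F (- z) \<partial>lborel) = N"
    unfolding N_def R_def subst ..
  finally have N_eq: "conv_pow ?fe n 0 = ennreal N" .
  have den: "conv_pow ?pe n (real n * a) = ennreal (N / A2)"
  proof -
    have "ennreal N = ennreal A2 * conv_pow ?pe n (real n * a)"
      using scale[of "Suc m" 0] N_eq unfolding A2_def m by simp
    then have "ennreal (1 / A2) * ennreal N = (ennreal (1 / A2) * ennreal A2) * conv_pow ?pe n (real n * a)"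
      by (simp add: mult.assoc)
    then show ?thesis using A N by (simp add: ennreal_mult'[symmetric])
  qed
  have "cond_density ?pe n (real n * a) = (\<lambda>x. ennreal (\<pi> x * R x / N))"
  proof
    fix x
    have "cond_density ?pe n (real n * a) x = ennreal (p x * (R x / A1 x) / (N / A2))"
    proof -
      have "0 \<le> p x * (R x / A1 x)" "0 < N / A2" "0 \<le> p x"
        using N A(1)[of x] A(2) p0[of x] R0[of x] by auto
      then show ?thesis
        unfolding cond_density_def num den by (simp only: ennreal_mult'[symmetric] divide_ennreal)
    qed
    also have "p x * (R x / A1 x) / (N / A2) = \<pi> x * R x / N"
    proof -
      have "A2 = A1 x * (exp (t * x) / \<Phi>)"
        unfolding A1_def A2_def using w by (simp add: right_diff_distrib exp_diff mult_ac)
      then show ?thesis using A(1)[of x] A(2) N \<Phi> by (simp add: \<pi>_def mult_ac)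
    qed
    finally show "cond_density ?pe n (real n * a) x = ennreal (\<pi> x * R x / N)" .
  qed
  then have "cond_measure p n a = density lborel (\<lambda>x. ennreal (\<pi> x * R x / N))"
    unfolding cond_measure_def by simp
  then show ?thesis
    using rw N \<pi>0 R0 by (intro exI[of _ "\<lambda>x. \<pi> x * R x / N"]) auto
qed

text \<open>After completing the square, the Gaussian factor is a constant times
\<open>exp (t x) exp (\<kappa> (x - a) - (x - a)\<^sup>2 / (2 \<beta>))\<close>. The condition on \<open>\<kappa>\<close> lets half of the exponential
tail of \<open>\<pi>\<close> dominate the last weight.\<close>

lemma gauss_tilt_L1:
  fixes p :: "real \<Rightarrow> real" and a t w \<kappa> \<beta> :: real
  assumes w: "w > 0" and \<beta>: "\<beta> > 0" and \<Phi>: "\<Phi> > 0"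
    and p [measurable]: "p \<in> borel_measurable borel"
  defines "\<pi> \<equiv> \<lambda>x. exp (t * x) * p x / \<Phi>"
  assumes tame: "tame_density (\<lambda>z. w * \<pi> (a + w * z)) B c d \<alpha>"
    and \<kappa>: "\<bar>\<kappa>\<bar> * w \<le> c / 2"
  defines "e \<equiv> B * ((\<bar>\<kappa>\<bar> * w) * exp_moment (c / 2) 1 + w\<^sup>2 / (2 * \<beta>) * exp_moment (c / 2) 2)"
  assumes small: "e < 1"
  defines "v \<equiv> gauss_tilt_density p a (t + \<kappa>) \<beta>"
  shows "(\<forall>x. 0 \<le> v x) \<and> integrable lborel v \<and> (\<integral>x. \<bar>v x - \<pi> x\<bar> \<partial>lborel) \<le> 2 * e / (1 - e)"
proof -
  interpret tame_density "\<lambda>z. w * \<pi> (a + w * z)" B c d \<alpha> by (rule tame)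
  let ?f = "\<lambda>z. w * \<pi> (a + w * z)"
  define W where "W = (\<lambda>z. exp (\<kappa> * w * z - w\<^sup>2 / (2 * \<beta>) * z\<^sup>2))"
  define R where "R = (\<lambda>x. W ((x - a) / w))"
  have [measurable]: "\<pi> \<in> borel_measurable borel" unfolding \<pi>_def by measurable
  have [measurable]: "W \<in> borel_measurable borel" unfolding W_def by measurable
  have [measurable]: "R \<in> borel_measurable borel" unfolding R_def by measurable
  have \<pi>0: "0 \<le> \<pi> x" for x
    using nonneg[of "(x - a) / w"] w by (simp add: zero_le_mult_iff)
  have subst_int: "integrable lborel (\<lambda>x. \<pi> x * h ((x - a) / w)) \<longleftrightarrow> integrable lborel (\<lambda>z. ?f z * h z)"
    and subst: "(\<integral>x. \<pi> x * h ((x - a) / w) \<partial>lborel) = (\<integral>z. ?f z * h z \<partial>lborel)" for h :: "real \<Rightarrow> real"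
    using lborel_affine_substitution[OF w, of "\<lambda>x. \<pi> x * h ((x - a) / w)" a] w
    by (simp_all add: mult.assoc)
  have i\<pi>: "integrable lborel \<pi>" and I\<pi>: "(\<integral>x. \<pi> x \<partial>lborel) = 1"
    using subst_int[of "\<lambda>_. 1"] subst[of "\<lambda>_. 1"] integrable_f integral_eq_1 by simp_all
  define G where "G = (\<lambda>z. B * ((\<bar>\<kappa>\<bar> * w) * (\<bar>z\<bar> ^ 1 * exp (- (c / 2 * \<bar>z\<bar>)))
      + w\<^sup>2 / (2 * \<beta>) * (\<bar>z\<bar>\<^sup>2 * exp (- (c / 2 * \<bar>z\<bar>)))))"
  have le: "?f z * \<bar>W z - 1\<bar> \<le> G z" for z
  proof -
    define y where "y = \<kappa> * w * z - w\<^sup>2 / (2 * \<beta>) * z\<^sup>2"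
    have kz: "\<bar>\<kappa> * w * z\<bar> \<le> c / 2 * \<bar>z\<bar>"
      using mult_right_mono[OF \<kappa>, of "\<bar>z\<bar>"] w by (simp add: abs_mult)
    have yle: "y \<le> c / 2 * \<bar>z\<bar>"
    proof -
      have "0 \<le> w\<^sup>2 / (2 * \<beta>) * z\<^sup>2" using \<beta> by simp
      then show ?thesis unfolding y_def using kz abs_ge_self[of "\<kappa> * w * z"] by linarith
    qed
    have "\<bar>exp y - 1\<bar> \<le> \<bar>y\<bar> * exp (c / 2 * \<bar>z\<bar>)"
    proof (cases "y \<ge> 0")
      case True
      have "exp y * (1 - y) \<le> exp y * exp (- y)"
        using exp_ge_add_one_self[of "- y"] by (intro mult_left_mono) auto
      then have "exp y - 1 \<le> y * exp y" by (simp add: exp_minus algebra_simps)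
      also have "\<dots> \<le> y * exp (c / 2 * \<bar>z\<bar>)" using yle True by (intro mult_left_mono) auto
      finally show ?thesis using True by simp
    next
      case False
      have "1 - exp y \<le> - y" using exp_ge_add_one_self[of y] by linarith
      also have "\<dots> * 1 \<le> - y * exp (c / 2 * \<bar>z\<bar>)"
        using False c_pos by (intro mult_left_mono) auto
      finally show ?thesis using False by simp
    qed
    then have "?f z * \<bar>W z - 1\<bar> \<le> (B * exp (- (c * \<bar>z\<bar>))) * (\<bar>y\<bar> * exp (c / 2 * \<bar>z\<bar>))"
      unfolding W_def y_def[symmetric] using B_pos by (intro mult_mono tail) auto
    also have "\<dots> = B * \<bar>y\<bar> * exp (- (c / 2 * \<bar>z\<bar>))"
      by (simp add: exp_add[symmetric] field_simps)
    also have "\<dots> \<le> B * ((\<bar>\<kappa>\<bar> * w) * \<bar>z\<bar> + w\<^sup>2 / (2 * \<beta>) * \<bar>z\<bar>\<^sup>2) * exp (- (c / 2 * \<bar>z\<bar>))"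
    proof (intro mult_right_mono mult_left_mono)
      have "\<bar>y\<bar> \<le> \<bar>\<kappa> * w * z\<bar> + \<bar>w\<^sup>2 / (2 * \<beta>) * z\<^sup>2\<bar>"
        unfolding y_def by (rule abs_triangle_ineq4)
      then show "\<bar>y\<bar> \<le> (\<bar>\<kappa>\<bar> * w) * \<bar>z\<bar> + w\<^sup>2 / (2 * \<beta>) * \<bar>z\<bar>\<^sup>2"
        using w \<beta> by (simp add: abs_mult)
    qed (use B_pos in auto)
    also have "\<dots> = G z" unfolding G_def by (simp add: algebra_simps)
    finally show ?thesis .
  qed
  have c2: "c / 2 > 0" using c_pos by simp
  have iG: "integrable lborel G"
    unfolding G_def by (intro integrable_mult_right Bochner_Integration.integrable_add integrable_abs_power_exp c2)
  have IG: "(\<integral>z. G z \<partial>lborel) = e"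
    unfolding G_def e_def exp_moment_def
    using integrable_abs_power_exp[OF c2, of 1] integrable_abs_power_exp[OF c2, of 2] by simp
  have iW: "integrable lborel (\<lambda>z. ?f z * \<bar>W z - 1\<bar>)"
    by (rule Bochner_Integration.integrable_bound[OF iG])
       (use le nonneg in \<open>auto intro!: AE_I2 order_trans[OF _ abs_ge_self]\<close>)
  have IW: "(\<integral>z. ?f z * \<bar>W z - 1\<bar> \<partial>lborel) \<le> e"
    unfolding IG[symmetric] by (rule integral_mono[OF iW iG]) (rule le)
  have R0: "0 \<le> R x" for x unfolding R_def W_def by simp
  have iR: "integrable lborel (\<lambda>x. \<pi> x * \<bar>R x - 1\<bar>)" and IR: "(\<integral>x. \<pi> x * \<bar>R x - 1\<bar> \<partial>lborel) \<le> e"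
    using iW IW subst_int[of "\<lambda>y. \<bar>W y - 1\<bar>"] subst[of "\<lambda>y. \<bar>W y - 1\<bar>"] unfolding R_def by simp_all
  define N where "N = (\<integral>x. \<pi> x * R x \<partial>lborel)"
  note rw = reweighted_density_L1[OF i\<pi> \<pi>0 I\<pi> _ R0 iR IR small, folded N_def]
  have N: "N > 0" using rw(2) small by simp
  define K where "K = \<Phi> * (1 / sqrt (2 * pi * \<beta>)) * exp (- (t * a) - (t + \<kappa>)\<^sup>2 * \<beta> / 2)"
  have K: "K > 0" unfolding K_def using \<Phi> \<beta> by simp
  have wt: "gauss_tilt_weight p a (t + \<kappa>) \<beta> x = K * (\<pi> x * R x)" for x
  proof -
    have "R x = exp (\<kappa> * (x - a) - (x - a)\<^sup>2 / (2 * \<beta>))"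
      unfolding R_def W_def using w by (simp add: power_divide)
    moreover have "- ((x - ((t + \<kappa>) * \<beta> + a))\<^sup>2 / (2 * \<beta>))
        = (- (t * a) - (t + \<kappa>)\<^sup>2 * \<beta> / 2) + t * x + (\<kappa> * (x - a) - (x - a)\<^sup>2 / (2 * \<beta>))"
      using \<beta> by (simp add: field_simps power2_eq_square)
    ultimately show ?thesis
      unfolding gauss_tilt_weight_def normal_density_def \<pi>_def K_def using \<beta> \<Phi> by (simp add: exp_add)
  qed
  have v_eq: "v = (\<lambda>x. \<pi> x * R x / N)"
    unfolding v_def gauss_tilt_density_def wt N_def using K by (intro ext) simp
  show ?thesis
    using rw N \<pi>0 R0 unfolding v_eq by auto
qed

section \<open>Tilted almost log-concave densities are tame at their own scale\<close>

text \<open>Here \<open>x1\<close> and \<open>x1 + w\<close> are the ends of the level set \<open>{G \<le> G x0 + 1}\<close>. A point at distance \<open>2 w\<close> from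
the minimiser lies outside the level set, so \<open>G\<close> has risen by more than \<open>1\<close> there, and by convexity it
keeps rising at least linearly at rate \<open>1 / (2 w)\<close>.\<close>

lemma convex_level_scale:
  fixes G :: "real \<Rightarrow> real"
  assumes conv: "convex_on {0..} G" and x0: "x0 > 0" and min: "\<And>x. x \<ge> 0 \<Longrightarrow> G x0 \<le> G x"
    and y: "y > x0" "G y > G x0 + 1"
  obtains x1 w where "w > 0" "0 \<le> x1" "x1 \<le> x0" "x0 \<le> x1 + w"
    "\<And>x. x1 < x \<Longrightarrow> x < x1 + w \<Longrightarrow> G x \<le> G x0 + 1"
    "\<And>x. x \<ge> 0 \<Longrightarrow> \<bar>x - x0\<bar> / (2 * w) - 1 \<le> G x - G x0"
proof -
  define A where "A = {x. x \<ge> 0 \<and> G x \<le> G x0 + 1}"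
  have cvx: "G ((1 - l) * a + l * b) \<le> (1 - l) * G a + l * G b" if "0 \<le> l" "l \<le> 1" "a \<ge> 0" "b \<ge> 0" for l a b
    using convex_onD[OF conv that(1,2), of a b] that by simp
  have conv_A: "convex A"
    unfolding convex_alt
  proof (intro ballI allI impI)
    fix a b u :: real assume ab: "a \<in> A" "b \<in> A" and u: "0 \<le> u \<and> u \<le> 1"
    have "G ((1 - u) * a + u * b) \<le> (1 - u) * G a + u * G b" using ab u by (intro cvx) (auto simp: A_def)
    also have "\<dots> \<le> (1 - u) * (G x0 + 1) + u * (G x0 + 1)"
      using ab u by (intro add_mono mult_left_mono) (auto simp: A_def)
    finally have "G ((1 - u) * a + u * b) \<le> G x0 + 1" by (simp add: algebra_simps)
    moreover have "0 \<le> (1 - u) * a + u * b" using ab u by (simp add: A_def)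
    ultimately show "(1 - u) *\<^sub>R a + u *\<^sub>R b \<in> A" by (simp add: A_def)
  qed
  have intervl: "x \<in> A" if "a \<in> A" "b \<in> A" "a \<le> x" "x \<le> b" for a b x
    using conv_A that unfolding is_interval_convex_1[symmetric] is_interval_1 by blast
  have x0A: "x0 \<in> A" using x0 by (simp add: A_def)
  have yA: "y \<notin> A" using y by (simp add: A_def)
  have A_le: "x \<le> y" if "x \<in> A" for x using intervl[OF x0A that, of y] y yA by linarith
  have bdd: "bdd_above A" "bdd_below A"
    using A_le by (auto intro!: bdd_aboveI bdd_belowI[of _ 0] simp: A_def)
  define x1 where "x1 = Inf A"
  define x2 where "x2 = Sup A"
  have A_bounds: "x1 \<le> x" "x \<le> x2" if "x \<in> A" for x
    unfolding x1_def x2_def using that bdd by (auto intro: cInf_lower cSup_upper)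
  have x1_0: "0 \<le> x1" unfolding x1_def using x0A by (intro cInf_greatest) (auto simp: A_def)
  have "x0 < x2"
  proof -
    have "convex_on {0<..} G" by (rule convex_on_subset[OF conv]) auto
    then have "continuous_on {0<..} G" by (intro convex_on_continuous) auto
    then have "isCont G x0" using x0 by (simp add: continuous_on_eq_continuous_at)
    then have "\<forall>\<^sub>F x in at x0. G x < G x0 + 1"
      by (intro order_tendstoD) (auto simp: isCont_def)
    then have "\<forall>\<^sub>F x in at_right x0. G x < G x0 + 1" by (simp add: eventually_at_split)
    moreover have "\<forall>\<^sub>F x in at_right x0. x > x0" by (simp add: eventually_at_filter)
    ultimately have "\<forall>\<^sub>F x in at_right x0. x > x0 \<and> x \<in> A"
      by eventually_elim (use x0 in \<open>simp add: A_def\<close>)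
    then obtain x where "x > x0" "x \<in> A"
      using eventually_happens'[OF trivial_limit_at_right_real] by blast
    then show ?thesis using A_bounds by force
  qed
  define w where "w = x2 - x1"
  have w: "w > 0" unfolding w_def using \<open>x0 < x2\<close> A_bounds[OF x0A] by simp
  show ?thesis
  proof
    show "w > 0" "0 \<le> x1" "x1 \<le> x0" "x0 \<le> x1 + w"
      using w x1_0 A_bounds[OF x0A] by (auto simp: w_def)
    show "G x \<le> G x0 + 1" if "x1 < x" "x < x1 + w" for x
    proof -
      have "Inf A < x" "x < Sup A" using that unfolding w_def x1_def x2_def by auto
      then obtain a b where a: "a \<in> A" "a < x" and b: "b \<in> A" "x < b"
        using cInf_lessD[of A x] less_cSupD[of A x] x0A by blast
      show ?thesis using intervl[OF a(1) b(1)] a b by (simp add: A_def)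
    qed
    show "\<bar>x - x0\<bar> / (2 * w) - 1 \<le> G x - G x0" if x: "x \<ge> 0" for x
    proof (cases "\<bar>x - x0\<bar> \<le> 2 * w")
      case True
      then have "\<bar>x - x0\<bar> / (2 * w) \<le> 1" using w by simp
      then show ?thesis using min[OF x] by linarith
    next
      case False
      define l where "l = 2 * w / \<bar>x - x0\<bar>"
      define v where "v = (1 - l) * x0 + l * x"
      have l: "0 < l" "l < 1" using False w by (auto simp: l_def)
      have "v - x0 = l * (x - x0)" by (simp add: v_def algebra_simps)
      then have v: "\<bar>v - x0\<bar> = 2 * w"
        using False w by (simp add: abs_mult l_def)
      have v0: "v \<ge> 0" unfolding v_def using l x x0 by simp
      have "v \<notin> A"
        using A_bounds[of v] A_bounds[OF x0A] v w unfolding w_def by (auto simp: abs_real_def split: if_splits)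
      then have "G x0 + 1 < G v" using v0 by (simp add: A_def)
      also have "G v \<le> (1 - l) * G x0 + l * G x" unfolding v_def using l x x0 by (intro cvx) auto
      finally have "1 < l * (G x - G x0)" by (simp add: algebra_simps)
      then have "1 / l < G x - G x0" using l by (simp add: field_simps)
      moreover have "1 / l = \<bar>x - x0\<bar> / (2 * w)" unfolding l_def by simp
      ultimately show ?thesis by linarith
    qed
  qed
qed

text \<open>The constants of the tame class for an almost log-concave density whose logarithm is known up to \<open>Q\<close>.
The inner exponential in the first one pays for moving the centre from the mode to the mean.\<close>

definition tail_const where "tail_const Q = exp (2 * Q + 2 + exp (2 * Q + 2) * exp_moment (1 / 2) 1 / 2)"
definition core_const where "core_const Q = exp (- (2 * Q + 2)) / exp_moment (1 / 2) 0"

lemma exp_moment_scale: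
  assumes w: "w > 0"
  shows "integrable lborel (\<lambda>x. \<bar>x - x0\<bar> ^ k * exp (- (\<bar>x - x0\<bar> / (2 * w))))"
    and "(\<integral>x. \<bar>x - x0\<bar> ^ k * exp (- (\<bar>x - x0\<bar> / (2 * w))) \<partial>lborel) = w ^ Suc k * exp_moment (1 / 2) k"
proof -
  have eq: "w * (\<bar>x0 + w * z - x0\<bar> ^ k * exp (- (\<bar>x0 + w * z - x0\<bar> / (2 * w))))
      = w ^ Suc k * (\<bar>z\<bar> ^ k * exp (- (1 / 2 * \<bar>z\<bar>)))" for z
    using w by (simp add: abs_mult power_mult_distrib)
  have i: "integrable lborel (\<lambda>z. w ^ Suc k * (\<bar>z\<bar> ^ k * exp (- (1 / 2 * \<bar>z\<bar>))))"
    by (intro integrable_mult_right integrable_abs_power_exp) simp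
  show "integrable lborel (\<lambda>x. \<bar>x - x0\<bar> ^ k * exp (- (\<bar>x - x0\<bar> / (2 * w))))"
    using i lborel_affine_substitution(1)[OF w, of "\<lambda>x. \<bar>x - x0\<bar> ^ k * exp (- (\<bar>x - x0\<bar> / (2 * w)))" x0]
    unfolding eq by blast
  show "(\<integral>x. \<bar>x - x0\<bar> ^ k * exp (- (\<bar>x - x0\<bar> / (2 * w))) \<partial>lborel) = w ^ Suc k * exp_moment (1 / 2) k"
    unfolding lborel_affine_substitution(2)[OF w, of "\<lambda>x. \<bar>x - x0\<bar> ^ k * exp (- (\<bar>x - x0\<bar> / (2 * w)))" x0] eq exp_moment_def
    by (rule integral_mult_right_zero)
qed

text \<open>The normalisation \<open>Z\<close> is squeezed between multiples of \<open>w\<close>: from below by the mass of the level set,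
from above by the exponential tail. This gives the height \<open>1 / w\<close> of the density, and the tail then
places the mean within a multiple of \<open>w\<close> of the mode.\<close>

lemma tame_of_log_concave:
  fixes \<pi> G :: "real \<Rightarrow> real"
  assumes [measurable]: "\<pi> \<in> borel_measurable borel" and I\<pi>: "(\<integral>x. \<pi> x \<partial>lborel) = 1"
    and neg: "\<And>x. x < 0 \<Longrightarrow> \<pi> x = 0" and Z: "Z > 0"
    and comp: "\<And>x. x \<ge> 0 \<Longrightarrow> exp (- Q - (G x - G x0)) \<le> Z * \<pi> x"
      "\<And>x. x \<ge> 0 \<Longrightarrow> Z * \<pi> x \<le> exp (Q - (G x - G x0))"
    and w: "w > 0" and x1: "0 \<le> x1"
    and near: "\<And>x. x1 < x \<Longrightarrow> x < x1 + w \<Longrightarrow> G x \<le> G x0 + 1"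
    and far: "\<And>x. x \<ge> 0 \<Longrightarrow> \<bar>x - x0\<bar> / (2 * w) - 1 \<le> G x - G x0"
  defines "a \<equiv> (\<integral>x. \<pi> x * x \<partial>lborel)"
  shows "tame_density (\<lambda>z. w * \<pi> (a + w * z)) (tail_const Q) (1 / 2) (core_const Q) ((x1 - a) / w)"
    and "\<bar>a - x0\<bar> \<le> exp (2 * Q + 2) * exp_moment (1 / 2) 1 * w"
proof -
  let ?T = "\<lambda>x. exp (- (\<bar>x - x0\<bar> / (2 * w)))"
  have \<pi>0: "0 \<le> \<pi> x" for x
  proof (cases "x \<ge> 0")
    case True
    have "0 \<le> Z * \<pi> x" using comp(1)[OF True] exp_gt_zero order_trans less_imp_le by blast
    then show ?thesis using Z by (simp add: zero_le_mult_iff)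
  qed (simp add: neg)
  have up: "Z * \<pi> x \<le> exp (Q + 1) * ?T x" for x
  proof (cases "x \<ge> 0")
    case True
    have "Z * \<pi> x \<le> exp (Q - (G x - G x0))" by (rule comp(2)[OF True])
    also have "\<dots> \<le> exp ((Q + 1) + - (\<bar>x - x0\<bar> / (2 * w)))"
      using far[OF True] by simp
    finally show ?thesis by (simp only: exp_add)
  qed (simp add: neg)
  have low: "exp (- Q - 1) \<le> Z * \<pi> x" if "x1 < x" "x < x1 + w" for x
  proof -
    have "exp (- Q - 1) \<le> exp (- Q - (G x - G x0))" using near[OF that] by simp
    also have "\<dots> \<le> Z * \<pi> x" using x1 that by (intro comp(1)) simp
    finally show ?thesis .
  qed
  have iT: "integrable lborel (\<lambda>x. \<bar>x - x0\<bar> ^ k * ?T x)"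
    and IT: "(\<integral>x. \<bar>x - x0\<bar> ^ k * ?T x \<partial>lborel) = w ^ Suc k * exp_moment (1 / 2) k" for k
    using exp_moment_scale[OF w] by auto
  have i\<pi>: "integrable lborel \<pi>"
    using I\<pi> not_integrable_integral_eq by force
  have Z_le: "Z \<le> exp (Q + 1) * (w * exp_moment (1 / 2) 0)"
  proof -
    have "Z = (\<integral>x. Z * \<pi> x \<partial>lborel)" using I\<pi> by simp
    also have "\<dots> \<le> (\<integral>x. exp (Q + 1) * (\<bar>x - x0\<bar> ^ 0 * ?T x) \<partial>lborel)"
      using up by (intro integral_mono integrable_mult_right i\<pi> iT) simp
    also have "\<dots> = exp (Q + 1) * (w * exp_moment (1 / 2) 0)"
      unfolding integral_mult_right_zero IT by simp
    finally show ?thesis .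
  qed
  have Z_ge: "w * exp (- Q - 1) \<le> Z"
  proof -
    have "w * exp (- Q - 1) = (\<integral>x. exp (- Q - 1) * indicator {x1<..<x1 + w} x \<partial>lborel)" using w by simp
    also have "\<dots> \<le> (\<integral>x. Z * \<pi> x \<partial>lborel)"
      using low Z \<pi>0 w by (intro integral_mono integrable_mult_right i\<pi>) (auto split: split_indicator)
    also have "\<dots> = Z" using I\<pi> by simp
    finally show ?thesis .
  qed
  have E0: "exp_moment (1 / 2) 0 > 0"
  proof -
    have "0 < exp (Q + 1) * (w * exp_moment (1 / 2) 0)" using Z Z_le by linarith
    then show ?thesis using w by (simp add: zero_less_mult_iff)
  qed
  have upper: "w * \<pi> x \<le> exp (2 * Q + 2) * ?T x" for x
  proof -
    have "w * exp (- Q - 1) * \<pi> x \<le> Z * \<pi> x" using Z_ge \<pi>0 by (intro mult_right_mono)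
    also have "\<dots> \<le> exp (Q + 1) * ?T x" by (rule up)
    finally have "exp (Q + 1) * (w * exp (- Q - 1) * \<pi> x) \<le> exp (Q + 1) * (exp (Q + 1) * ?T x)"
      by (intro mult_left_mono) auto
    moreover have "exp (Q + 1) * (w * exp (- Q - 1) * \<pi> x) = (exp (Q + 1) * exp (- Q - 1)) * (w * \<pi> x)"
      by (simp only: mult_ac)
    moreover have "exp (Q + 1) * (exp (Q + 1) * ?T x) = (exp (Q + 1) * exp (Q + 1)) * ?T x"
      by (simp only: mult_ac)
    moreover have "exp (Q + 1) * exp (- Q - 1) = 1" "exp (Q + 1) * exp (Q + 1) = exp (2 * Q + 2)"
      by (simp_all add: exp_add[symmetric])
    ultimately show ?thesis by (simp only: mult_1)
  qed
  have lower: "core_const Q \<le> w * \<pi> x" if "x1 < x" "x < x1 + w" for x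
  proof -
    have "exp (- Q - 1) \<le> Z * \<pi> x" by (rule low[OF that])
    also have "\<dots> \<le> exp (Q + 1) * (w * exp_moment (1 / 2) 0) * \<pi> x" using Z_le \<pi>0 by (intro mult_right_mono)
    finally have "exp (- Q - 1) * exp (- (Q + 1)) / exp_moment (1 / 2) 0
        \<le> exp (Q + 1) * (w * exp_moment (1 / 2) 0) * \<pi> x * exp (- (Q + 1)) / exp_moment (1 / 2) 0"
      using E0 by (intro divide_right_mono mult_right_mono) auto
    moreover have "exp (- Q - 1) * exp (- (Q + 1)) = exp (- (2 * Q + 2))"
      by (simp add: exp_add[symmetric])
    moreover have "exp (Q + 1) * (w * exp_moment (1 / 2) 0) * \<pi> x * exp (- (Q + 1)) / exp_moment (1 / 2) 0 = w * \<pi> x"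
      using E0 by simp (simp add: exp_add[symmetric])
    ultimately show ?thesis unfolding core_const_def by simp
  qed
  have iT1: "integrable lborel (\<lambda>x. exp (2 * Q + 2) / w * (\<bar>x - x0\<bar> ^ 1 * ?T x))"
    using iT by (rule integrable_mult_right)
  have le1: "\<pi> x * \<bar>x - x0\<bar> \<le> exp (2 * Q + 2) / w * (\<bar>x - x0\<bar> ^ 1 * ?T x)" for x
    using mult_right_mono[OF upper[of x], of "\<bar>x - x0\<bar>"] w by (simp add: field_simps)
  have i1: "integrable lborel (\<lambda>x. \<pi> x * (x - x0))"
    by (rule Bochner_Integration.integrable_bound[OF iT1])
       (use le1 \<pi>0 w in \<open>auto intro!: AE_I2 order_trans[OF _ abs_ge_self] simp: abs_mult\<close>)
  have "integrable lborel (\<lambda>x. \<pi> x * (x - x0) + x0 * \<pi> x)" using i1 i\<pi> by simp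
  then have i1': "integrable lborel (\<lambda>x. \<pi> x * x)" by (simp add: algebra_simps)
  have a_x0: "a - x0 = (\<integral>x. \<pi> x * (x - x0) \<partial>lborel)"
    unfolding a_def using i1' i\<pi> I\<pi> by (simp add: right_diff_distrib)
  show ax: "\<bar>a - x0\<bar> \<le> exp (2 * Q + 2) * exp_moment (1 / 2) 1 * w"
  proof -
    have "\<bar>a - x0\<bar> \<le> (\<integral>x. \<bar>\<pi> x * (x - x0)\<bar> \<partial>lborel)"
      unfolding a_x0 by (rule integral_abs_bound)
    also have "\<dots> \<le> (\<integral>x. exp (2 * Q + 2) / w * (\<bar>x - x0\<bar> ^ 1 * ?T x) \<partial>lborel)"
      using le1 \<pi>0 by (intro integral_mono integrable_abs i1 iT1) (simp add: abs_mult)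
    also have "\<dots> = exp (2 * Q + 2) * exp_moment (1 / 2) 1 * w"
      unfolding integral_mult_right_zero IT using w by (simp add: power2_eq_square)
    finally show ?thesis .
  qed
  show "tame_density (\<lambda>z. w * \<pi> (a + w * z)) (tail_const Q) (1 / 2) (core_const Q) ((x1 - a) / w)"
  proof
    show "(\<integral>z. w * \<pi> (a + w * z) \<partial>lborel) = 1"
      using lborel_affine_substitution(2)[OF w, of \<pi> a] I\<pi> by simp
    have "(\<integral>z. w * \<pi> (a + w * z) * z \<partial>lborel) = (\<integral>x. \<pi> x * ((x - a) / w) \<partial>lborel)"
      using w by (subst lborel_affine_substitution(2)[OF w, of _ a]) (simp add: mult.assoc)
    also have "\<dots> = (\<integral>x. (1 / w) * (\<pi> x * x - a * \<pi> x) \<partial>lborel)"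
      by (intro Bochner_Integration.integral_cong) (auto simp: field_simps)
    also have "\<dots> = (1 / w) * ((\<integral>x. \<pi> x * x \<partial>lborel) - a * (\<integral>x. \<pi> x \<partial>lborel))"
      using i1' i\<pi> by simp
    also have "\<dots> = 0" unfolding I\<pi> a_def by simp
    finally show "(\<integral>z. w * \<pi> (a + w * z) * z \<partial>lborel) = 0" .
    show "w * \<pi> (a + w * z) \<le> tail_const Q * exp (- (1 / 2 * \<bar>z\<bar>))" for z
    proof -
      have "w * \<bar>z\<bar> \<le> \<bar>a + w * z - x0\<bar> + \<bar>a - x0\<bar>"
        using abs_triangle_ineq4[of "a + w * z - x0" "a - x0"] w by (simp add: abs_mult)
      also have "\<dots> \<le> \<bar>a + w * z - x0\<bar> + exp (2 * Q + 2) * exp_moment (1 / 2) 1 * w" using ax by simp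
      finally have "\<bar>z\<bar> / 2 \<le> \<bar>a + w * z - x0\<bar> / (2 * w) + exp (2 * Q + 2) * exp_moment (1 / 2) 1 / 2"
        using w by (simp add: field_simps)
      then have "exp (- (\<bar>a + w * z - x0\<bar> / (2 * w))) \<le> exp (exp (2 * Q + 2) * exp_moment (1 / 2) 1 / 2 + - (1 / 2 * \<bar>z\<bar>))" by simp
      then have "exp (2 * Q + 2) * ?T (a + w * z) \<le> exp (2 * Q + 2) * exp (exp (2 * Q + 2) * exp_moment (1 / 2) 1 / 2 + - (1 / 2 * \<bar>z\<bar>))"
        by (intro mult_left_mono) auto
      also have "\<dots> = tail_const Q * exp (- (1 / 2 * \<bar>z\<bar>))"
        unfolding tail_const_def by (simp only: exp_add[symmetric] add.assoc)
      finally show ?thesis using upper[of "a + w * z"] by linarith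
    qed
    show "0 < core_const Q" unfolding core_const_def using E0 by simp
    show "core_const Q \<le> w * \<pi> (a + w * z)" if "(x1 - a) / w < z" "z < (x1 - a) / w + 1" for z
    proof (rule lower)
      show "x1 < a + w * z" "a + w * z < x1 + w"
        using that w by (simp_all add: field_simps)
    qed
  qed (use \<pi>0 w in auto)
qed

section \<open>Cumulants as central moments of the tilted density\<close>

locale light_tailed =
  fixes p :: "real \<Rightarrow> real"
  assumes meas [measurable]: "p \<in> borel_measurable borel"
    and nonneg: "\<And>x. 0 \<le> p x"
    and light: "\<And>t k. integrable lborel (\<lambda>x. \<bar>x\<bar> ^ k * exp (t * \<bar>x\<bar>) * p x)"
    and total: "(\<integral>x. p x \<partial>lborel) = 1"
begin

definition \<psi> where "\<psi> k t = (\<integral>x. x ^ k * exp (t * x) * p x \<partial>lborel)"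

lemma integrable_\<psi>: "integrable lborel (\<lambda>x. x ^ k * exp (t * x) * p x)"
proof (rule Bochner_Integration.integrable_bound[OF light[of k "\<bar>t\<bar>"]])
  show "AE x in lborel. norm (x ^ k * exp (t * x) * p x) \<le> norm (\<bar>x\<bar> ^ k * exp (\<bar>t\<bar> * \<bar>x\<bar>) * p x)"
  proof (rule AE_I2)
    fix x
    have "exp (t * x) \<le> exp (\<bar>t\<bar> * \<bar>x\<bar>)"
      using abs_ge_self[of "t * x"] by (simp add: abs_mult)
    then show "norm (x ^ k * exp (t * x) * p x) \<le> norm (\<bar>x\<bar> ^ k * exp (\<bar>t\<bar> * \<bar>x\<bar>) * p x)"
      using nonneg[of x] by (auto simp: abs_mult power_abs intro!: mult_right_mono mult_left_mono)
  qed
qed measurable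

lemma exp_second_order_bound: "\<bar>exp y - 1 - y\<bar> \<le> y\<^sup>2 * exp \<bar>y\<bar>" for y :: real
proof -
  obtain \<theta> where \<theta>: "\<bar>\<theta>\<bar> \<le> \<bar>y\<bar>" "exp y = (\<Sum>m<2. y ^ m / fact m) + exp \<theta> / fact 2 * y ^ 2"
    using Maclaurin_exp_le[of y 2] by blast
  then have "exp y - 1 - y = exp \<theta> / 2 * y\<^sup>2" by (simp add: numeral_2_eq_2)
  then have "\<bar>exp y - 1 - y\<bar> = exp \<theta> / 2 * y\<^sup>2" by (simp only: abs_of_nonneg) simp
  also have "\<dots> \<le> exp \<bar>y\<bar> * y\<^sup>2"
  proof (rule mult_right_mono)
    have "exp \<theta> \<le> exp \<bar>y\<bar>" using \<theta>(1) by simp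
    then show "exp \<theta> / 2 \<le> exp \<bar>y\<bar>" by (smt (verit) exp_gt_zero field_sum_of_halves)
  qed simp
  finally show ?thesis by (simp add: mult.commute)
qed

text \<open>Differentiation under the integral: by the second-order bound for the exponential, the error of the
difference quotient is at most \<open>|h|\<close> times an exponential moment that does not depend on \<open>h\<close>.\<close>

lemma DERIV_\<psi>: "(\<psi> k has_real_derivative \<psi> (Suc k) t) (at t)"
proof -
  define C where "C = (\<integral>x. \<bar>x\<bar> ^ (k + 2) * exp ((\<bar>t\<bar> + 1) * \<bar>x\<bar>) * p x \<partial>lborel)"
  have bound: "\<bar>(\<psi> k (t + h) - \<psi> k t) / h - \<psi> (Suc k) t\<bar> \<le> \<bar>h\<bar> * C" if h: "h \<noteq> 0" "\<bar>h\<bar> \<le> 1" for h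
  proof -
    let ?D = "\<lambda>x. x ^ k * exp ((t + h) * x) * p x - x ^ k * exp (t * x) * p x - h * (x ^ Suc k * exp (t * x) * p x)"
    have iD: "integrable lborel ?D"
      by (intro Bochner_Integration.integrable_diff integrable_mult_right integrable_\<psi>)
    have "\<psi> k (t + h) - \<psi> k t - h * \<psi> (Suc k) t = (\<integral>x. ?D x \<partial>lborel)"
      unfolding \<psi>_def integral_mult_right_zero[symmetric]
      by (simp only: Bochner_Integration.integral_diff integrable_\<psi> integrable_mult_right Bochner_Integration.integrable_diff)
    then have "\<bar>\<psi> k (t + h) - \<psi> k t - h * \<psi> (Suc k) t\<bar> = \<bar>\<integral>x. ?D x \<partial>lborel\<bar>" by simp
    also have "\<dots> \<le> (\<integral>x. \<bar>?D x\<bar> \<partial>lborel)" by (rule integral_abs_bound)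
    also have "\<dots> \<le> (\<integral>x. h\<^sup>2 * (\<bar>x\<bar> ^ (k + 2) * exp ((\<bar>t\<bar> + 1) * \<bar>x\<bar>) * p x) \<partial>lborel)"
    proof (rule integral_mono)
      show "integrable lborel (\<lambda>x. \<bar>?D x\<bar>)" using iD by (rule integrable_abs)
      show "integrable lborel (\<lambda>x. h\<^sup>2 * (\<bar>x\<bar> ^ (k + 2) * exp ((\<bar>t\<bar> + 1) * \<bar>x\<bar>) * p x))"
        by (rule integrable_mult_right) (rule light)
      fix x
      have "?D x = x ^ k * exp (t * x) * p x * (exp (h * x) - 1 - h * x)"
        by (simp add: algebra_simps exp_add)
      then have "\<bar>?D x\<bar> = \<bar>x\<bar> ^ k * exp (t * x) * p x * \<bar>exp (h * x) - 1 - h * x\<bar>"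
        using nonneg[of x] by (simp add: abs_mult power_abs)
      also have "\<dots> \<le> \<bar>x\<bar> ^ k * exp (\<bar>t\<bar> * \<bar>x\<bar>) * p x * ((h * x)\<^sup>2 * exp \<bar>x\<bar>)"
      proof (intro mult_mono)
        show "exp (t * x) \<le> exp (\<bar>t\<bar> * \<bar>x\<bar>)"
          using abs_ge_self[of "t * x"] by (simp add: abs_mult)
        have "\<bar>h * x\<bar> \<le> \<bar>x\<bar>" using h mult_right_mono[of "\<bar>h\<bar>" 1 "\<bar>x\<bar>"] by (simp add: abs_mult)
        then have "(h * x)\<^sup>2 * exp \<bar>h * x\<bar> \<le> (h * x)\<^sup>2 * exp \<bar>x\<bar>" by (intro mult_left_mono) auto
        then show "\<bar>exp (h * x) - 1 - h * x\<bar> \<le> (h * x)\<^sup>2 * exp \<bar>x\<bar>"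
          using exp_second_order_bound[of "h * x"] by linarith
      qed (use nonneg[of x] in auto)
      also have "\<dots> = h\<^sup>2 * (\<bar>x\<bar> ^ (k + 2) * exp ((\<bar>t\<bar> + 1) * \<bar>x\<bar>) * p x)"
      proof -
        have "exp ((\<bar>t\<bar> + 1) * \<bar>x\<bar>) = exp (\<bar>t\<bar> * \<bar>x\<bar>) * exp \<bar>x\<bar>"
          by (simp only: distrib_right mult_1 exp_add)
        moreover have "\<bar>x\<bar> ^ (k + 2) = \<bar>x\<bar> ^ k * x\<^sup>2" by (simp only: power_add power2_abs)
        ultimately show ?thesis by (simp only: power_mult_distrib mult_ac)
      qed
      finally show "\<bar>?D x\<bar> \<le> h\<^sup>2 * (\<bar>x\<bar> ^ (k + 2) * exp ((\<bar>t\<bar> + 1) * \<bar>x\<bar>) * p x)" .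
    qed
    also have "\<dots> = h\<^sup>2 * C" unfolding C_def by (rule integral_mult_right_zero)
    finally have "\<bar>\<psi> k (t + h) - \<psi> k t - h * \<psi> (Suc k) t\<bar> / \<bar>h\<bar> \<le> h\<^sup>2 * C / \<bar>h\<bar>"
      by (intro divide_right_mono) auto
    moreover have "\<bar>\<psi> k (t + h) - \<psi> k t - h * \<psi> (Suc k) t\<bar> / \<bar>h\<bar> = \<bar>(\<psi> k (t + h) - \<psi> k t) / h - \<psi> (Suc k) t\<bar>"
      using h by (simp add: abs_divide[symmetric] diff_divide_distrib)
    moreover have "h\<^sup>2 * C / \<bar>h\<bar> = \<bar>h\<bar> * C"
      using h by (simp add: power2_eq_square field_simps abs_if)
    ultimately show ?thesis by simp
  qed
  have "((\<lambda>h. (\<psi> k (t + h) - \<psi> k t) / h - \<psi> (Suc k) t) \<longlongrightarrow> 0) (at 0)"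
  proof (rule Lim_null_comparison)
    have "\<forall>\<^sub>F h in at 0. \<bar>h\<bar> \<le> (1::real)"
      unfolding eventually_at by (intro exI[of _ 1]) auto
    moreover have "\<forall>\<^sub>F h in at 0. h \<noteq> (0::real)" by (simp add: eventually_at_filter)
    ultimately show "\<forall>\<^sub>F h in at 0. norm ((\<psi> k (t + h) - \<psi> k t) / h - \<psi> (Suc k) t) \<le> \<bar>h\<bar> * C"
      by eventually_elim (use bound in simp)
    show "((\<lambda>h. \<bar>h\<bar> * C) \<longlongrightarrow> 0) (at 0)" by (auto intro!: tendsto_eq_intros)
  qed
  then show ?thesis
    by (simp add: DERIV_def LIM_zero_iff)
qed

lemma \<psi>_pos: "\<psi> 0 t > 0"
proof -
  have "\<psi> 0 t \<ge> 0" unfolding \<psi>_def by (intro Bochner_Integration.integral_nonneg) (simp add: nonneg)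
  moreover have "\<psi> 0 t \<noteq> 0"
  proof
    assume "\<psi> 0 t = 0"
    then have "AE x in lborel. exp (t * x) * p x = 0"
      unfolding \<psi>_def using integrable_\<psi>[of 0 t] nonneg
      by (subst (asm) integral_nonneg_eq_0_iff_AE) auto
    then have "AE x in lborel. p x = 0" by eventually_elim simp
    then have "(\<integral>x. p x \<partial>lborel) = 0" by (rule integral_eq_zero_AE)
    then show False using total by simp
  qed
  ultimately show ?thesis by simp
qed

definition tilt where "tilt t x = exp (t * x) * p x / \<psi> 0 t"
definition mean where "mean t = (\<integral>x. tilt t x * x \<partial>lborel)"
abbreviation tilted_variance where "tilted_variance t \<equiv> \<integral>x. tilt t x * (x - mean t)\<^sup>2 \<partial>lborel"
abbreviation third_central_moment where "third_central_moment t \<equiv> \<integral>x. tilt t x * (x - mean t) ^ 3 \<partial>lborel"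

lemma borel_measurable_tilt [measurable]: "tilt t \<in> borel_measurable borel"
  unfolding tilt_def by measurable

lemma tilt_nonneg: "0 \<le> tilt t x"
  unfolding tilt_def using nonneg \<psi>_pos[of t] by simp

lemma integrable_tilt_power: "integrable lborel (\<lambda>x. tilt t x * x ^ k)"
  and integral_tilt_power: "(\<integral>x. tilt t x * x ^ k \<partial>lborel) = \<psi> k t / \<psi> 0 t"
proof -
  have eq: "tilt t x * x ^ k = (x ^ k * exp (t * x) * p x) / \<psi> 0 t" for x
    unfolding tilt_def by simp
  show "integrable lborel (\<lambda>x. tilt t x * x ^ k)" unfolding eq using integrable_\<psi> by simp
  show "(\<integral>x. tilt t x * x ^ k \<partial>lborel) = \<psi> k t / \<psi> 0 t" unfolding eq \<psi>_def by simp
qed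

lemma integral_tilt: "(\<integral>x. tilt t x \<partial>lborel) = 1"
  using integral_tilt_power[of t 0] \<psi>_pos[of t] by simp

lemma mean_eq: "mean t = \<psi> 1 t / \<psi> 0 t"
  using integral_tilt_power[of t 1] unfolding mean_def by simp

lemma DERIV_ln_\<psi>: "((\<lambda>t. ln (\<psi> 0 t)) has_real_derivative mean t) (at t)"
  unfolding mean_eq using \<psi>_pos[of t] DERIV_\<psi>[of 0 t]
  by (auto intro!: derivative_eq_intros)

lemma variance_eq: "tilted_variance t = \<psi> 2 t / \<psi> 0 t - (\<psi> 1 t / \<psi> 0 t)\<^sup>2"
proof -
  note int = integrable_tilt_power[of t] and I = integral_tilt_power[of t]
  have "tilted_variance t
      = (\<integral>x. tilt t x * x ^ 2 - 2 * mean t * (tilt t x * x ^ 1) + (mean t)\<^sup>2 * (tilt t x * x ^ 0) \<partial>lborel)"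
    by (intro Bochner_Integration.integral_cong) (auto simp: power2_eq_square algebra_simps)
  also have "\<dots> = \<psi> 2 t / \<psi> 0 t - 2 * mean t * (\<psi> 1 t / \<psi> 0 t) + (mean t)\<^sup>2 * (\<psi> 0 t / \<psi> 0 t)"
    by (simp only: Bochner_Integration.integral_add Bochner_Integration.integral_diff int integrable_mult_right
        Bochner_Integration.integrable_diff integral_mult_right_zero I)
  finally show ?thesis
    using \<psi>_pos[of t] unfolding mean_eq by (simp add: power2_eq_square)
qed

lemma third_central_moment_eq: "third_central_moment t
    = \<psi> 3 t / \<psi> 0 t - 3 * mean t * (\<psi> 2 t / \<psi> 0 t) + 2 * (mean t) ^ 3"
proof -
  note int = integrable_tilt_power[of t] and I = integral_tilt_power[of t]
  have "third_central_moment t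
      = (\<integral>x. tilt t x * x ^ 3 - 3 * mean t * (tilt t x * x ^ 2) + 3 * (mean t)\<^sup>2 * (tilt t x * x ^ 1)
          - (mean t) ^ 3 * (tilt t x * x ^ 0) \<partial>lborel)"
    by (intro Bochner_Integration.integral_cong) (auto simp: power2_eq_square power3_eq_cube algebra_simps)
  also have "\<dots> = \<psi> 3 t / \<psi> 0 t - 3 * mean t * (\<psi> 2 t / \<psi> 0 t) + 3 * (mean t)\<^sup>2 * (\<psi> 1 t / \<psi> 0 t)
          - (mean t) ^ 3 * (\<psi> 0 t / \<psi> 0 t)"
    by (simp only: Bochner_Integration.integral_add Bochner_Integration.integral_diff int integrable_mult_right
        Bochner_Integration.integrable_diff Bochner_Integration.integrable_add integral_mult_right_zero I)
  finally show ?thesis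
    using \<psi>_pos[of t] unfolding mean_eq by (simp add: power2_eq_square power3_eq_cube)
qed

lemma DERIV_mean: "(mean has_real_derivative tilted_variance t) (at t)"
proof -
  have "((\<lambda>t. \<psi> 1 t / \<psi> 0 t) has_real_derivative (\<psi> 2 t * \<psi> 0 t - \<psi> 1 t * \<psi> 1 t) / (\<psi> 0 t * \<psi> 0 t)) (at t)"
    using DERIV_divide[OF DERIV_\<psi>[of 1 t] DERIV_\<psi>[of 0 t]] \<psi>_pos[of t] by (simp add: numeral_2_eq_2)
  moreover have "(\<psi> 2 t * \<psi> 0 t - \<psi> 1 t * \<psi> 1 t) / (\<psi> 0 t * \<psi> 0 t) = \<psi> 2 t / \<psi> 0 t - (\<psi> 1 t / \<psi> 0 t)\<^sup>2"
    using \<psi>_pos[of t] by (simp add: field_simps power2_eq_square)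
  moreover have "mean = (\<lambda>t. \<psi> 1 t / \<psi> 0 t)" by (rule ext) (rule mean_eq)
  ultimately show ?thesis unfolding variance_eq by simp
qed

lemma DERIV_variance:
  "(tilted_variance has_real_derivative third_central_moment t) (at t)"
proof -
  have d: "(\<psi> 0 has_real_derivative \<psi> 1 t) (at t)" "(\<psi> 1 has_real_derivative \<psi> 2 t) (at t)"
    "(\<psi> 2 has_real_derivative \<psi> 3 t) (at t)"
    using DERIV_\<psi>[of 0 t] DERIV_\<psi>[of 1 t] DERIV_\<psi>[of 2 t] by (simp_all add: numeral_eq_Suc)
  have pos: "\<psi> 0 t \<noteq> 0" using \<psi>_pos[of t] by simp
  have "((\<lambda>t. \<psi> 2 t / \<psi> 0 t - (\<psi> 1 t / \<psi> 0 t)\<^sup>2) has_real_derivative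
      ((\<psi> 3 t * \<psi> 0 t - \<psi> 2 t * \<psi> 1 t) / (\<psi> 0 t * \<psi> 0 t)
        - 2 * (\<psi> 1 t / \<psi> 0 t) * ((\<psi> 2 t * \<psi> 0 t - \<psi> 1 t * \<psi> 1 t) / (\<psi> 0 t * \<psi> 0 t)))) (at t)"
    using DERIV_diff[OF DERIV_divide[OF d(3) d(1) pos] DERIV_power[OF DERIV_divide[OF d(2) d(1) pos], of 2]]
    by (simp add: mult_ac)
  moreover have "(\<psi> 3 t * \<psi> 0 t - \<psi> 2 t * \<psi> 1 t) / (\<psi> 0 t * \<psi> 0 t)
        - 2 * (\<psi> 1 t / \<psi> 0 t) * ((\<psi> 2 t * \<psi> 0 t - \<psi> 1 t * \<psi> 1 t) / (\<psi> 0 t * \<psi> 0 t))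
      = \<psi> 3 t / \<psi> 0 t - 3 * mean t * (\<psi> 2 t / \<psi> 0 t) + 2 * (mean t) ^ 3"
    using pos unfolding mean_eq by (simp add: field_simps power3_eq_cube)
  ultimately show ?thesis unfolding variance_eq third_central_moment_eq by simp
qed

end

section \<open>Regular and rapid variation force curvature\<close>

lemma DERIV_karamata:
  assumes \<epsilon>: "continuous_on {1..} \<epsilon>" and x: "x > 1"
  shows "(karamata c \<epsilon> has_real_derivative karamata c \<epsilon> x * (\<epsilon> x / x)) (at x)"
proof -
  have "continuous_on {1..x + 1} (\<lambda>u. \<epsilon> u / u)"
    by (intro continuous_intros continuous_on_subset[OF \<epsilon>]) auto
  then have "((\<lambda>x. integral {1..x} (\<lambda>u. \<epsilon> u / u)) has_real_derivative \<epsilon> x / x) (at x within {1..x + 1})"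
    by (rule integral_has_real_derivative) (use x in auto)
  then have "((\<lambda>x. integral {1..x} (\<lambda>u. \<epsilon> u / u)) has_real_derivative \<epsilon> x / x) (at x within {1<..<x + 1})"
    by (rule DERIV_subset) auto
  then have "((\<lambda>x. integral {1..x} (\<lambda>u. \<epsilon> u / u)) has_real_derivative \<epsilon> x / x) (at x)"
    using x by (subst (asm) at_within_open) auto
  then show ?thesis
    unfolding karamata_def[abs_def] by (auto intro!: derivative_eq_intros)
qed

locale superlinear_convex =
  fixes g :: "real \<Rightarrow> real"
  assumes convex: "convex_on {0..} g"
    and pos: "\<And>x. x \<ge> 0 \<Longrightarrow> g x > 0"
    and diff: "\<And>x. x > 0 \<Longrightarrow> g differentiable (at x)"
    and diff2: "\<And>x. x > 0 \<Longrightarrow> deriv g differentiable (at x)"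
    and superlinear: "filterlim (\<lambda>x. g x / x) at_top at_top"
begin

abbreviation "h \<equiv> deriv g"

lemma DERIV_g: "x > 0 \<Longrightarrow> (g has_real_derivative h x) (at x)"
  using diff by (simp add: DERIV_deriv_iff_real_differentiable)

lemma DERIV_h: "x > 0 \<Longrightarrow> (h has_real_derivative deriv h x) (at x)"
  using diff2 by (simp add: DERIV_deriv_iff_real_differentiable)

lemma above_tangent:
  assumes "c > 0" "x \<ge> 0" shows "g x - g c \<ge> h c * (x - c)"
  using assms
  by (intro convex_on_imp_above_tangent[OF convex]) (auto intro: has_field_derivative_at_within DERIV_g)

lemma h_mono:
  assumes "0 < x" "x \<le> y" shows "h x \<le> h y"
proof (cases "x = y")
  case False
  have "h x * (y - x) \<le> h y * (y - x)"
    using above_tangent[of x y] above_tangent[of y x] assms by (simp add: algebra_simps)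
  then show ?thesis using False assms by simp
qed simp

lemma deriv_h_nonneg: "x > 0 \<Longrightarrow> deriv h x \<ge> 0"
  by (rule mono_on_imp_deriv_nonneg[of "{0<..}" h]) (auto intro!: mono_onI h_mono DERIV_h simp: interior_open)

lemma h_at_top: "filterlim h at_top at_top"
proof (rule filterlim_at_top_mono)
  show "filterlim (\<lambda>x. - \<bar>g 1\<bar> + g x / x) at_top at_top"
    by (rule filterlim_tendsto_add_at_top[OF tendsto_const superlinear])
  show "\<forall>\<^sub>F x in at_top. - \<bar>g 1\<bar> + g x / x \<le> h x"
    using eventually_ge_at_top[of 2] filterlim_at_top[THEN iffD1, OF superlinear, rule_format, of "\<bar>g 1\<bar>"]
  proof eventually_elim
    case (elim x)
    have "g x - g 1 \<le> h x * (x - 1)" using above_tangent[of x 1] elim by (simp add: algebra_simps)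
    moreover have gx: "\<bar>g 1\<bar> * x \<le> g x" using elim by (simp add: field_simps)
    moreover have "\<bar>g 1\<bar> * 1 \<le> \<bar>g 1\<bar> * x" using elim by (intro mult_left_mono) auto
    ultimately have "0 \<le> h x * (x - 1)" by linarith
    then have "0 \<le> h x" using elim by (simp add: zero_le_mult_iff)
    then have "h x * (x - 1) \<le> h x * x" by (simp add: algebra_simps)
    then have "g x - \<bar>g 1\<bar> * x \<le> h x * x"
      using \<open>g x - g 1 \<le> h x * (x - 1)\<close> \<open>\<bar>g 1\<bar> * 1 \<le> \<bar>g 1\<bar> * x\<close> by linarith
    then have "(g x - \<bar>g 1\<bar> * x) / x \<le> h x" using elim by (simp add: divide_le_eq)
    then show ?case using elim by (simp add: diff_divide_distrib)
  qed
qed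

lemma critical_point:
  assumes X: "X > 0" and t: "t \<ge> h X"
  obtains x0 where "x0 \<ge> X" "h x0 = t"
proof -
  have "\<forall>\<^sub>F b in at_top. t \<le> h b \<and> X \<le> b"
    using h_at_top eventually_ge_at_top by (auto simp: filterlim_at_top intro: eventually_conj)
  then obtain b where b: "b \<ge> X" "h b \<ge> t"
    unfolding eventually_at_top_linorder by blast
  have "isCont h x" if "x \<ge> X" for x
    using DERIV_h[of x] X that by (intro DERIV_isCont) auto
  then show ?thesis
    using IVT[of h X t b] b t that by auto
qed

lemma linear_minorant: "\<exists>C. \<forall>x\<ge>0. t * x - C \<le> g x"
proof -
  have "\<forall>\<^sub>F x in at_top. t \<le> g x / x"
    using superlinear by (simp add: filterlim_at_top)
  then obtain X0 where X0: "\<And>x. x \<ge> X0 \<Longrightarrow> g x / x \<ge> t"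
    unfolding eventually_at_top_linorder by blast
  define X where "X = max X0 1"
  have X: "X > 0" "\<And>x. x \<ge> X \<Longrightarrow> g x / x \<ge> t" using X0 by (auto simp: X_def)
  have "t * x - \<bar>t\<bar> * X \<le> g x" if x: "x \<ge> 0" for x
  proof (cases "x \<ge> X")
    case True
    then have "t * x \<le> g x" using X(2)[OF True] X(1) by (simp add: field_simps)
    moreover have "0 \<le> \<bar>t\<bar> * X" using X by simp
    ultimately show ?thesis by linarith
  next
    case False
    have "t * x \<le> \<bar>t\<bar> * x" using x by (intro mult_right_mono) auto
    also have "\<dots> \<le> \<bar>t\<bar> * X" using False by (intro mult_left_mono) auto
    finally show ?thesis using pos[OF x] by linarith
  qed
  then show ?thesis by blast
qed

text \<open>If \<open>h x = x powr \<beta>0 * l x\<close>, then \<open>x h' x = (\<beta>0 + \<epsilon> x) h x\<close>. In the rapidly varying case \<open>\<psi> = h\<^sup>-\<^sup>1\<close> has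
\<open>\<psi>' t = \<psi> t \<epsilon> t / t\<close>, so \<open>x h' x = h x / \<epsilon> (h x)\<close>, which is at least \<open>h x\<close> once \<open>|\<epsilon>| < 1\<close>; monotonicity
of \<open>h\<close> makes \<open>\<epsilon>\<close> positive there.\<close>

lemma x_deriv_h_at_top:
  assumes R: "class_R h q"
  shows "filterlim (\<lambda>x. x * deriv h x) at_top at_top"
  using R unfolding class_R_def
proof
  assume "regularly_varying_case h q"
  then obtain \<beta>0 c \<epsilon> \<epsilon>' \<epsilon>'' where \<beta>0: "\<beta>0 > 0" and d: "has_two_derivs_on \<epsilon> \<epsilon>' \<epsilon>'' {1..}"
    and h: "\<And>x. x \<ge> 1 \<Longrightarrow> h x = x powr \<beta>0 * karamata c \<epsilon> x" and \<epsilon>: "\<epsilon> \<in> o(\<lambda>_. 1)"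
    unfolding regularly_varying_case_def by blast
  have cont: "continuous_on {1..} \<epsilon>"
    using d unfolding has_two_derivs_on_def by (auto intro!: DERIV_continuous_on)
  have lim: "filterlim (\<lambda>x. (\<beta>0 + \<epsilon> x) * h x) at_top at_top"
  proof (rule filterlim_tendsto_pos_mult_at_top[OF _ \<beta>0 h_at_top])
    have "(\<epsilon> \<longlongrightarrow> 0) at_top" using smalloD_tendsto[OF \<epsilon>] by simp
    then show "((\<lambda>x. \<beta>0 + \<epsilon> x) \<longlongrightarrow> \<beta>0) at_top" by (auto intro!: tendsto_eq_intros)
  qed
  have eq: "\<forall>\<^sub>F x in at_top. (\<beta>0 + \<epsilon> x) * h x = x * deriv h x"
    using eventually_gt_at_top[of 1]
  proof eventually_elim
    case (elim x)
    have "((\<lambda>x. x powr \<beta>0 * karamata c \<epsilon> x) has_real_derivative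
        (\<beta>0 * x powr (\<beta>0 - 1) * karamata c \<epsilon> x + karamata c \<epsilon> x * (\<epsilon> x / x) * x powr \<beta>0)) (at x)"
      using elim by (intro DERIV_mult has_real_derivative_powr DERIV_karamata[OF cont]) auto
    then have "(h has_real_derivative
        (\<beta>0 * x powr (\<beta>0 - 1) * karamata c \<epsilon> x + karamata c \<epsilon> x * (\<epsilon> x / x) * x powr \<beta>0)) (at x)"
      by (rule has_field_derivative_transform_within_open[of _ _ _ "{1<..}"]) (use elim h in auto)
    then have "deriv h x = \<beta>0 * x powr (\<beta>0 - 1) * karamata c \<epsilon> x + karamata c \<epsilon> x * (\<epsilon> x / x) * x powr \<beta>0"
      by (rule DERIV_imp_deriv)
    moreover have "x powr (\<beta>0 - 1) = x powr \<beta>0 / x" using elim by (simp add: powr_diff)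
    ultimately show ?case using elim h[of x] by (simp add: field_simps)
  qed
  show ?thesis using iffD1[OF filterlim_cong[OF refl refl eq] lim] .
next
  assume "rapidly_varying_case h q"
  then obtain \<psi> c \<epsilon> \<epsilon>' \<epsilon>'' where inv: "inverse_at_infinity h \<psi>" and c: "c > 0"
    and d: "has_two_derivs_on \<epsilon> \<epsilon>' \<epsilon>'' {1..}"
    and \<psi>: "\<forall>\<^sub>F t in at_top. \<psi> t = karamata c \<epsilon> t"
    and \<epsilon>0: "\<forall>\<^sub>F t in at_top. \<epsilon> t \<noteq> 0" and \<epsilon>: "\<epsilon> \<in> o(\<lambda>_. 1)"
    unfolding rapidly_varying_case_def by blast
  have cont: "continuous_on {1..} \<epsilon>"
    using d unfolding has_two_derivs_on_def by (auto intro!: DERIV_continuous_on)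
  have "(\<epsilon> \<longlongrightarrow> 0) at_top" using smalloD_tendsto[OF \<epsilon>] by simp
  then have \<epsilon>1: "\<forall>\<^sub>F t in at_top. \<bar>\<epsilon> t\<bar> < 1" using tendstoD[of \<epsilon> 0 at_top 1] by simp
  have "\<forall>\<^sub>F t in at_top. \<psi> t = karamata c \<epsilon> t \<and> h (\<psi> t) = t"
    using \<psi> inv unfolding inverse_at_infinity_def by (auto intro: eventually_conj)
  then obtain T where T: "\<And>t. t \<ge> T \<Longrightarrow> \<psi> t = karamata c \<epsilon> t \<and> h (\<psi> t) = t"
    unfolding eventually_at_top_linorder by blast
  have key: "\<forall>\<^sub>F t in at_top. \<psi> t * deriv h (\<psi> t) \<ge> t"
    using eventually_gt_at_top[of T] eventually_gt_at_top[of 1] \<epsilon>0 \<epsilon>1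
  proof eventually_elim
    case (elim t)
    have \<psi>t: "\<psi> t = karamata c \<epsilon> t" using T elim by simp
    then have pos: "\<psi> t > 0" using c by (simp add: karamata_def)
    have "(karamata c \<epsilon> has_real_derivative karamata c \<epsilon> t * (\<epsilon> t / t)) (at t)"
      using elim by (intro DERIV_karamata cont) auto
    then have "(\<psi> has_real_derivative \<psi> t * (\<epsilon> t / t)) (at t)"
      unfolding \<psi>t by (rule has_field_derivative_transform_within_open[of _ _ _ "{T<..}"]) (use elim T in auto)
    then have comp: "((\<lambda>t. h (\<psi> t)) has_real_derivative deriv h (\<psi> t) * (\<psi> t * (\<epsilon> t / t))) (at t)"
      by (rule DERIV_chain2[where f = h and g = \<psi> and x = t, OF DERIV_h[OF pos]])
    have "h (\<psi> s) = s" if "s > T" for s by (rule conjunct2[OF T]) (use that in simp)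
    note inverse = this
    have "((\<lambda>t. t) has_real_derivative deriv h (\<psi> t) * (\<psi> t * (\<epsilon> t / t))) (at t)"
      by (rule has_field_derivative_transform_within_open[OF comp, of "{T<..}"]) (use elim inverse in auto)
    then have "deriv h (\<psi> t) * (\<psi> t * (\<epsilon> t / t)) = 1"
      by (rule DERIV_unique) (rule DERIV_ident)
    then have eq: "\<psi> t * deriv h (\<psi> t) * \<epsilon> t = t" using elim by (simp add: field_simps)
    have nn: "0 \<le> \<psi> t * deriv h (\<psi> t)" using pos deriv_h_nonneg[OF pos] by simp
    have "t = \<psi> t * deriv h (\<psi> t) * \<epsilon> t" using eq ..
    also have "\<dots> \<le> \<psi> t * deriv h (\<psi> t) * 1" using elim nn by (intro mult_left_mono) auto
    finally show ?case by simp
  qed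
  show ?thesis
  proof (rule filterlim_at_top_mono[OF h_at_top])
    have "\<forall>\<^sub>F x in at_top. \<psi> (h x) * deriv h (\<psi> (h x)) \<ge> h x"
      using key h_at_top by (auto simp: filterlim_iff)
    moreover have "\<forall>\<^sub>F x in at_top. \<psi> (h x) = x"
      using inv unfolding inverse_at_infinity_def by blast
    ultimately show "\<forall>\<^sub>F x in at_top. h x \<le> x * deriv h x"
      by eventually_elim simp
  qed
qed

end

section \<open>The scale of the tilted density\<close>

locale almost_log_concave = superlinear_convex g for g +
  fixes q p :: "real \<Rightarrow> real" and Q :: real
  assumes q_bounded: "\<And>x. x \<ge> 0 \<Longrightarrow> \<bar>q x\<bar> \<le> Q"
    and p_eq: "\<And>x. p x = (if x \<ge> 0 then exp (- (g x - q x)) else 0)"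
    and p_measurable [measurable]: "p \<in> borel_measurable borel"
    and p_total: "(\<integral>x. p x \<partial>lborel) = 1"
begin

lemma integrable_exp_power: "integrable lborel (\<lambda>x. \<bar>x\<bar> ^ k * exp (t * \<bar>x\<bar>) * p x)"
proof -
  obtain C where C: "\<And>x. x \<ge> 0 \<Longrightarrow> (t + 1) * x - C \<le> g x"
    using linear_minorant[of "t + 1"] by blast
  have i: "integrable lborel (\<lambda>x. exp (Q + C) * (\<bar>x\<bar> ^ k * exp (- (1 * \<bar>x\<bar>))))"
    by (intro integrable_mult_right integrable_abs_power_exp) simp
  show ?thesis
  proof (rule Bochner_Integration.integrable_bound[OF i])
    have "\<bar>x\<bar> ^ k * exp (t * \<bar>x\<bar>) * p x \<le> exp (Q + C) * (\<bar>x\<bar> ^ k * exp (- (1 * \<bar>x\<bar>)))" for x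
    proof (cases "x \<ge> 0")
      case True
      have "exp (t * \<bar>x\<bar>) * p x = exp (t * x - (g x - q x))"
        using True by (simp add: p_eq exp_add[symmetric])
      also have "\<dots> \<le> exp ((Q + C) + - (1 * \<bar>x\<bar>))"
        using C[OF True] q_bounded[OF True] True by (simp add: algebra_simps)
      also have "\<dots> = exp (Q + C) * exp (- (1 * \<bar>x\<bar>))" by (rule exp_add)
      finally have "\<bar>x\<bar> ^ k * (exp (t * \<bar>x\<bar>) * p x) \<le> \<bar>x\<bar> ^ k * (exp (Q + C) * exp (- (1 * \<bar>x\<bar>)))"
        by (intro mult_left_mono) auto
      then show ?thesis by (simp only: mult_ac)
    qed (simp add: p_eq)
    moreover have "0 \<le> p x" for x by (simp add: p_eq)
    ultimately show "AE x in lborel. norm (\<bar>x\<bar> ^ k * exp (t * \<bar>x\<bar>) * p x)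
        \<le> norm (exp (Q + C) * (\<bar>x\<bar> ^ k * exp (- (1 * \<bar>x\<bar>))))"
      by (auto intro!: AE_I2 simp: abs_mult)
  qed measurable
qed

sublocale light_tailed p
proof
  show "0 \<le> p x" for x by (simp add: p_eq)
qed (fact p_measurable integrable_exp_power p_total)+

abbreviation rescaled :: "real \<Rightarrow> real \<Rightarrow> real \<Rightarrow> real" where
  "rescaled t w \<equiv> \<lambda>z. w * tilt t (mean t + w * z)"

abbreviation tame_at :: "real \<Rightarrow> real \<Rightarrow> real \<Rightarrow> bool" where
  "tame_at t w \<alpha> \<equiv> tame_density (rescaled t w) (tail_const Q) (1 / 2) (core_const Q) \<alpha>"

abbreviation "centre_const \<equiv> exp (2 * Q + 2) * exp_moment (1 / 2) 1"

text \<open>The width \<open>w\<close> is that of the level set of \<open>g x - t x\<close>; the last property bounds it by the distance of any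
two points on either side of the minimiser that lie above the level.\<close>

lemma tilted_scale:
  assumes x0: "x0 > 0" and t: "h x0 = t"
  obtains w \<alpha> where "w > 0"
    "tame_at t w \<alpha>"
    "\<bar>mean t - x0\<bar> \<le> centre_const * w"
    "\<And>y y'. 0 \<le> y' \<Longrightarrow> y' < x0 \<Longrightarrow> x0 < y \<Longrightarrow> g x0 - t * x0 + 1 < g y' - t * y' \<Longrightarrow>
       g x0 - t * x0 + 1 < g y - t * y \<Longrightarrow> w \<le> y - y'"
proof -
  define G where "G = (\<lambda>x. g x - t * x)"
  have conv: "convex_on {0..} G"
  proof -
    have "convex_on {0..} (\<lambda>x. g x + (- t) * x)"
      by (intro convex_on_add convex) (auto intro!: convex_on_linorderI simp: algebra_simps)
    then show ?thesis by (simp add: G_def)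
  qed
  have min: "G x0 \<le> G x" if "x \<ge> 0" for x
    using above_tangent[OF x0 that] t by (simp add: G_def algebra_simps)
  obtain C where C: "\<And>x. x \<ge> 0 \<Longrightarrow> (t + 1) * x - C \<le> g x"
    using linear_minorant[of "t + 1"] by blast
  define y where "y = x0 + \<bar>G x0 + 1 + C\<bar> + 1"
  have y: "y > x0" "G y > G x0 + 1"
    using C[of y] x0 by (auto simp: y_def G_def algebra_simps)
  obtain x1 w where w: "w > 0" "0 \<le> x1" "x1 \<le> x0" "x0 \<le> x1 + w"
    and near: "\<And>x. x1 < x \<Longrightarrow> x < x1 + w \<Longrightarrow> G x \<le> G x0 + 1"
    and far: "\<And>x. x \<ge> 0 \<Longrightarrow> \<bar>x - x0\<bar> / (2 * w) - 1 \<le> G x - G x0"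
    by (rule convex_level_scale[OF conv x0 min y]) (simp, rule that)
  define Z where "Z = \<psi> 0 t * exp (G x0)"
  have Z: "Z > 0" unfolding Z_def using \<psi>_pos by simp
  have Z_tilt: "Z * tilt t x = exp (q x - (G x - G x0))" if "x \<ge> 0" for x
    using that \<psi>_pos[of t] unfolding Z_def tilt_def p_eq G_def
    by (simp add: exp_add[symmetric] algebra_simps)
  have comp: "exp (- Q - (G x - G x0)) \<le> Z * tilt t x" "Z * tilt t x \<le> exp (Q - (G x - G x0))" if "x \<ge> 0" for x
    using q_bounded[OF that] unfolding Z_tilt[OF that] by auto
  have neg: "tilt t x = 0" if "x < 0" for x using that by (simp add: tilt_def p_eq)
  note tame = tame_of_log_concave[OF borel_measurable_tilt integral_tilt neg Z comp w(1,2) near far, folded mean_def]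
  show ?thesis
  proof (rule that[OF w(1) tame])
    fix y y' assume "0 \<le> y'" "y' < x0" "x0 < y" "g x0 - t * x0 + 1 < g y' - t * y'" "g x0 - t * x0 + 1 < g y - t * y"
    then show "w \<le> y - y'"
      using near[of y] near[of y'] w unfolding G_def by force
  qed
qed

lemma eventually_tame:
  "\<forall>\<^sub>F t in at_top. \<exists>w \<alpha>. w > 0 \<and> tame_at t w \<alpha>"
  using eventually_ge_at_top[of "h 1"]
proof eventually_elim
  case (elim t)
  obtain x0 where x0: "x0 \<ge> 1" "h x0 = t" using critical_point[of 1 t] elim by auto
  show ?case by (rule tilted_scale[OF _ x0(2)]) (use x0(1) in auto)
qed

text \<open>The step \<open>e\<close> is chosen so that the curvature bound \<open>h' \<ge> 2 K / (3 x0)\<close> on \<open>[x0 / 2, 3 x0 / 2]\<close> produces a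
rise of \<open>4 / 3 > 1\<close>. The rise is read off from the tangents at \<open>x0\<close> and at \<open>x0 \<plusminus> e\<close>: by the mean value
theorem the slopes at these points differ by at least \<open>2 K e / (3 x0)\<close>.\<close>

lemma quadratic_growth:
  assumes K: "\<And>x. x \<ge> X \<Longrightarrow> x * deriv h x \<ge> K" and K0: "K > 0" and x0: "x0 \<ge> 2 * X" "x0 > 0"
    and e: "e = sqrt (2 * x0 / K)" "2 * e \<le> x0 / 2"
  shows "g x0 - h x0 * x0 + 1 < g (x0 + 2 * e) - h x0 * (x0 + 2 * e)"
    and "g x0 - h x0 * x0 + 1 < g (x0 - 2 * e) - h x0 * (x0 - 2 * e)"
proof -
  have e0: "e > 0" "e\<^sup>2 = 2 * x0 / K" using e(1) x0 K0 by auto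
  have slope: "h b - h a \<ge> 2 * K / (3 * x0) * e" if ab: "x0 / 2 \<le> a" "b = a + e" "b \<le> 3 * x0 / 2" for a b
  proof -
    have "\<exists>z. a < z \<and> z < b \<and> h b - h a = (b - a) * deriv h z"
      using ab e0 x0 by (intro MVT2 DERIV_h) auto
    then obtain z where z: "a < z" "z < b" "h b - h a = (b - a) * deriv h z" by blast
    have z0: "z > 0" "z \<le> 3 * x0 / 2" using z ab x0 by auto
    have "K \<le> z * deriv h z" using z ab x0 by (intro K) auto
    also have "\<dots> \<le> (3 * x0 / 2) * deriv h z" using z0 deriv_h_nonneg[of z] by (intro mult_right_mono) auto
    finally have "2 * K / (3 * x0) \<le> deriv h z" using x0 by (simp add: field_simps)
    then have "e * (2 * K / (3 * x0)) \<le> e * deriv h z" using e0 by (intro mult_left_mono) auto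
    then show ?thesis using z(3) ab(2) by (simp add: mult_ac)
  qed
  have step: "1 < (2 * K / (3 * x0) * e) * e"
  proof -
    have "(2 * K / (3 * x0) * e) * e = 2 * K / (3 * x0) * e\<^sup>2" by (simp add: power2_eq_square)
    also have "\<dots> = 4 / 3" unfolding e0(2) using x0 K0 by simp
    finally show ?thesis by simp
  qed
  have "h (x0 + e) * e \<le> g (x0 + 2 * e) - g (x0 + e)"
    using above_tangent[of "x0 + e" "x0 + 2 * e"] e0 x0 by simp
  moreover have "h x0 * e \<le> g (x0 + e) - g x0"
    using above_tangent[of x0 "x0 + e"] e0 x0 by simp
  moreover have "(2 * K / (3 * x0) * e) * e \<le> (h (x0 + e) - h x0) * e"
    using slope[of x0 "x0 + e"] e e0 x0 by (intro mult_right_mono) auto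
  ultimately show "g x0 - h x0 * x0 + 1 < g (x0 + 2 * e) - h x0 * (x0 + 2 * e)"
    using step by (simp add: algebra_simps)
  have "- h (x0 - e) * e \<le> g (x0 - 2 * e) - g (x0 - e)"
    using above_tangent[of "x0 - e" "x0 - 2 * e"] e e0 x0 by simp
  moreover have "- h x0 * e \<le> g (x0 - e) - g x0"
    using above_tangent[of x0 "x0 - e"] e e0 x0 by simp
  moreover have "(2 * K / (3 * x0) * e) * e \<le> (h x0 - h (x0 - e)) * e"
    using slope[of "x0 - e" x0] e e0 x0 by (intro mult_right_mono) auto
  ultimately show "g x0 - h x0 * x0 + 1 < g (x0 - 2 * e) - h x0 * (x0 - 2 * e)"
    using step by (simp add: algebra_simps)
qed

text \<open>The level set has width at most \<open>4 e\<close> with \<open>e\<^sup>2 = 2 x0 / K\<close>, where \<open>K\<close> can be taken arbitrarily large,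
and the mean is comparable to the minimiser \<open>x0\<close>.\<close>

lemma eventually_narrow:
  assumes curv: "filterlim (\<lambda>x. x * deriv h x) at_top at_top" and \<delta>: "\<delta> > 0"
  shows "\<forall>\<^sub>F t in at_top. \<exists>w \<alpha>. w > 0 \<and>
    tame_at t w \<alpha> \<and> w\<^sup>2 \<le> \<delta> * mean t"
proof -
  \<comment> \<open>The first summand keeps the test points \<open>x0 \<plusminus> 2 e\<close> inside \<open>[x0 / 2, 3 x0 / 2]\<close>, the second keeps the mean above \<open>x0 / 2\<close>, the third yields \<open>\<delta>\<close>.\<close>
  define K where "K = 32 + 128 * centre_const\<^sup>2 + 64 / \<delta>"
  have K: "K \<ge> 32" "K \<ge> 128 * centre_const\<^sup>2" "K \<ge> 64 / \<delta>" using \<delta> by (auto simp: K_def)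
  have "\<forall>\<^sub>F x in at_top. K \<le> x * deriv h x"
    using curv by (simp add: filterlim_at_top)
  then obtain X0 where X0: "\<And>x. x \<ge> X0 \<Longrightarrow> K \<le> x * deriv h x"
    unfolding eventually_at_top_linorder by blast
  define X where "X = max X0 1"
  have X: "X \<ge> 1" "\<And>x. x \<ge> X \<Longrightarrow> K \<le> x * deriv h x" using X0 by (auto simp: X_def)
  show ?thesis
    using eventually_ge_at_top[of "h (2 * X)"]
  proof eventually_elim
    case (elim t)
    obtain x0 where x0: "x0 \<ge> 2 * X" "h x0 = t" using critical_point[of "2 * X" t] elim X by auto
    have x0_ge: "x0 \<ge> 2" using x0 X by simp
    obtain w \<alpha> where w: "w > 0"
      and tame: "tame_at t w \<alpha>"
      and centre: "\<bar>mean t - x0\<bar> \<le> centre_const * w"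
      and width: "\<And>y y'. 0 \<le> y' \<Longrightarrow> y' < x0 \<Longrightarrow> x0 < y \<Longrightarrow> g x0 - t * x0 + 1 < g y' - t * y' \<Longrightarrow>
       g x0 - t * x0 + 1 < g y - t * y \<Longrightarrow> w \<le> y - y'"
      by (rule tilted_scale[OF _ x0(2)]) (use x0_ge in simp, rule that)
    define e where "e = sqrt (2 * x0 / K)"
    have e0: "e > 0" "e\<^sup>2 = 2 * x0 / K" using x0_ge K by (auto simp: e_def)
    have e2: "2 * e \<le> x0 / 2"
    proof (rule power2_le_imp_le)
      have "(2 * e)\<^sup>2 = 8 * x0 / K" using e0 by (simp add: power_mult_distrib)
      also have "\<dots> \<le> 8 * x0 / 32" using K x0_ge by (intro divide_left_mono) auto
      also have "\<dots> \<le> x0 * x0 / 4" using x0_ge by simp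
      finally show "(2 * e)\<^sup>2 \<le> (x0 / 2)\<^sup>2" by (simp add: power2_eq_square)
    qed (use x0_ge in simp)
    have "w \<le> (x0 + 2 * e) - (x0 - 2 * e)"
      using quadratic_growth[OF X(2) _ x0(1) _ e_def e2] K x0_ge e0 e2 unfolding x0(2)
      by (intro width) auto
    then have "w\<^sup>2 \<le> (4 * e)\<^sup>2" using w by (intro power_mono) auto
    also have "\<dots> = 32 * x0 / K" using e0 by (simp add: power_mult_distrib)
    finally have w2: "w\<^sup>2 \<le> 32 * x0 / K" .
    have "centre_const * w \<le> x0 / 2"
    proof (rule power2_le_imp_le)
      have "(centre_const * w)\<^sup>2 \<le> centre_const\<^sup>2 * (32 * x0 / K)"
        unfolding power_mult_distrib[of centre_const w] using w2 by (intro mult_left_mono) auto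
      also have "\<dots> = (128 * centre_const\<^sup>2) * (x0 / (4 * K))" by simp
      also have "\<dots> \<le> K * (x0 / (4 * K))" using K x0_ge by (intro mult_right_mono) auto
      also have "\<dots> \<le> (x0 / 2)\<^sup>2" using K x0_ge by (simp add: power2_eq_square)
      finally show "(centre_const * w)\<^sup>2 \<le> (x0 / 2)\<^sup>2" .
    qed (use x0_ge in simp)
    then have "x0 \<le> 2 * mean t" using centre by linarith
    then have "32 * x0 / K \<le> 64 * mean t / K" using K by (intro divide_right_mono) auto
    also have "\<dots> = mean t * (64 / K)" by simp
    also have "\<dots> \<le> mean t * \<delta>"
    proof (rule mult_left_mono)
      show "64 / K \<le> \<delta>" using K \<delta> by (simp add: field_simps)
      show "0 \<le> mean t" using \<open>x0 \<le> 2 * mean t\<close> x0_ge by simp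
    qed
    finally have "w\<^sup>2 \<le> \<delta> * mean t" using w2 by (simp add: mult.commute)
    then show ?case using w tame by blast
  qed
qed

lemma mean_mono: "mono mean"
proof (rule monoI)
  fix s t :: real assume "s \<le> t"
  then show "mean s \<le> mean t"
  proof (rule DERIV_nonneg_imp_nondecreasing)
    fix x
    have "0 \<le> (\<integral>y. tilt x y * (y - mean x)\<^sup>2 \<partial>lborel)"
      using tilt_nonneg by (intro Bochner_Integration.integral_nonneg) simp
    then show "\<exists>y. (mean has_real_derivative y) (at x) \<and> 0 \<le> y" using DERIV_mean by blast
  qed
qed

end

section \<open>Rates of approximation\<close>

lemma tv_dist_density_nonneg:
  fixes u v :: "real \<Rightarrow> real"
  assumes "integrable lborel u" "\<And>x. 0 \<le> u x" "integrable lborel v" "\<And>x. 0 \<le> v x"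
  shows "0 \<le> tv_dist (density lborel (\<lambda>x. ennreal (u x))) (density lborel (\<lambda>x. ennreal (v x)))"
proof -
  have fin: "finite_measure (density lborel (\<lambda>x. ennreal (f x)))" if "integrable lborel f" "\<And>x. 0 \<le> f x" for f :: "real \<Rightarrow> real"
  proof
    have [measurable]: "f \<in> borel_measurable borel" using that by auto
    show "emeasure (density lborel (\<lambda>x. ennreal (f x))) (space (density lborel (\<lambda>x. ennreal (f x)))) \<noteq> \<infinity>"
      using nn_integral_eq_integral[OF that(1)] that(2) by (simp add: emeasure_density)
  qed
  interpret U: finite_measure "density lborel (\<lambda>x. ennreal (u x))" using assms by (intro fin)
  interpret V: finite_measure "density lborel (\<lambda>x. ennreal (v x))" using assms by (intro fin)
  let ?U = "density lborel (\<lambda>x. ennreal (u x))" and ?V = "density lborel (\<lambda>x. ennreal (v x))"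
  have "bdd_above ((\<lambda>A. \<bar>measure ?U A - measure ?V A\<bar>) ` sets borel)"
  proof (rule bdd_aboveI2)
    fix A :: "real set"
    show "\<bar>measure ?U A - measure ?V A\<bar> \<le> measure ?U (space ?U) + measure ?V (space ?V)"
      using U.bounded_measure[of A] V.bounded_measure[of A] measure_nonneg[of ?U A] measure_nonneg[of ?V A] by linarith
  qed
  then have "\<bar>measure ?U {} - measure ?V {}\<bar> \<le> tv_dist ?U ?V"
    unfolding tv_dist_def by (rule cSUP_upper[rotated]) simp
  then show ?thesis by simp
qed

context almost_log_concave
begin

lemma tilted_moments:
  assumes w: "w > 0"
    and tame: "tame_density (rescaled t w) B c d \<alpha>"
  defines "f \<equiv> rescaled t w"
  shows "tilted_variance t = w\<^sup>2 * tame_density.\<sigma>2 f"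
    and "\<bar>third_central_moment t\<bar> \<le> w ^ 3 * (B * exp_moment c 3)"
proof -
  interpret tame_density "rescaled t w" B c d \<alpha> by (rule tame)
  have eq: "(\<integral>x. tilt t x * (x - mean t) ^ k \<partial>lborel) = w ^ k * (\<integral>z. f z * z ^ k \<partial>lborel)" for k
    unfolding integral_mult_right_zero[symmetric] f_def
    by (subst lborel_affine_substitution(2)[OF w, of _ "mean t"]) (simp add: power_mult_distrib mult_ac)
  show "tilted_variance t = w\<^sup>2 * tame_density.\<sigma>2 f"
    unfolding eq \<sigma>2_def f_def by simp
  have "\<bar>\<integral>z. f z * z ^ 3 \<partial>lborel\<bar> \<le> (\<integral>z. \<bar>f z * z ^ 3\<bar> \<partial>lborel)" by (rule integral_abs_bound)
  also have "\<dots> = (\<integral>z. f z * \<bar>z\<bar> ^ 3 \<partial>lborel)"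
    unfolding f_def by (simp only: abs_mult[of _ "_ ^ 3"] power_abs abs_of_nonneg[OF nonneg])
  also have "\<dots> \<le> B * mom 3" unfolding f_def by (rule moment_le)
  finally show "\<bar>third_central_moment t\<bar> \<le> w ^ 3 * (B * mom 3)"
    unfolding eq using w by (simp add: abs_mult mult_left_mono)
qed

text \<open>One null sequence \<open>\<eta>\<close>, of order \<open>1 / \<surd>n\<close>, serves all tilts at once, because the constants of the tame
class depend only on \<open>Q\<close>.\<close>

lemma gibbs_rate:
  obtains \<eta> :: "nat \<Rightarrow> real" where "\<eta> \<longlonglongrightarrow> 0"
    "\<forall>\<^sub>F n in sequentially. \<forall>t w \<alpha>. w > 0 \<longrightarrow>
       tame_at t w \<alpha> \<longrightarrow>
       (\<exists>u. cond_measure p n (mean t) = density lborel (\<lambda>x. ennreal (u x)) \<and> (\<forall>x. 0 \<le> u x) \<and> integrable lborel u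
         \<and> (\<integral>x. \<bar>u x - tilt t x\<bar> \<partial>lborel) \<le> \<eta> n)"
proof -
  define K where "K = tame_density.llt_const (tail_const Q) (1 / 2) (core_const Q)"
  define S where "S = \<bar>tail_const Q * exp_moment (1 / 2) 2\<bar> + 1"
  define l where "l = 1 / sqrt (2 * pi * S)"
  have S: "S > 0" unfolding S_def by simp
  have l: "l > 0" unfolding l_def using S by simp
  define \<eta> where "\<eta> = (\<lambda>n. 2 * \<bar>K\<bar> / (l * sqrt (real (n - 1)) - \<bar>K\<bar>))"
  have lim: "filterlim (\<lambda>n. l * sqrt (real (n - 1)) - \<bar>K\<bar>) at_top sequentially"
  proof -
    have "filterlim (\<lambda>n. sqrt (real (n - 1))) at_top sequentially"
      by (intro filterlim_compose[OF sqrt_at_top] filterlim_compose[OF filterlim_real_sequentially] filterlim_minus_const_nat_at_top)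
    then have "filterlim (\<lambda>n. - \<bar>K\<bar> + l * sqrt (real (n - 1))) at_top sequentially"
      by (intro filterlim_tendsto_add_at_top[OF tendsto_const] filterlim_tendsto_pos_mult_at_top[OF tendsto_const l])
    then show ?thesis by simp
  qed
  show ?thesis
  proof (rule that[of \<eta>])
    show "\<eta> \<longlonglongrightarrow> 0"
      unfolding \<eta>_def by (rule real_tendsto_divide_at_top[OF tendsto_const lim])
    have "\<forall>\<^sub>F n in sequentially. 0 < l * sqrt (real (n - 1)) - \<bar>K\<bar>"
      using lim unfolding filterlim_at_top_dense by blast
    then show "\<forall>\<^sub>F n in sequentially. \<forall>t w \<alpha>. w > 0 \<longrightarrow>
       tame_at t w \<alpha> \<longrightarrow>
       (\<exists>u. cond_measure p n (mean t) = density lborel (\<lambda>x. ennreal (u x)) \<and> (\<forall>x. 0 \<le> u x) \<and> integrable lborel u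
         \<and> (\<integral>x. \<bar>u x - tilt t x\<bar> \<partial>lborel) \<le> \<eta> n)"
      using eventually_ge_at_top[of 3]
    proof eventually_elim
      case (elim n)
      define r where "r = sqrt (real (n - 1))"
      have r: "r > 0" "real (n - 1) = r\<^sup>2" using elim by (auto simp: r_def)
      show ?case
      proof (intro allI impI)
        fix t w \<alpha> assume w: "w > 0"
          and tame: "tame_at t w \<alpha>"
        define e where "e = K / real (n - 1)"
        define L where "L = 1 / sqrt (2 * pi * tame_density.\<sigma>2 (rescaled t w) * real (n - 1))"
        have e: "e \<le> \<bar>K\<bar> / r\<^sup>2" unfolding e_def r(2) by (intro divide_right_mono) auto
        have L: "l / r \<le> L"
        proof -
          have \<sigma>: "0 < tame_density.\<sigma>2 (rescaled t w)" "tame_density.\<sigma>2 (rescaled t w) \<le> S"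
            using tame_density.\<sigma>2_ge[OF tame] tame_density.\<sigma>2_le[OF tame] tame_density.d_pos[OF tame] unfolding S_def by linarith+
          have "l / r = 1 / sqrt (2 * pi * S * real (n - 1))"
            unfolding l_def r_def by (simp add: real_sqrt_mult)
          also have "\<dots> \<le> L"
            unfolding L_def using \<sigma> S elim by (intro divide_left_mono real_sqrt_le_mono mult_right_mono mult_left_mono mult_pos_pos) auto
          finally show ?thesis .
        qed
        have pos: "0 < l / r - \<bar>K\<bar> / r\<^sup>2"
        proof -
          have "0 < (l * r - \<bar>K\<bar>) / r\<^sup>2" using elim r unfolding r_def[symmetric] by (intro divide_pos_pos) auto
          then show ?thesis using r by (simp add: diff_divide_distrib power2_eq_square)
        qed
        then have small: "e < L" using e L by linarith
        obtain u where u: "cond_measure p n (mean t) = density lborel (\<lambda>x. ennreal (u x))" "\<forall>x. 0 \<le> u x" "integrable lborel u"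
          "(\<integral>x. \<bar>u x - tilt t x\<bar> \<partial>lborel) \<le> 2 * e / (L - e)"
          using gibbs_conditioning_L1[of p "\<psi> 0 t" w n t "mean t" "tail_const Q" "1 / 2" "core_const Q" \<alpha>, folded tilt_def K_def, folded e_def L_def]
            w tame small elim \<psi>_pos p_measurable nonneg by blast
        have "2 * e / (L - e) \<le> 2 * (\<bar>K\<bar> / r\<^sup>2) / (l / r - \<bar>K\<bar> / r\<^sup>2)"
        proof (rule frac_le)
          show "0 \<le> 2 * (\<bar>K\<bar> / r\<^sup>2)" by simp
        qed (use pos e L in auto)
        also have "\<dots> = (2 * \<bar>K\<bar> / r\<^sup>2) / ((l * r - \<bar>K\<bar>) / r\<^sup>2)"
          using r by (simp add: diff_divide_distrib power2_eq_square)
        also have "\<dots> = \<eta> n" unfolding \<eta>_def r_def[symmetric] using r by simp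
        finally show "\<exists>u. cond_measure p n (mean t) = density lborel (\<lambda>x. ennreal (u x)) \<and> (\<forall>x. 0 \<le> u x) \<and> integrable lborel u
         \<and> (\<integral>x. \<bar>u x - tilt t x\<bar> \<partial>lborel) \<le> \<eta> n"
          using u by (intro exI[of _ u]) auto
      qed
    qed
  qed
qed

text \<open>Variance and third cumulant are of orders \<open>w\<^sup>2\<close> and \<open>w\<^sup>3\<close>, so that \<open>\<kappa> w\<close> is of order \<open>w\<^sup>2 / N\<close> and
\<open>w\<^sup>2 / \<beta>\<close> of order \<open>1 / N\<close>.\<close>

lemma gauss_tilt_rate:
  obtains C :: real where "C > 0"
    "\<And>t w \<alpha> N. w > 0 \<Longrightarrow> N > 0 \<Longrightarrow>
       tame_at t w \<alpha> \<Longrightarrow>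
       C * (w\<^sup>2 + 1) / N \<le> 1 / 4 \<Longrightarrow>
       (let s2 = tilted_variance t; \<mu>3 = third_central_moment t;
          v = gauss_tilt_density p (mean t) (t + \<mu>3 / (2 * N * s2)) (N * s2)
        in (\<forall>x. 0 \<le> v x) \<and> integrable lborel v \<and> (\<integral>x. \<bar>v x - tilt t x\<bar> \<partial>lborel) \<le> 4 * (C * (w\<^sup>2 + 1) / N))"
proof -
  let ?B = "tail_const Q" and ?d = "core_const Q"
  define M3 where "M3 = \<bar>?B * exp_moment (1 / 2) 3\<bar>"
  define I where "I = exp_moment (1 / 4)"
  define C where "C = \<bar>?B\<bar> * (6 * M3 / \<bar>?d\<bar> * I 1 + 6 / \<bar>?d\<bar> * I 2) + 6 * M3 / \<bar>?d\<bar> + 1"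
  have I0: "I k \<ge> 0" for k unfolding I_def by (rule exp_moment_nonneg)
  have M30: "M3 \<ge> 0" unfolding M3_def by simp
  have C0: "C > 0" "6 * M3 / \<bar>?d\<bar> \<le> C" "\<bar>?B\<bar> * (6 * M3 / \<bar>?d\<bar> * I 1 + 6 / \<bar>?d\<bar> * I 2) \<le> C"
    unfolding C_def using I0 M30 by (auto simp: add_nonneg_pos)
  show ?thesis
  proof (rule that[OF C0(1)])
    fix t w \<alpha> N :: real
    assume w: "w > 0" and N: "N > 0"
      and tame: "tame_at t w \<alpha>"
      and small: "C * (w\<^sup>2 + 1) / N \<le> 1 / 4"
    interpret T: tame_density "rescaled t w" ?B "1 / 2" ?d \<alpha> by (rule tame)
    define s2 where "s2 = tilted_variance t"
    define \<mu>3 where "\<mu>3 = third_central_moment t"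
    define \<kappa> where "\<kappa> = \<mu>3 / (2 * N * s2)"
    define b where "b = w\<^sup>2 * (?d / 12)"
    have b: "b > 0" unfolding b_def using w T.d_pos by simp
    have s2: "s2 \<ge> b"
      unfolding s2_def b_def tilted_moments(1)[OF w tame] using T.\<sigma>2_ge by (intro mult_left_mono) auto
    have \<mu>3: "\<bar>\<mu>3\<bar> \<le> w ^ 3 * M3"
    proof -
      have "\<bar>\<mu>3\<bar> \<le> w ^ 3 * (?B * T.mom 3)" unfolding \<mu>3_def by (rule tilted_moments(2)[OF w tame])
      also have "\<dots> \<le> w ^ 3 * M3" unfolding M3_def using w by (intro mult_left_mono) auto
      finally show ?thesis .
    qed
    have \<kappa>w: "\<bar>\<kappa>\<bar> * w \<le> 6 * M3 / ?d * (w\<^sup>2 / N)"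
    proof -
      have "\<bar>\<kappa>\<bar> * w = \<bar>\<mu>3\<bar> * w / (2 * N * s2)" unfolding \<kappa>_def using N s2 b by (simp add: abs_mult)
      also have "\<dots> \<le> (w ^ 3 * M3) * w / (2 * N * b)"
        using \<mu>3 w N s2 b M30 by (intro frac_le mult_right_mono mult_left_mono) auto
      also have "\<dots> = 6 * M3 / ?d * (w\<^sup>2 / N)"
        unfolding b_def using w N T.d_pos by (simp add: field_simps power2_eq_square power3_eq_cube)
      finally show ?thesis .
    qed
    have d_abs: "\<bar>?d\<bar> = ?d" "\<bar>?B\<bar> = ?B" using T.d_pos T.B_pos by auto
    have "6 * M3 / ?d * (w\<^sup>2 / N) \<le> C * ((w\<^sup>2 + 1) / N)"
      using C0 N M30 T.d_pos unfolding d_abs by (intro mult_mono divide_right_mono) auto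
    also have "C * ((w\<^sup>2 + 1) / N) \<le> 1 / 4" using small by simp
    finally have \<kappa>_small: "\<bar>\<kappa>\<bar> * w \<le> 1 / 2 / 2" using \<kappa>w by linarith
    define e where "e = ?B * ((\<bar>\<kappa>\<bar> * w) * exp_moment (1 / 2 / 2) 1 + w\<^sup>2 / (2 * (N * s2)) * exp_moment (1 / 2 / 2) 2)"
    have e_eq: "e = ?B * ((\<bar>\<kappa>\<bar> * w) * I 1 + w\<^sup>2 / (2 * (N * s2)) * I 2)" unfolding e_def I_def by simp
    have w_s2: "w\<^sup>2 / (2 * (N * s2)) \<le> 6 / ?d * (1 / N)"
    proof -
      have "w\<^sup>2 / (2 * (N * s2)) \<le> w\<^sup>2 / (2 * (N * b))"
        using s2 b N by (intro divide_left_mono mult_left_mono mult_pos_pos) auto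
      also have "\<dots> = 6 / ?d * (1 / N)" unfolding b_def using w T.d_pos by (simp add: field_simps)
      finally show ?thesis .
    qed
    have "e \<le> ?B * ((6 * M3 / ?d * (w\<^sup>2 / N)) * I 1 + (6 / ?d * (1 / N)) * I 2)"
      unfolding e_eq using \<kappa>w w_s2 I0 T.B_pos by (intro mult_left_mono add_mono mult_right_mono) auto
    also have "\<dots> \<le> ?B * ((6 * M3 / ?d * ((w\<^sup>2 + 1) / N)) * I 1 + (6 / ?d * ((w\<^sup>2 + 1) / N)) * I 2)"
      using I0 T.B_pos T.d_pos M30 N by (intro mult_left_mono add_mono mult_right_mono divide_right_mono) auto
    also have "\<dots> = ?B * (6 * M3 / ?d * I 1 + 6 / ?d * I 2) * ((w\<^sup>2 + 1) / N)" by (simp add: algebra_simps)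
    also have "\<dots> \<le> C * ((w\<^sup>2 + 1) / N)"
      using C0(3) N unfolding d_abs by (intro mult_right_mono) auto
    finally have e_le: "e \<le> C * (w\<^sup>2 + 1) / N" by simp
    have e4: "e \<le> 1 / 4" using e_le small by (rule order_trans)
    have "N * s2 > 0" using N s2 b by simp
    from gauss_tilt_L1[OF w this \<psi>_pos[of t] p_measurable, where t = t and a = "mean t" and B = ?B and c = "1 / 2"
        and d = ?d and \<alpha> = \<alpha> and \<kappa> = \<kappa>, folded tilt_def, folded e_def]
    have v: "(\<forall>x. 0 \<le> gauss_tilt_density p (mean t) (t + \<kappa>) (N * s2) x) \<and>
        integrable lborel (gauss_tilt_density p (mean t) (t + \<kappa>) (N * s2)) \<and>
        (\<integral>x. \<bar>gauss_tilt_density p (mean t) (t + \<kappa>) (N * s2) x - tilt t x\<bar> \<partial>lborel) \<le> 2 * e / (1 - e)"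
      using tame \<kappa>_small e4 by (auto simp del: divide_divide_eq_left divide_divide_eq_right)
    have "2 * e / (1 - e) \<le> 4 * (C * (w\<^sup>2 + 1) / N)"
    proof -
      have "e \<ge> 0" unfolding e_eq using I0 T.B_pos w N s2 b by (intro mult_nonneg_nonneg add_nonneg_nonneg) auto
      then have "2 * e / (1 - e) \<le> 2 * e / (1 / 2)" using e4 by (intro divide_left_mono) auto
      then show ?thesis using e_le by simp
    qed
    then show "let s2 = tilted_variance t; \<mu>3 = third_central_moment t;
          v = gauss_tilt_density p (mean t) (t + \<mu>3 / (2 * N * s2)) (N * s2)
        in (\<forall>x. 0 \<le> v x) \<and> integrable lborel v \<and> (\<integral>x. \<bar>v x - tilt t x\<bar> \<partial>lborel) \<le> 4 * (C * (w\<^sup>2 + 1) / N)"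
      using v unfolding Let_def \<kappa>_def s2_def \<mu>3_def by auto
  qed
qed

text \<open>The bound on \<open>a / (s \<surd>n)\<close> says that \<open>n\<close> is at least of order \<open>a\<^sup>2 / w\<^sup>2\<close>, hence
\<open>w\<^sup>2 / n\<close> is at most of order \<open>w\<^sup>4 / a\<^sup>2 \<le> \<delta>\<^sup>2\<close>.\<close>

lemma scale_vs_sample_size:
  assumes w: "w > 0" and n: "n \<ge> 2" and a: "a > 0" and w2: "w\<^sup>2 \<le> \<delta> * a" and \<delta>: "\<delta> > 0"
    and s2: "0 < s2" "s2 \<le> S * w\<^sup>2" and ratio: "a / (sqrt s2 * sqrt (real n)) \<le> L" and L: "L > 0"
  shows "w\<^sup>2 / (real n - 1) \<le> 2 * \<delta>\<^sup>2 * L\<^sup>2 * S"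
proof -
  have "a \<le> L * (sqrt s2 * sqrt (real n))"
    using ratio s2 n by (simp add: divide_le_eq)
  then have "a\<^sup>2 \<le> (L * (sqrt s2 * sqrt (real n)))\<^sup>2" using a by (intro power_mono) auto
  also have "\<dots> = L\<^sup>2 * s2 * real n" using s2 by (simp add: power_mult_distrib)
  also have "\<dots> \<le> L\<^sup>2 * (S * w\<^sup>2) * real n" using s2 by (intro mult_right_mono mult_left_mono) auto
  finally have a2: "a\<^sup>2 \<le> L\<^sup>2 * S * w\<^sup>2 * real n" by (simp add: mult_ac)
  have "w\<^sup>2 * w\<^sup>2 \<le> (\<delta> * a) * (\<delta> * a)" using w2 \<delta> a by (intro mult_mono) auto
  also have "\<dots> = \<delta>\<^sup>2 * a\<^sup>2" by (simp add: power2_eq_square)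
  also have "\<dots> \<le> \<delta>\<^sup>2 * (L\<^sup>2 * S * w\<^sup>2 * real n)" using a2 by (intro mult_left_mono) auto
  also have "\<dots> = (\<delta>\<^sup>2 * L\<^sup>2 * S * real n) * w\<^sup>2" by (simp add: mult_ac)
  finally have "w\<^sup>2 \<le> \<delta>\<^sup>2 * L\<^sup>2 * S * real n"
    by (rule mult_right_le_imp_le) (use w in simp)
  moreover have "\<delta>\<^sup>2 * L\<^sup>2 * S * real n \<le> \<delta>\<^sup>2 * L\<^sup>2 * S * (2 * (real n - 1))"
  proof -
    have "0 < S * w\<^sup>2" using s2 by linarith
    then have "S > 0" using w by (simp add: zero_less_mult_iff)
    then show ?thesis using n by (intro mult_left_mono) auto
  qed
  moreover have "\<delta>\<^sup>2 * L\<^sup>2 * S * (2 * (real n - 1)) = (2 * \<delta>\<^sup>2 * L\<^sup>2 * S) * (real n - 1)" by simp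
  ultimately have "w\<^sup>2 \<le> (2 * \<delta>\<^sup>2 * L\<^sup>2 * S) * (real n - 1)" by linarith
  then show ?thesis using n by (simp add: divide_le_eq)
qed

end

section \<open>Gibbs conditioning under extreme deviations\<close>

theorem theorem20:
  fixes M :: "'w measure" and X :: "nat \<Rightarrow> 'w \<Rightarrow> real"
    and p g q :: "real \<Rightarrow> real" and a t :: "nat \<Rightarrow> real"
  assumes "prob_space M"
    and "prob_space.indep_vars M (\<lambda>_. borel) X {1..}"
    and "\<And>i. i \<ge> 1 \<Longrightarrow> distributed M lborel (X i) (\<lambda>x. ennreal (p x))"
    and "\<And>x. p x = (if x \<ge> 0 then exp (- (g x - q x)) else 0)"
    and "\<And>x. x \<ge> 0 \<Longrightarrow> g x > 0"
    and "convex_on {0..} g"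
    and "\<And>k x. k < 4 \<Longrightarrow> x > 0 \<Longrightarrow> (deriv ^^ k) g differentiable (at x)"
    and "filterlim (\<lambda>x. g x / x) at_top at_top"
    and "bounded (q ` {0..})"
    and "class_R (deriv g) q"
    and "filterlim a at_top sequentially"
    and "\<forall>\<^sub>F n in sequentially. tilted_mean M (X 1) (t n) = a n"
  shows "(0 < liminf (\<lambda>n. ereal (a n / (tilted_sd M (X 1) (t n) * sqrt (real n)))) \<and>
          limsup (\<lambda>n. ereal (a n / (tilted_sd M (X 1) (t n) * sqrt (real n)))) < \<infinity> \<longrightarrow>
          (\<lambda>n. tv_dist (cond_measure p n (a n)) (gauss_tilt_measure M (X 1) p n (a n) (t n)))
            \<longlonglongrightarrow> 0) \<and>
         ((\<lambda>n. a n / (tilted_sd M (X 1) (t n) * sqrt (real n))) \<longlonglongrightarrow> 0 \<longrightarrow>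
          (\<lambda>n. tv_dist (cond_measure p n (a n)) (tilted_measure M (X 1) p (t n)))
            \<longlonglongrightarrow> 0)"
proof -
  interpret P: prob_space M by fact
  have dist: "distributed M lborel (X 1) (\<lambda>x. ennreal (p x))" using assms(3) by simp
  have p0: "0 \<le> p x" for x by (simp add: assms(4))
  have p_meas [measurable]: "p \<in> borel_measurable borel"
  proof -
    have [measurable]: "(\<lambda>x. ennreal (p x)) \<in> borel_measurable borel"
      using distributed_borel_measurable[OF dist] by simp
    have "(\<lambda>x. enn2real (ennreal (p x))) \<in> borel_measurable borel" by (rule borel_measurable_enn2real) measurable
    then show ?thesis unfolding enn2real_ennreal[OF p0] .
  qed
  have transfer: "(\<integral>\<omega>. f (X 1 \<omega>) \<partial>M) = (\<integral>x. p x * f x \<partial>lborel)" if "f \<in> borel_measurable borel" for f :: "real \<Rightarrow> real"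
    using distributed_integral[OF dist, of f] that p0 by simp
  have p_total: "(\<integral>x. p x \<partial>lborel) = 1"
    using transfer[of "\<lambda>_. 1"] by (simp add: P.prob_space)
  obtain Q where Q: "\<And>x. x \<ge> 0 \<Longrightarrow> \<bar>q x\<bar> \<le> Q"
    using assms(9) unfolding bounded_iff by auto
  interpret almost_log_concave g q p Q
  proof
    show "g differentiable (at x)" "deriv g differentiable (at x)" if "x > 0" for x
      using assms(7)[of 0 x] assms(7)[of 1 x] that by simp_all
  qed (use assms Q p_meas p_total in auto)
  have mgf: "mgf M (X 1) t = \<psi> 0 t" for t
    unfolding mgf_def \<psi>_def using transfer[of "\<lambda>x. exp (t * x)"] by (simp add: mult.commute)
  have mean: "tilted_mean M (X 1) = mean"
    unfolding tilted_mean_def mgf by (rule ext) (rule DERIV_imp_deriv[OF DERIV_ln_\<psi>])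
  define s2 where "s2 = tilted_variance"
  define \<mu>3 where "\<mu>3 = third_central_moment"
  have deriv_mean: "deriv mean = s2"
    unfolding s2_def by (rule ext) (rule DERIV_imp_deriv[OF DERIV_mean])
  have sd: "tilted_sd M (X 1) t = sqrt (s2 t)" for t
    unfolding tilted_sd_def mean deriv_mean ..
  have mu3: "tilted_mu3 M (X 1) = \<mu>3"
  proof
    fix t
    have "tilted_mu3 M (X 1) t = deriv (deriv (tilted_mean M (X 1))) t"
      unfolding tilted_mu3_def tilted_mean_def by (simp add: numeral_3_eq_3)
    also have "\<dots> = \<mu>3 t"
      unfolding mean deriv_mean unfolding s2_def \<mu>3_def by (rule DERIV_imp_deriv[OF DERIV_variance])
    finally show "tilted_mu3 M (X 1) t = \<mu>3 t" .
  qed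
  have tilted: "tilted_measure M (X 1) p t = density lborel (\<lambda>x. ennreal (tilt t x))" for t
    unfolding tilted_measure_def tilted_density_def mgf tilt_def ..
  have s2_nonneg: "s2 t \<ge> 0" for t
    unfolding s2_def using tilt_nonneg by (intro Bochner_Integration.integral_nonneg) simp
  have gauss: "gauss_tilt_measure M (X 1) p n a t = density lborel (\<lambda>x. ennreal
      (gauss_tilt_density p a (t + \<mu>3 t / (2 * (real n - 1) * s2 t)) ((real n - 1) * s2 t) x))" for n a t
    unfolding gauss_tilt_measure_def Let_def sd mu3 using s2_nonneg by simp
  have a_t: "\<forall>\<^sub>F n in sequentially. a n = mean (t n)"
    using assms(12) unfolding mean by eventually_elim simp
  have t_lim: "filterlim t at_top sequentially"
    unfolding filterlim_at_top_dense
  proof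
    fix T
    have "\<forall>\<^sub>F n in sequentially. mean T < a n"
      using assms(11) unfolding filterlim_at_top_dense by blast
    then show "\<forall>\<^sub>F n in sequentially. T < t n"
      using a_t
    proof eventually_elim
      case (elim n)
      then show ?case using monoD[OF mean_mono, of "t n" T] by linarith
    qed
  qed
  obtain \<eta> where \<eta>: "\<eta> \<longlonglongrightarrow> 0"
    "\<forall>\<^sub>F n in sequentially. \<forall>t w \<alpha>. w > 0 \<longrightarrow>
       tame_at t w \<alpha> \<longrightarrow>
       (\<exists>u. cond_measure p n (mean t) = density lborel (\<lambda>x. ennreal (u x)) \<and> (\<forall>x. 0 \<le> u x) \<and> integrable lborel u
         \<and> (\<integral>x. \<bar>u x - tilt t x\<bar> \<partial>lborel) \<le> \<eta> n)"
    using gibbs_rate by blast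
  have int_tilt: "integrable lborel (tilt t)" for t
    using integrable_tilt_power[of t 0] by simp
  show ?thesis
  proof (intro conjI impI)
    let ?tv = "\<lambda>n. tv_dist (cond_measure p n (a n)) (tilted_measure M (X 1) p (t n))"
    have "\<forall>\<^sub>F n in sequentially. 0 \<le> ?tv n \<and> ?tv n \<le> \<eta> n"
      using \<eta>(2) eventually_compose_filterlim[OF eventually_tame t_lim] a_t
    proof eventually_elim
      case (elim n)
      then obtain u where u: "cond_measure p n (a n) = density lborel (\<lambda>x. ennreal (u x))" "\<And>x. 0 \<le> u x" "integrable lborel u"
        "(\<integral>x. \<bar>u x - tilt (t n) x\<bar> \<partial>lborel) \<le> \<eta> n" by fastforce
      then show ?case
        using tv_dist_density_le[of u "tilt (t n)"] tv_dist_density_nonneg[of u "tilt (t n)"] int_tilt tilt_nonneg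
        unfolding u(1) tilted by (auto intro: order_trans)
    qed
    then have ev: "\<forall>\<^sub>F n in sequentially. 0 \<le> ?tv n" "\<forall>\<^sub>F n in sequentially. ?tv n \<le> \<eta> n"
      by (auto elim: eventually_mono)
    show "?tv \<longlonglongrightarrow> 0"
      by (rule tendsto_sandwich[OF ev tendsto_const \<eta>(1)])
  next
    let ?r = "\<lambda>n. a n / (tilted_sd M (X 1) (t n) * sqrt (real n))"
    let ?tv = "\<lambda>n. tv_dist (cond_measure p n (a n)) (gauss_tilt_measure M (X 1) p n (a n) (t n))"
    assume "0 < liminf (\<lambda>n. ereal (?r n)) \<and> limsup (\<lambda>n. ereal (?r n)) < \<infinity>"
    then have "limsup (\<lambda>n. ereal (?r n)) \<noteq> \<infinity>" by simp
    then have "\<exists>m. limsup (\<lambda>n. ereal (?r n)) < ereal (real m)"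
      by (rule iffD1[OF less_PInf_Ex_of_nat])
    then obtain m where "limsup (\<lambda>n. ereal (?r n)) < ereal (real m)" ..
    then have "\<forall>\<^sub>F n in sequentially. ereal (?r n) < ereal (real m)"
      by (rule Limsup_lessD)
    define L where "L = real m + 1"
    have L: "L > 0" by (simp add: L_def)
    have ratio: "\<forall>\<^sub>F n in sequentially. a n / (sqrt (s2 (t n)) * sqrt (real n)) \<le> L"
      using \<open>\<forall>\<^sub>F n in sequentially. ereal (?r n) < ereal (real m)\<close>
      unfolding sd L_def by eventually_elim simp
    obtain C where C: "C > 0" and gauss_le: "\<And>t w \<alpha> N. w > 0 \<Longrightarrow> N > 0 \<Longrightarrow>
       tame_at t w \<alpha> \<Longrightarrow>
       C * (w\<^sup>2 + 1) / N \<le> 1 / 4 \<Longrightarrow>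
       (let s2 = tilted_variance t; \<mu>3 = third_central_moment t;
          v = gauss_tilt_density p (mean t) (t + \<mu>3 / (2 * N * s2)) (N * s2)
        in (\<forall>x. 0 \<le> v x) \<and> integrable lborel v \<and> (\<integral>x. \<bar>v x - tilt t x\<bar> \<partial>lborel) \<le> 4 * (C * (w\<^sup>2 + 1) / N))"
      by (rule gauss_tilt_rate) (rule that)
    define S where "S = \<bar>tail_const Q * exp_moment (1 / 2) 2\<bar> + 1"
    have S: "S > 0" by (simp add: S_def)
    \<comment> \<open>Both laws are compared with the tilted one; \<open>\<delta>\<close> below is chosen such that the term with \<open>w\<^sup>2\<close> in the error of the Gaussian tilt is at most \<open>\<epsilon> / 2\<close>.\<close>
    have main: "\<forall>\<^sub>F n in sequentially. 0 \<le> ?tv n \<and> ?tv n \<le> \<eta> n + 4 * \<epsilon>" if \<epsilon>: "0 < \<epsilon>" "\<epsilon> \<le> 1 / 4" for \<epsilon>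
    proof -
      define \<delta> where "\<delta> = sqrt (\<epsilon> / (4 * C * L\<^sup>2 * S))"
      have \<delta>: "\<delta> > 0" "C * (2 * \<delta>\<^sup>2 * L\<^sup>2 * S) = \<epsilon> / 2" unfolding \<delta>_def using \<epsilon> C L S by auto
      have "\<forall>\<^sub>F n in sequentially. C * (1 / (real n - 1)) \<le> \<epsilon> / 2"
      proof -
        have "(\<lambda>n. C * (1 / (real n - 1))) \<longlonglongrightarrow> 0" by real_asymp
        then have "\<forall>\<^sub>F n in sequentially. C * (1 / (real n - 1)) < \<epsilon> / 2" using \<epsilon> by (intro order_tendstoD) auto
        then show ?thesis by eventually_elim simp
      qed
      moreover have "\<forall>\<^sub>F n in sequentially. a n > 0"
        using assms(11) unfolding filterlim_at_top_dense by blast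
      ultimately show ?thesis
        using \<eta>(2) eventually_compose_filterlim[OF eventually_narrow[OF x_deriv_h_at_top[OF assms(10)] \<delta>(1)] t_lim]
          a_t ratio eventually_ge_at_top[of 2]
      proof eventually_elim
        case (elim n)
        then obtain w \<alpha> where w: "w > 0" and w2: "w\<^sup>2 \<le> \<delta> * mean (t n)"
          and tame: "tame_at (t n) w \<alpha>"
          by blast
        obtain u where u: "cond_measure p n (a n) = density lborel (\<lambda>x. ennreal (u x))" "\<And>x. 0 \<le> u x" "integrable lborel u"
          "(\<integral>x. \<bar>u x - tilt (t n) x\<bar> \<partial>lborel) \<le> \<eta> n"
          using elim(3) w tame elim(5) by fastforce
        have \<sigma>: "0 < s2 (t n)" "s2 (t n) \<le> S * w\<^sup>2"
        proof -
          have "0 < tame_density.\<sigma>2 (rescaled (t n) w)"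
            "tame_density.\<sigma>2 (rescaled (t n) w) \<le> S"
            using tame_density.\<sigma>2_ge[OF tame] tame_density.\<sigma>2_le[OF tame] tame_density.d_pos[OF tame] unfolding S_def by linarith+
          then show "0 < s2 (t n)" "s2 (t n) \<le> S * w\<^sup>2"
            unfolding s2_def tilted_moments(1)[OF w tame] using w by (simp_all add: mult.commute[of S] mult_left_mono)
        qed
        have "w\<^sup>2 / (real n - 1) \<le> 2 * \<delta>\<^sup>2 * L\<^sup>2 * S"
          using scale_vs_sample_size[OF w _ _ _ \<delta>(1) \<sigma>, of n "a n" L] elim w2 L by simp
        then have "C * (w\<^sup>2 / (real n - 1)) \<le> \<epsilon> / 2"
          using C \<delta>(2) by (metis less_imp_le mult_left_mono)
        then have small: "C * (w\<^sup>2 + 1) / (real n - 1) \<le> \<epsilon>"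
        proof -
          have "C * (w\<^sup>2 + 1) / (real n - 1) = C * (w\<^sup>2 / (real n - 1)) + C * (1 / (real n - 1))"
            by (simp add: add_divide_distrib distrib_left)
          then show ?thesis using elim(1) \<open>C * (w\<^sup>2 / (real n - 1)) \<le> \<epsilon> / 2\<close> by linarith
        qed
        define v where "v = gauss_tilt_density p (a n) (t n + \<mu>3 (t n) / (2 * (real n - 1) * s2 (t n))) ((real n - 1) * s2 (t n))"
        have N_pos: "0 < real n - 1" using elim(7) by simp
        have "C * (w\<^sup>2 + 1) / (real n - 1) \<le> 1 / 4" using small \<epsilon>(2) by linarith
        from gauss_le[OF w N_pos tame this]
        have v_all: "(\<forall>x. 0 \<le> v x) \<and> integrable lborel v
            \<and> (\<integral>x. \<bar>v x - tilt (t n) x\<bar> \<partial>lborel) \<le> 4 * (C * (w\<^sup>2 + 1) / (real n - 1))"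
          unfolding Let_def v_def s2_def \<mu>3_def elim(5) .
        then have v: "\<And>x. 0 \<le> v x" "integrable lborel v" by auto
        have v_L1: "(\<integral>x. \<bar>v x - tilt (t n) x\<bar> \<partial>lborel) \<le> 4 * \<epsilon>"
          using v_all small by linarith
        have G: "gauss_tilt_measure M (X 1) p n (a n) (t n) = density lborel (\<lambda>x. ennreal (v x))"
          unfolding gauss v_def ..
        have "(\<integral>x. \<bar>u x - v x\<bar> \<partial>lborel) \<le> (\<integral>x. \<bar>u x - tilt (t n) x\<bar> + \<bar>v x - tilt (t n) x\<bar> \<partial>lborel)"
          using u(3) v(2) int_tilt by (intro integral_mono) auto
        also have "\<dots> \<le> \<eta> n + 4 * \<epsilon>"
          using u(3,4) v(2) v_L1 int_tilt by (subst Bochner_Integration.integral_add) auto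
        finally show ?case
          using tv_dist_density_le[OF u(3,2) v(2,1)] tv_dist_density_nonneg[OF u(3,2) v(2,1)] unfolding u(1) G by auto
      qed
    qed
    show "?tv \<longlonglongrightarrow> 0"
    proof (rule tendstoI)
      fix e :: real assume e: "e > 0"
      define \<epsilon> where "\<epsilon> = min (e / 8) (1 / 4)"
      have \<epsilon>: "0 < \<epsilon>" "\<epsilon> \<le> 1 / 4" "4 * \<epsilon> \<le> e / 2" using e by (auto simp: \<epsilon>_def)
      have "\<forall>\<^sub>F n in sequentially. \<eta> n < e / 2" using \<eta>(1) e by (intro order_tendstoD) auto
      then show "\<forall>\<^sub>F n in sequentially. dist (?tv n) 0 < e"
        using main[OF \<epsilon>(1,2)] by eventually_elim (use \<epsilon>(3) in auto)
    qed
  qed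
qed

end
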